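(* Let $M$ be a two-dimensional manifold, let $X:M\to\mathbb R^3$ be a $C^\infty$ immersion, and let $p$ be an interior point of $M$ that is umbilic. Suppose the curvature germ of $X$ at $p$ is nonconstant. If a continuous labeling $(\kappa_1,\kappa_2)$ of the principal curvatures near $p$ has a secant tangent $L$ at $p$, then the slope of $L$ belongs to $$\mathcal S=\{0,-1,\infty\}\cup\{2j+1,\ (2j+1)^{-1}: j=1,2,\ldots\}.$$
   Context: Choose a unit normal $N$ near $p$ and let $A=-dN$ be the shape operator (tangent spaces identified via $dX$). The point $p$ is umbilic if $A(p)=tI$ for some $t\in\mathbb R$. A continuous labeling $(\kappa_1,\kappa_2)$ of the principal curvatures near $p$ is a pair of continuous real functions near $p$ whose unordered values at each point are the eigenvalues of $A$ (with multiplicity); no ordering $\kappa_1\ge\kappa_2$ and no continuous principal direction fields are required. Put $v(q)=(\kappa_1(q)-t,\kappa_2(q)-t)\in\mathbb R^2$. The curvature germ at $p$ is nonconstant if every neighborhood of $p$ contains a point where $v\neq 0$ (this does not depend on the labeling). The labeling has secant tangent $L$ at $p$ if $L\subset\mathbb R^2$ is a line through the origin and $$\lim_{q\to p,\ v(q)\ne0}\frac{\operatorname{dist}(v(q),L)}{|v(q)|}=0.$$ The slope of $L$ is measured with $\kappa_1$ as horizontal coordinate and $\kappa_2$ as vertical coordinate; the vertical line has slope $\infty$. *)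

theory Defs
  imports "HOL-Analysis.Analysis"
begin

section \<open>Smooth maps between Euclidean spaces\<close>

text \<open>Meant for open \<open>U\<close>. In finite dimension, requiring every directional derivative to be
  \<open>C\<^sup>k\<close> is the same as requiring the derivative itself to be \<open>C\<^sup>k\<close>.\<close>

primrec Ck_on_open :: "nat \<Rightarrow> 'a::euclidean_space set \<Rightarrow> ('a \<Rightarrow> 'b::euclidean_space) \<Rightarrow> bool" where
  "Ck_on_open 0 U f \<longleftrightarrow> continuous_on U f"
| "Ck_on_open (Suc k) U f \<longleftrightarrow>
     (\<forall>x\<in>U. f differentiable (at x)) \<and>
     (\<forall>v. Ck_on_open k U (\<lambda>x. frechet_derivative f (at x) v))"

text \<open>On a set that need not be open (such as a relatively open subset of a half-plane),
  smooth means: locally the restriction of a smooth map defined on an open set.\<close>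

definition smooth_on :: "'a::euclidean_space set \<Rightarrow> ('a \<Rightarrow> 'b::euclidean_space) \<Rightarrow> bool" where
  "smooth_on S f \<longleftrightarrow>
     (\<forall>x\<in>S. \<exists>U g. open U \<and> x \<in> U \<and> (\<forall>k. Ck_on_open k U g) \<and> (\<forall>y\<in>S \<inter> U. g y = f y))"


section \<open>Smooth surfaces, possibly with boundary\<close>

text \<open>A chart is a pair \<open>(U, \<phi>)\<close> of a domain and a coordinate map; outside \<open>U\<close> the values of
  \<open>\<phi>\<close> are irrelevant. An atlas is not required to be maximal.\<close>

type_synonym 'a chart = "'a set \<times> ('a \<Rightarrow> real^2)"

abbreviation dom_of :: "'a chart \<Rightarrow> 'a set" where
  "dom_of c \<equiv> fst c"

abbreviation coord :: "'a chart \<Rightarrow> 'a \<Rightarrow> real^2" where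
  "coord c \<equiv> snd c"

definition half_plane :: "(real^2) set" where
  "half_plane = {x. x $ 2 \<ge> 0}"

definition is_chart :: "'a topology \<Rightarrow> 'a chart \<Rightarrow> bool" where
  "is_chart M c \<longleftrightarrow>
     openin M (dom_of c) \<and>
     (open (coord c ` dom_of c) \<or> openin (top_of_set half_plane) (coord c ` dom_of c)) \<and>
     homeomorphic_map (subtopology M (dom_of c)) (top_of_set (coord c ` dom_of c)) (coord c)"

definition coord_rep :: "'a chart \<Rightarrow> ('a \<Rightarrow> 'b) \<Rightarrow> real^2 \<Rightarrow> 'b" where
  "coord_rep c f = f \<circ> inv_into (dom_of c) (coord c)"

definition smooth_surface :: "'a topology \<Rightarrow> 'a chart set \<Rightarrow> bool" where
  "smooth_surface M \<A> \<longleftrightarrow>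
     Hausdorff_space M \<and> second_countable M \<and>
     (\<forall>c\<in>\<A>. is_chart M c) \<and> (\<Union>c\<in>\<A>. dom_of c) = topspace M \<and>
     (\<forall>c\<in>\<A>. \<forall>d\<in>\<A>. smooth_on (coord c ` (dom_of c \<inter> dom_of d)) (coord_rep c (coord d)))"

definition interior_point :: "'a chart set \<Rightarrow> 'a \<Rightarrow> bool" where
  "interior_point \<A> p \<longleftrightarrow>
     (\<exists>c\<in>\<A>. p \<in> dom_of c \<and> coord c p \<in> interior (coord c ` dom_of c))"

definition smooth_map_on :: "'a chart set \<Rightarrow> 'a set \<Rightarrow> ('a \<Rightarrow> 'b::euclidean_space) \<Rightarrow> bool" where
  "smooth_map_on \<A> W f \<longleftrightarrow>
     (\<forall>c\<in>\<A>. smooth_on (coord c ` (dom_of c \<inter> W)) (coord_rep c f))"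

text \<open>The differential at \<open>q\<close> in the chart \<open>c\<close>. Taking the derivative within the image of the chart
  also covers boundary points; it is unique because that image is relatively open in the plane
  or in a half-plane.\<close>

definition coord_deriv ::
  "'a chart \<Rightarrow> ('a \<Rightarrow> 'b::euclidean_space) \<Rightarrow> 'a \<Rightarrow> real^2 \<Rightarrow> 'b" where
  "coord_deriv c f q =
     frechet_derivative (coord_rep c f) (at (coord c q) within coord c ` dom_of c)"

definition smooth_immersion :: "'a topology \<Rightarrow> 'a chart set \<Rightarrow> ('a \<Rightarrow> real^3) \<Rightarrow> bool" where
  "smooth_immersion M \<A> X \<longleftrightarrow>
     smooth_map_on \<A> (topspace M) X \<and>
     (\<forall>c\<in>\<A>. \<forall>q\<in>dom_of c. inj (coord_deriv c X q))"


section \<open>Shape operator, umbilics, principal curvatures\<close>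

definition unit_normal_near ::
  "'a topology \<Rightarrow> 'a chart set \<Rightarrow> ('a \<Rightarrow> real^3) \<Rightarrow> 'a \<Rightarrow> ('a \<Rightarrow> real^3) \<Rightarrow> bool" where
  "unit_normal_near M \<A> X p N \<longleftrightarrow>
     (\<exists>W. openin M W \<and> p \<in> W \<and> smooth_map_on \<A> W N \<and>
        (\<forall>q\<in>W. norm (N q) = 1 \<and>
           (\<forall>c\<in>\<A>. q \<in> dom_of c \<longrightarrow> (\<forall>u. N q \<bullet> coord_deriv c X q u = 0))))"

text \<open>The shape operator \<open>A = -dN\<close>, with \<open>dX\<close> identifying \<open>T\<^sub>qM\<close> with its image in space, is the
  endomorphism of \<open>T\<^sub>qM\<close> such that \<open>dX (A u) = -dN u\<close>. Below is its matrix in the coordinate basis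
  of the chart \<open>c\<close>; other charts give similar matrices.\<close>

definition shape_operator ::
  "('a \<Rightarrow> real^3) \<Rightarrow> ('a \<Rightarrow> real^3) \<Rightarrow> 'a chart \<Rightarrow> 'a \<Rightarrow> real^2^2" where
  "shape_operator X N c q =
     (THE A. \<forall>u. coord_deriv c X q (A *v u) = - coord_deriv c N q u)"

definition umbilic_at ::
  "'a chart set \<Rightarrow> ('a \<Rightarrow> real^3) \<Rightarrow> ('a \<Rightarrow> real^3) \<Rightarrow> 'a \<Rightarrow> real \<Rightarrow> bool" where
  "umbilic_at \<A> X N p t \<longleftrightarrow> (\<forall>c\<in>\<A>. p \<in> dom_of c \<longrightarrow> shape_operator X N c p = mat t)"

definition eigenvalues_with_mult :: "real^2^2 \<Rightarrow> real \<Rightarrow> real \<Rightarrow> bool" where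
  "eigenvalues_with_mult A a b \<longleftrightarrow> (\<forall>x. det (mat x - A) = (x - a) * (x - b))"

definition continuous_labeling_near ::
  "'a topology \<Rightarrow> 'a chart set \<Rightarrow> ('a \<Rightarrow> real^3) \<Rightarrow> ('a \<Rightarrow> real^3) \<Rightarrow> 'a \<Rightarrow>
     ('a \<Rightarrow> real) \<Rightarrow> ('a \<Rightarrow> real) \<Rightarrow> bool" where
  "continuous_labeling_near M \<A> X N p \<kappa>1 \<kappa>2 \<longleftrightarrow>
     (\<exists>V. openin M V \<and> p \<in> V \<and>
        continuous_map (subtopology M V) euclideanreal \<kappa>1 \<and>
        continuous_map (subtopology M V) euclideanreal \<kappa>2 \<and>
        (\<forall>q\<in>V. \<forall>c\<in>\<A>. q \<in> dom_of c \<longrightarrow>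
           eigenvalues_with_mult (shape_operator X N c q) (\<kappa>1 q) (\<kappa>2 q)))"

definition curvature_deviation ::
  "('a \<Rightarrow> real) \<Rightarrow> ('a \<Rightarrow> real) \<Rightarrow> real \<Rightarrow> 'a \<Rightarrow> real^2" where
  "curvature_deviation \<kappa>1 \<kappa>2 t q = vector [\<kappa>1 q - t, \<kappa>2 q - t]"

definition nonconstant_germ ::
  "'a topology \<Rightarrow> 'a \<Rightarrow> ('a \<Rightarrow> real) \<Rightarrow> ('a \<Rightarrow> real) \<Rightarrow> real \<Rightarrow> bool" where
  "nonconstant_germ M p \<kappa>1 \<kappa>2 t \<longleftrightarrow>
     (\<forall>U. openin M U \<and> p \<in> U \<longrightarrow> (\<exists>q\<in>U. curvature_deviation \<kappa>1 \<kappa>2 t q \<noteq> 0))"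


section \<open>Secant tangents and slopes\<close>

definition line_through_origin :: "(real^2) set \<Rightarrow> bool" where
  "line_through_origin L \<longleftrightarrow> subspace L \<and> dim L = 1"

text \<open>\<^const>\<open>atin_within\<close> excludes \<open>p\<close> itself, but the deviation vanishes there at an umbilic.\<close>

definition secant_tangent ::
  "'a topology \<Rightarrow> 'a \<Rightarrow> ('a \<Rightarrow> real) \<Rightarrow> ('a \<Rightarrow> real) \<Rightarrow> real \<Rightarrow> (real^2) set \<Rightarrow> bool" where
  "secant_tangent M p \<kappa>1 \<kappa>2 t L \<longleftrightarrow>
     line_through_origin L \<and>
     (let v = curvature_deviation \<kappa>1 \<kappa>2 t in
       ((\<lambda>q. infdist (v q) L / norm (v q)) \<longlongrightarrow> 0) (atin_within M p {q. v q \<noteq> 0}))"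

text \<open>Meaningful for lines through the origin; the single slope of the vertical line is \<open>\<infinity>\<close>.\<close>

definition slope :: "(real^2) set \<Rightarrow> ereal" where
  "slope L = (if \<forall>x\<in>L. x $ 1 = 0 then \<infinity> else ereal (THE m. \<forall>x\<in>L. x $ 2 = m * x $ 1))"

definition admissible_slopes :: "ereal set" where
  "admissible_slopes =
     {0, -1, \<infinity>} \<union> (\<Union>j\<in>{1::nat..}. {ereal (2 * real j + 1), ereal (1 / (2 * real j + 1))})"

end

theory Submission
  imports Defs "HOL-Real_Asymp.Real_Asymp" "HOL-Computational_Algebra.Fundamental_Theorem_Algebra"
begin

text \<open>Project \<open>N + tX\<close> to the tangent plane at \<open>p\<close> and read it in coordinates in which \<open>dX(p)\<close> is
  isometric. The resulting plane map \<open>G\<close> has a differential close to \<open>-(A - tI)\<close>: it is nearly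
  symmetric, with eigenvalues close to those of \<open>-(A - tI)\<close>. If the slope \<open>m\<close> of \<open>L\<close> is none of \<open>0\<close>,
  \<open>-1\<close>, \<open>\<infinity>\<close>, then \<open>G\<close> or its complex conjugate is quasiregular near \<open>p\<close>. A smooth quasiregular map
  vanishing to infinite order is locally zero, so \<open>G - G(p)\<close> has a nonzero leading Taylor form, and
  this is the gradient of a binary form \<open>F\<close> of degree at least 3 whose Hessian has eigenvalues in
  constant ratio \<open>m\<close>. In the variables \<open>z\<close> and \<open>w = cnj z\<close> the ratio condition reads
  \<open>F\<^sub>z\<^sub>z F\<^sub>w\<^sub>w = c\<^sup>2 F\<^sub>z\<^sub>w\<^sup>2\<close> with \<open>c = (1 - m) / (1 + m)\<close>, and for \<open>c\<^sup>2 \<noteq> 1\<close> its only real solutions are the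
  multiples of \<open>(z w)\<^sup>j\<^sup>+\<^sup>1\<close>, for which \<open>c = \<plusminus> j / (j + 1)\<close>.\<close>

section \<open>Flat quasiregular maps in polar coordinates\<close>

text \<open>The principal curvatures need not be differentiable at p, and the secant condition
  controls them only up to o(|v|), so they cannot be Taylor expanded. The condition enters through
  (k' - m k)(k - m k'), where k and k' are the two deviations; this is a polynomial in the trace and
  determinant of A - tI, which \<open>G\<close> recovers up to small relative errors. The main
  obstacle is a germ that is nonconstant but flat, with no leading form to analyse. Unique
  continuation is therefore proved directly, in logarithmic polar coordinates, from a weighted flux
  through circles. Its derivative in s is a weighted integral of the Jacobian, which by
  quasiregularity dominates the squared gradient. A weight adapted to ln(1 - ln rho) yields a
  zero-free circle near any nonzero value; a weight adapted to ln rho shows that flatness forbids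
  zero-free circles. The slopes 0, -1 and infinity are admissible without argument: for 0 and
  infinity the Jacobian may degenerate and quasiregularity fails, and for -1 the leading forms may
  be harmonic of any degree.\<close>

lemma integral_square_bound:
  fixes f :: "real \<Rightarrow> real"
  assumes "continuous_on {a..b} f" "a \<le> b"
  shows "(integral {a..b} f)\<^sup>2 \<le> (b - a) * integral {a..b} (\<lambda>x. (f x)\<^sup>2)"
proof (cases "a = b")
  case True then show ?thesis by simp
next
  case False
  with assms have ab: "b - a > 0" by simp
  define c where "c = integral {a..b} f / (b - a)"
  with ab have I: "integral {a..b} f = c * (b - a)" by simp
  have i1: "f integrable_on {a..b}" "(\<lambda>x. (f x)\<^sup>2) integrable_on {a..b}"
    using assms by (auto intro!: integrable_continuous_real continuous_intros)
  \<comment> \<open>Expanding the variance of \<open>f\<close> about its mean \<open>c\<close> gives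
    the Cauchy-Schwarz inequality against the constant 1.\<close>
  have "0 \<le> integral {a..b} (\<lambda>x. (f x - c)\<^sup>2)"
    by (intro integral_nonneg integrable_continuous_real continuous_intros assms) auto
  also have "(\<lambda>x. (f x - c)\<^sup>2) = (\<lambda>x. (f x)\<^sup>2 - 2 * c * f x + c\<^sup>2)"
    by (auto simp: power2_eq_square algebra_simps)
  also have "integral {a..b} \<dots> = integral {a..b} (\<lambda>x. (f x)\<^sup>2) - 2 * c * integral {a..b} f + c\<^sup>2 * (b - a)"
  proof (rule integral_unique)
    have "((\<lambda>x. c\<^sup>2) has_integral c\<^sup>2 * (b - a)) {a..b}"
      using has_integral_const_real[of "c\<^sup>2" a b] assms(2) by (simp add: mult.commute)
    then show "((\<lambda>x. (f x)\<^sup>2 - 2 * c * f x + c\<^sup>2) has_integral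
        integral {a..b} (\<lambda>x. (f x)\<^sup>2) - 2 * c * integral {a..b} f + c\<^sup>2 * (b - a)) {a..b}"
      using i1 by (intro has_integral_add has_integral_diff has_integral_mult_right integrable_integral)
  qed
  also have "\<dots> = integral {a..b} (\<lambda>x. (f x)\<^sup>2) - c\<^sup>2 * (b - a)"
    unfolding I by (simp add: power2_eq_square algebra_simps)
  finally have "(b - a) * (c\<^sup>2 * (b - a)) \<le> (b - a) * integral {a..b} (\<lambda>x. (f x)\<^sup>2)"
    using ab by (intro mult_left_mono) auto
  then show ?thesis by (simp add: I power2_eq_square algebra_simps)
qed

text \<open>\<open>g s \<theta>\<close> stands for \<open>f (exp (s + \<i> \<theta>))\<close>; \<open>gs\<close>, \<open>gt\<close>, \<open>gst\<close> are its partial derivatives.\<close>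

locale quasiregular_polar =
  fixes g gs gt gst :: "real \<Rightarrow> real \<Rightarrow> complex" and S K :: real
  assumes deriv_s: "s < S \<Longrightarrow> ((\<lambda>s. g s \<theta>) has_vector_derivative gs s \<theta>) (at s)"
    and deriv_t: "s < S \<Longrightarrow> (g s has_vector_derivative gt s \<theta>) (at \<theta>)"
    and deriv_ts: "s < S \<Longrightarrow> ((\<lambda>s. gt s \<theta>) has_vector_derivative gst s \<theta>) (at s)"
    and deriv_st: "s < S \<Longrightarrow> (gs s has_vector_derivative gst s \<theta>) (at \<theta>)"
    and cont_g: "continuous_on ({..<S} \<times> UNIV) (\<lambda>(s, \<theta>). g s \<theta>)"
    and cont_gs: "continuous_on ({..<S} \<times> UNIV) (\<lambda>(s, \<theta>). gs s \<theta>)"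
    and cont_gt: "continuous_on ({..<S} \<times> UNIV) (\<lambda>(s, \<theta>). gt s \<theta>)"
    and cont_gst: "continuous_on ({..<S} \<times> UNIV) (\<lambda>(s, \<theta>). gst s \<theta>)"
    and periodic: "g s (\<theta> + 2 * pi) = g s \<theta>" "gs s (\<theta> + 2 * pi) = gs s \<theta>"
    and K_pos: "K > 0"
    and g_small: "s < S \<Longrightarrow> norm (g s \<theta>) \<le> 1 / 2" and gt_small: "s < S \<Longrightarrow> norm (gt s \<theta>) \<le> 1"
    and quasiregular: "s < S \<Longrightarrow> (norm (gs s \<theta>))\<^sup>2 + (norm (gt s \<theta>))\<^sup>2 \<le> K * Im (cnj (gs s \<theta>) * gt s \<theta>)"
begin

section \<open>Weighted flux through circles and its monotonicity\<close>

definition rho :: "real \<Rightarrow> real \<Rightarrow> real" where "rho s \<theta> = (norm (g s \<theta>))\<^sup>2"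
definition jac :: "real \<Rightarrow> real \<Rightarrow> real" where "jac s \<theta> = Im (cnj (gs s \<theta>) * gt s \<theta>)"
text \<open>For \<open>F = 1\<close> this is twice the signed area enclosed by the image of the
  circle. The weight acts on the target, through \<open>rho\<close>, so that one derivative formula
  serves both estimates below.\<close>

definition flux :: "(real \<Rightarrow> real) \<Rightarrow> real \<Rightarrow> real" where
  "flux F s = integral {0..2*pi} (\<lambda>\<theta>. F (rho s \<theta>) * Im (cnj (g s \<theta>) * gt s \<theta>))"

lemma rho_nonneg: "rho s \<theta> \<ge> 0" by (simp add: rho_def)

text \<open>The value 1/4 leaves room for a regularisation d \<le> 1/4: then rho + d is at most 1/2,
  and 1 - ln(rho + d) is at least 1.\<close>

lemma rho_le: "s < S \<Longrightarrow> rho s \<theta> \<le> 1 / 4"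
  using power_mono[OF g_small norm_ge_zero, of s \<theta> 2] by (simp add: rho_def power2_eq_square)

lemma rho_le_1: "s < S \<Longrightarrow> rho s \<theta> \<le> 1"
  using rho_le[of s \<theta>] by simp

lemma jac_bound: "s < S \<Longrightarrow> (norm (gs s \<theta>))\<^sup>2 + (norm (gt s \<theta>))\<^sup>2 \<le> K * jac s \<theta>"
  using quasiregular by (simp add: jac_def)

lemma jac_nonneg: "s < S \<Longrightarrow> 0 \<le> jac s \<theta>"
proof -
  assume "s < S"
  then have "0 \<le> K * jac s \<theta>" using jac_bound[of s \<theta>] by (smt (verit) zero_le_power2)
  then show ?thesis using K_pos by (simp add: zero_le_mult_iff)
qed

lemma cont_compose:
  assumes "continuous_on A p" "continuous_on A q" "\<And>x. x \<in> A \<Longrightarrow> p x < S"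
  shows "continuous_on A (\<lambda>x. g (p x) (q x))" "continuous_on A (\<lambda>x. gs (p x) (q x))"
    "continuous_on A (\<lambda>x. gt (p x) (q x))" "continuous_on A (\<lambda>x. gst (p x) (q x))"
    "continuous_on A (\<lambda>x. rho (p x) (q x))" "continuous_on A (\<lambda>x. jac (p x) (q x))"
proof -
  have *: "continuous_on A (\<lambda>x. (p x, q x))" "(\<lambda>x. (p x, q x)) ` A \<subseteq> {..<S} \<times> UNIV"
    using assms by (auto intro!: continuous_intros)
  note c = continuous_on_compose2[OF _ *]
  show 1: "continuous_on A (\<lambda>x. g (p x) (q x))" using c[OF cont_g] by simp
  show 2: "continuous_on A (\<lambda>x. gs (p x) (q x))" using c[OF cont_gs] by simp
  show 3: "continuous_on A (\<lambda>x. gt (p x) (q x))" using c[OF cont_gt] by simp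
  show "continuous_on A (\<lambda>x. gst (p x) (q x))" using c[OF cont_gst] by simp
  show "continuous_on A (\<lambda>x. rho (p x) (q x))" unfolding rho_def by (intro continuous_intros 1)
  show "continuous_on A (\<lambda>x. jac (p x) (q x))" unfolding jac_def by (intro continuous_intros 2 3)
qed

lemma rho_deriv_s:
  "s < S \<Longrightarrow> ((\<lambda>s. rho s \<theta>) has_real_derivative 2 * Re (cnj (g s \<theta>) * gs s \<theta>)) (at s)"
  unfolding rho_def cmod_power2 by (auto intro!: derivative_eq_intros deriv_s)

lemma rho_deriv_t:
  "s < S \<Longrightarrow> (rho s has_real_derivative 2 * Re (cnj (g s \<theta>) * gt s \<theta>)) (at \<theta>)"
  unfolding rho_def[abs_def] cmod_power2 by (auto intro!: derivative_eq_intros deriv_t)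

text \<open>Stokes: the exterior derivative of \<open>F(\<rho>) Im (cnj g dg)\<close> is \<open>2 (\<rho> F(\<rho>))' jac ds d\<theta>\<close>.\<close>

lemma flux_deriv:
  assumes chi: "\<And>x. 0 \<le> x \<Longrightarrow> x \<le> 1 \<Longrightarrow> (F has_real_derivative F' x) (at x)"
    and chi': "continuous_on {0..1} F'" and s: "s < S"
  shows "(flux F has_real_derivative
    integral {0..2*pi} (\<lambda>\<theta>. 2 * (F (rho s \<theta>) + rho s \<theta> * F' (rho s \<theta>)) * jac s \<theta>)) (at s)"
proof -
  have cchi: "continuous_on {0..1} F"
    using chi by (meson DERIV_continuous_on atLeastAtMost_iff has_field_derivative_at_within)
  define D where "D s \<theta> = F' (rho s \<theta>) * (2 * Re (cnj (g s \<theta>) * gs s \<theta>)) * Im (cnj (g s \<theta>) * gt s \<theta>)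
     + F (rho s \<theta>) * (Im (cnj (gs s \<theta>) * gt s \<theta>) + Im (cnj (g s \<theta>) * gst s \<theta>))" for s \<theta>
  \<comment> \<open>The ds-coefficient of the one-form whose d\<theta>-coefficient is the flux
    integrand. It is periodic, so \<open>Q'\<close> integrates to 0 and may be subtracted from
    \<open>D\<close>; this cancels the mixed derivative \<open>gst\<close> and leaves a multiple of
    \<open>jac\<close>.\<close>
  define Q where "Q \<theta> = F (rho s \<theta>) * Im (cnj (g s \<theta>) * gs s \<theta>)" for \<theta>
  define Q' where "Q' \<theta> = F' (rho s \<theta>) * (2 * Re (cnj (g s \<theta>) * gt s \<theta>)) * Im (cnj (g s \<theta>) * gs s \<theta>)
     + F (rho s \<theta>) * (Im (cnj (gt s \<theta>) * gs s \<theta>) + Im (cnj (g s \<theta>) * gst s \<theta>))" for \<theta>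
  have c_comp: "continuous_on A (\<lambda>x. F (rho (p x) (q x)))" "continuous_on A (\<lambda>x. F' (rho (p x) (q x)))"
    if "continuous_on A p" "continuous_on A q" "\<And>x. x \<in> A \<Longrightarrow> p x < S" for A :: "'z::topological_space set" and p q
    using continuous_on_compose2[OF cchi cont_compose(5)[OF that]]
      continuous_on_compose2[OF chi' cont_compose(5)[OF that]] rho_nonneg rho_le_1[OF that(3)]
    by (auto simp: image_subset_iff)
  have "((\<lambda>s. integral (cbox 0 (2*pi)) (\<lambda>\<theta>. F (rho s \<theta>) * Im (cnj (g s \<theta>) * gt s \<theta>)))
      has_real_derivative integral (cbox 0 (2*pi)) (D s)) (at s within {..<S})"
  proof (rule leibniz_rule_field_derivative)
    fix x \<theta> :: real assume "x \<in> {..<S}"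
    then have x: "x < S" by simp
    have "((\<lambda>s. F (rho s \<theta>)) has_real_derivative F' (rho x \<theta>) * (2 * Re (cnj (g x \<theta>) * gs x \<theta>))) (at x)"
      by (rule DERIV_chain2[where f=F, OF chi[OF rho_nonneg rho_le_1[OF x]] rho_deriv_s[OF x]])
    moreover have "((\<lambda>s. Im (cnj (g s \<theta>) * gt s \<theta>)) has_real_derivative
        Im (cnj (gs x \<theta>) * gt x \<theta>) + Im (cnj (g x \<theta>) * gst x \<theta>)) (at x)"
      by (auto intro!: derivative_eq_intros deriv_s deriv_ts x simp: algebra_simps)
    ultimately have "((\<lambda>s. F (rho s \<theta>) * Im (cnj (g s \<theta>) * gt s \<theta>)) has_real_derivative D x \<theta>) (at x)"
      unfolding D_def by (rule DERIV_cong[OF DERIV_mult]) (simp add: algebra_simps)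
    then show "((\<lambda>s. F (rho s \<theta>) * Im (cnj (g s \<theta>) * gt s \<theta>)) has_real_derivative D x \<theta>) (at x within {..<S})"
      by (rule has_field_derivative_at_within)
  next
    fix x assume "x \<in> {..<S}"
    then show "(\<lambda>\<theta>. F (rho x \<theta>) * Im (cnj (g x \<theta>) * gt x \<theta>)) integrable_on cbox 0 (2 * pi)"
      by (intro integrable_continuous continuous_intros c_comp cont_compose) auto
  next
    show "continuous_on ({..<S} \<times> cbox 0 (2 * pi)) (\<lambda>(s, \<theta>). D s \<theta>)"
      unfolding D_def split_beta
      by (intro continuous_intros c_comp cont_compose) auto
  qed (use s in auto)
  then have 1: "(flux F has_real_derivative integral {0..2*pi} (D s)) (at s)"
    using s by (simp add: flux_def[abs_def] at_within_open[of s "{..<S}"])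
  have Qd: "(Q has_real_derivative Q' \<theta>) (at \<theta>)" for \<theta>
  proof -
    have "((\<lambda>\<theta>. F (rho s \<theta>)) has_real_derivative F' (rho s \<theta>) * (2 * Re (cnj (g s \<theta>) * gt s \<theta>))) (at \<theta>)"
      by (rule DERIV_chain2[where f=F, OF chi[OF rho_nonneg rho_le_1[OF s]] rho_deriv_t[OF s]])
    moreover have "((\<lambda>\<theta>. Im (cnj (g s \<theta>) * gs s \<theta>)) has_real_derivative
        Im (cnj (gt s \<theta>) * gs s \<theta>) + Im (cnj (g s \<theta>) * gst s \<theta>)) (at \<theta>)"
      by (auto intro!: derivative_eq_intros deriv_t deriv_st s simp: algebra_simps)
    ultimately show ?thesis
      unfolding Q_def[abs_def] Q'_def by (rule DERIV_cong[OF DERIV_mult]) (simp add: algebra_simps)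
  qed
  have "(Q' has_integral (Q (2*pi) - Q 0)) {0..2*pi}"
    by (rule fundamental_theorem_of_calculus)
      (auto intro!: has_field_derivative_at_within Qd simp flip: has_real_derivative_iff_has_vector_derivative)
  moreover have "Q (2*pi) = Q 0"
    using periodic[of s 0] by (simp add: Q_def rho_def)
  ultimately have 2: "(Q' has_integral 0) {0..2*pi}" by simp
  have "D s integrable_on {0..2*pi}"
    unfolding D_def using s
    by (intro integrable_continuous_real continuous_intros c_comp cont_compose) auto
  then have "((\<lambda>\<theta>. D s \<theta> - Q' \<theta>) has_integral integral {0..2*pi} (D s) - 0) {0..2*pi}"
    by (intro has_integral_diff 2) (rule integrable_integral)
  moreover have "(\<lambda>\<theta>. D s \<theta> - Q' \<theta>) = (\<lambda>\<theta>. 2 * (F (rho s \<theta>) + rho s \<theta> * F' (rho s \<theta>)) * jac s \<theta>)"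
    unfolding D_def Q'_def jac_def rho_def cmod_power2
    by (rule ext) (simp add: algebra_simps power2_eq_square)
  ultimately show ?thesis using 1 by (metis diff_zero integral_unique)
qed

lemma cont_chi_rho:
  assumes F: "continuous_on {0..1} F" and "s < S"
  shows "continuous_on A (\<lambda>\<theta>. F (rho s \<theta>))"
  using continuous_on_compose2[OF F cont_compose(5)[of A "\<lambda>_. s" "\<lambda>x. x"]] assms rho_nonneg rho_le_1
  by (auto simp: image_subset_iff)

lemma chi_cont:
  assumes "\<And>x. 0 \<le> x \<Longrightarrow> x \<le> 1 \<Longrightarrow> (F has_real_derivative F' x) (at x)"
  shows "continuous_on {0..1::real} F"
  using assms by (meson DERIV_continuous_on atLeastAtMost_iff has_field_derivative_at_within)

lemma flux_le:
  assumes F: "continuous_on {0..1} F" and nonneg: "\<And>x. 0 \<le> x \<Longrightarrow> x \<le> 1 \<Longrightarrow> 0 \<le> F x" and s: "s < S"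
  shows "\<bar>flux F s\<bar> \<le> integral {0..2*pi} (\<lambda>\<theta>. F (rho s \<theta>) * (norm (g s \<theta>) * norm (gt s \<theta>)))"
proof -
  have "norm (flux F s) \<le> integral {0..2*pi} (\<lambda>\<theta>. F (rho s \<theta>) * (norm (g s \<theta>) * norm (gt s \<theta>)))"
    unfolding flux_def
  proof (rule integral_norm_bound_integral)
    fix \<theta>
    have "\<bar>Im (cnj (g s \<theta>) * gt s \<theta>)\<bar> \<le> norm (g s \<theta>) * norm (gt s \<theta>)"
      by (metis abs_Im_le_cmod norm_mult complex_mod_cnj)
    then show "norm (F (rho s \<theta>) * Im (cnj (g s \<theta>) * gt s \<theta>)) \<le> F (rho s \<theta>) * (norm (g s \<theta>) * norm (gt s \<theta>))"
      using nonneg[OF rho_nonneg rho_le_1[OF s], of \<theta>]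
      by (simp add: abs_mult mult_left_mono)
  qed (use s in \<open>auto intro!: integrable_continuous_real continuous_intros cont_chi_rho F cont_compose\<close>)
  then show ?thesis by simp
qed

text \<open>The quantity in \<open>pos\<close> is the derivative of x F(x), the factor in front of
  \<open>jac\<close> in \<open>flux_deriv\<close>; values of \<open>rho\<close> stay in the range
  where it is nonnegative.\<close>

lemma flux_mono:
  assumes chi: "\<And>x. 0 \<le> x \<Longrightarrow> x \<le> 1 \<Longrightarrow> (F has_real_derivative F' x) (at x)"
    and chi': "continuous_on {0..1} F'"
    and pos: "\<And>x. 0 \<le> x \<Longrightarrow> x \<le> 1/4 \<Longrightarrow> 0 \<le> F x + x * F' x" and s: "s \<le> s'" "s' < S"
  shows "flux F s \<le> flux F s'"
proof (rule DERIV_nonneg_imp_nondecreasing[OF s(1)])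
  fix x assume "s \<le> x" "x \<le> s'"
  then have x: "x < S" using s by simp
  let ?D = "integral {0..2*pi} (\<lambda>\<theta>. 2 * (F (rho x \<theta>) + rho x \<theta> * F' (rho x \<theta>)) * jac x \<theta>)"
  have "0 \<le> ?D"
    using x by (intro integral_nonneg integrable_continuous_real continuous_intros cont_chi_rho
        chi' chi_cont[OF chi] cont_compose mult_nonneg_nonneg pos jac_nonneg rho_nonneg rho_le) auto
  then show "\<exists>y. (flux F has_real_derivative y) (at x) \<and> 0 \<le> y"
    using flux_deriv[OF chi chi' x] by blast
qed

end

text \<open>The \<open>n\<close> in \<open>flat\<close> is implicitly universal: this is vanishing
  of infinite order at the puncture, which lies at s = -infinity. The threshold \<open>s1\<close>
  may depend on \<open>n\<close>.\<close>

locale flat_quasiregular_polar = quasiregular_polar +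
  assumes flat: "\<exists>s1. \<forall>s\<le>s1. \<forall>\<theta>. norm (g s \<theta>) \<le> exp (real n * s)"
begin

text \<open>The flux increases with s and tends to 0 as s goes to -infinity: flatness of order 1,
  the bound on \<open>gt\<close> and an upper bound B of F make it at most 2 pi B exp s.\<close>

lemma flux_nonneg:
  assumes chi: "\<And>x. 0 \<le> x \<Longrightarrow> x \<le> 1 \<Longrightarrow> (F has_real_derivative F' x) (at x)"
    and chi': "continuous_on {0..1} F'"
    and nonneg: "\<And>x. 0 \<le> x \<Longrightarrow> x \<le> 1 \<Longrightarrow> 0 \<le> F x"
    and pos: "\<And>x. 0 \<le> x \<Longrightarrow> x \<le> 1/4 \<Longrightarrow> 0 \<le> F x + x * F' x" and s: "s < S"
  shows "0 \<le> flux F s"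
proof -
  have cF: "continuous_on {0..1} F" by (rule chi_cont[OF chi])
  obtain B where B: "\<And>x. 0 \<le> x \<Longrightarrow> x \<le> 1 \<Longrightarrow> F x \<le> B"
    using continuous_attains_sup[OF compact_Icc _ cF] by (metis atLeastAtMost_iff atLeastatMost_empty_iff zero_le_one)
  have B0: "B \<ge> 0" using B[of 0] nonneg[of 0] by simp
  obtain s1 where s1: "\<And>s \<theta>. s \<le> s1 \<Longrightarrow> norm (g s \<theta>) \<le> exp s"
    using flat[of 1] by auto
  have *: "- (B * 2 * pi) * exp r \<le> flux F s" if r: "r \<le> s1" "r \<le> s" for r
  proof -
    have rS: "r < S" using r s by simp
    have "\<bar>flux F r\<bar> \<le> integral {0..2*pi} (\<lambda>\<theta>. F (rho r \<theta>) * (norm (g r \<theta>) * norm (gt r \<theta>)))"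
      by (rule flux_le[OF cF nonneg rS])
    also have "\<dots> \<le> integral {0..2*pi} (\<lambda>\<theta>. B * (exp r * 1))"
      using rS by (intro integral_le integrable_continuous_real continuous_intros cont_chi_rho cF cont_compose
          mult_mono B s1 gt_small rho_nonneg rho_le_1 B0 mult_nonneg_nonneg) (use r in auto)
    also have "\<dots> = B * 2 * pi * exp r" by simp
    finally have "- (B * 2 * pi) * exp r \<le> flux F r" by simp
    also have "\<dots> \<le> flux F s" by (rule flux_mono[OF chi chi' pos r(2) s])
    finally show ?thesis .
  qed
  have "((\<lambda>r. - (B * 2 * pi) * exp r) \<longlongrightarrow> - (B * 2 * pi) * 0) at_bot"
    by (intro tendsto_intros exp_at_bot)
  moreover have "\<forall>\<^sub>F r in at_bot. - (B * 2 * pi) * exp r \<le> flux F s"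
    using * unfolding eventually_at_bot_linorder by (intro exI[of _ "min s1 s"]) auto
  ultimately have "- (B * 2 * pi) * 0 \<le> flux F s"
    by (rule tendsto_upperbound) simp
  then show ?thesis by simp
qed

end

section \<open>Existence and exclusion of circles free of zeros\<close>

context flat_quasiregular_polar begin

lemma square_integral_circle:
  assumes "continuous_on {0..2*pi} f"
  shows "(integral {0..2*pi} f)\<^sup>2 \<le> 2 * pi * integral {0..2*pi} (\<lambda>x. (f x)\<^sup>2)"
  using integral_square_bound[OF assms] by simp

text \<open>The weight makes \<open>\<rho> F(\<rho>)\<close> a regularisation of \<open>1 / (1 - ln \<rho>)\<close>, for which the flux \<open>\<Phi>\<close> satisfies
  \<open>\<Phi>\<^sup>2 \<le> \<pi> K \<Phi>'\<close> and hence has an interior bound independent of the regularisation \<open>d\<close>. If every circle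
  contained a zero, the oscillation of \<open>ln (1 - ln (\<rho> + d))\<close> along it would force \<open>\<Phi>' \<rightarrow> \<infinity>\<close> as \<open>d \<rightarrow> 0\<close>.\<close>

lemma good_circle:
  assumes ab: "a < b" "b < S" and eps: "\<epsilon> > 0"
    and large: "\<And>s. s \<in> {a..b} \<Longrightarrow> \<exists>\<theta>\<in>{0..2*pi}. \<epsilon> \<le> norm (g s \<theta>)"
  shows "\<exists>s\<in>{a..b}. \<forall>\<theta>\<in>{0..2*pi}. g s \<theta> \<noteq> 0"
proof (rule ccontr)
  assume "\<not> ?thesis"
  then have zero: "\<exists>\<theta>\<in>{0..2*pi}. g s \<theta> = 0" if "s \<in> {a..b}" for s
    using that by blast
  \<comment> \<open>On the interval from \<open>b\<close> to \<open>s1\<close> the inequality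
    \<Phi>^2 \<le> pi K \<Phi>' caps the flux at \<open>b\<close>: a larger flux would blow up
    before \<open>s1\<close>.\<close>
  define s1 where "s1 = (b + S) / 2"
  have s1: "b < s1" "s1 < S" using ab by (auto simp: s1_def)
  \<comment> \<open>A lower bound for the oscillation of ln(1 - ln(rho + d)) on a circle that has a
    zero and a point with |g| \<ge> \<epsilon>. It tends to infinity as d goes to 0.\<close>
  define osc where "osc d = ln (1 - ln d) - ln (1 - ln (\<epsilon>\<^sup>2))" for d :: real
  \<comment> \<open>The left side is 4 pi K (s1 - b) times a lower bound of the flux at
    \<open>b\<close>, which has grown over [a, b] at rate at least osc^2 / (4 pi K); the cap on that
    flux is pi K / (s1 - b).\<close>
  have key: "(b - a) * (s1 - b) * (osc d)\<^sup>2 \<le> (4 * pi * K) * (pi * K)"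
    if d: "0 < d" "d \<le> 1/4" "osc d > 0" for d
  proof -
    define L where "L x = 1 - ln (x + d)" for x
    define F where "F x = 1 / ((x + d) * L x)" for x
    define F' where "F' x = ln (x + d) / ((x + d) * L x)\<^sup>2" for x
    define q where "q s \<theta> = F (rho s \<theta>) * (norm (g s \<theta>) * norm (gt s \<theta>))" for s \<theta>
    have L_pos: "L x > 0" if "0 \<le> x" "x \<le> 1" for x
      using ln_le_minus_one[of "x + d"] that d by (simp add: L_def)
    have L_ge: "L x \<ge> 1" if "0 \<le> x" "x \<le> 1/4" for x
      using that d by (simp add: L_def)
    have chi: "(F has_real_derivative F' x) (at x)" if x: "0 \<le> x" "x \<le> 1" for x
    proof -
      have y: "x + d > 0" using x d by simp
      have "((\<lambda>x. ln (x + d)) has_real_derivative inverse (x + d) * 1) (at x)"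
        by (rule DERIV_chain2[where f=ln and g="\<lambda>x. x + d", OF DERIV_ln[OF y]]) (auto intro!: derivative_eq_intros)
      then have Ld: "(L has_real_derivative 0 - inverse (x + d) * 1) (at x)"
        unfolding L_def[abs_def] by (intro DERIV_diff DERIV_const)
      have "((\<lambda>x. x + d) has_real_derivative 1) (at x)" by (auto intro!: derivative_eq_intros)
      moreover have ne: "(x + d) * L x \<noteq> 0" using L_pos[OF x] y by simp
      ultimately have "((\<lambda>x. inverse ((x + d) * L x)) has_real_derivative
          - ((1 * L x + (0 - inverse (x + d) * 1) * (x + d)) * inverse (((x + d) * L x) ^ Suc (Suc 0)))) (at x)"
        by (intro DERIV_inverse_fun DERIV_mult Ld)
      moreover have "- ((1 * L x + (0 - inverse (x + d) * 1) * (x + d)) * inverse (((x + d) * L x) ^ Suc (Suc 0))) = F' x"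
        using y ne by (simp add: F'_def L_def divide_inverse power2_eq_square)
      ultimately show ?thesis by (simp add: F_def[abs_def] inverse_eq_divide)
    qed
    have cF: "continuous_on {0..1} F" by (rule chi_cont[OF chi])
    have chi': "continuous_on {0..1} F'"
      unfolding F'_def L_def
      by (intro continuous_intros) (use d L_pos in \<open>force simp: L_def\<close>)+
    have F_nonneg: "0 \<le> F x" if "0 \<le> x" "x \<le> 1" for x
      using L_pos[OF that] that d by (auto simp: F_def)
    \<comment> \<open>Substituting ln(x + d) = 1 - L turns the derivative of x F into (d L + x) /
      ((x + d) L)^2, and \<open>L_ge\<close> bounds d L + x below by x + d.\<close>
    have psi': "1 / ((x + d) * (L x)\<^sup>2) \<le> F x + x * F' x" if x: "0 \<le> x" "x \<le> 1/4" for x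
    proof -
      have *: "L x \<ge> 1" "x + d > 0" using L_ge[OF x] x d by auto
      have ln: "ln (x + d) = 1 - L x" by (simp add: L_def)
      have "F x + x * F' x = (d * L x + x) / ((x + d) * L x)\<^sup>2"
        using * unfolding F_def F'_def ln by (simp add: divide_simps power2_eq_square) algebra
      moreover have "(x + d) / ((x + d) * L x)\<^sup>2 \<le> (d * L x + x) / ((x + d) * L x)\<^sup>2"
        using * d by (intro divide_right_mono) auto
      moreover have "(x + d) / ((x + d) * L x)\<^sup>2 = 1 / ((x + d) * (L x)\<^sup>2)"
        using * by (simp add: power2_eq_square)
      ultimately show ?thesis by simp
    qed
    have pos: "0 \<le> F x + x * F' x" if "0 \<le> x" "x \<le> 1/4" for x
      using psi'[OF that] that d by (smt (verit) divide_nonneg_nonneg mult_nonneg_nonneg zero_le_power2)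
    define D where "D s = integral {0..2*pi} (\<lambda>\<theta>. 2 * (F (rho s \<theta>) + rho s \<theta> * F' (rho s \<theta>)) * jac s \<theta>)" for s
    have fd: "(flux F has_real_derivative D s) (at s)" if "s < S" for s
      unfolding D_def by (rule flux_deriv[OF chi chi' that])
    have q_cont: "continuous_on A (q s)" if "s < S" for s A
      unfolding q_def[abs_def] using that
      by (intro continuous_intros cont_chi_rho cF cont_compose) auto
    have q_nonneg: "0 \<le> q s \<theta>" if "s < S" for s \<theta>
      unfolding q_def by (intro mult_nonneg_nonneg F_nonneg rho_nonneg rho_le_1 that) auto
    \<comment> \<open>One factor rho / (rho + d) \<le> 1 is given away; what remains is |gt|^2 times
      exactly the lower bound in \<open>psi'\<close>.\<close>
    have q_sq: "2 * (q s \<theta>)\<^sup>2 \<le> K * (2 * (F (rho s \<theta>) + rho s \<theta> * F' (rho s \<theta>)) * jac s \<theta>)" if s: "s < S" for s \<theta>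
    proof -
      let ?x = "rho s \<theta>"
      have *: "L ?x \<ge> 1" "?x + d > 0" using L_ge[OF rho_nonneg rho_le] rho_nonneg[of s \<theta>] d s by (auto intro: add_nonneg_pos)
      have "(q s \<theta>)\<^sup>2 = (?x / (?x + d)) * (norm (gt s \<theta>))\<^sup>2 * (1 / ((?x + d) * (L ?x)\<^sup>2))"
        using * by (simp add: q_def F_def rho_def power_mult_distrib divide_simps power2_eq_square)
      also have "\<dots> \<le> 1 * (norm (gt s \<theta>))\<^sup>2 * (1 / ((?x + d) * (L ?x)\<^sup>2))"
        using * d rho_nonneg[of s \<theta>] by (intro mult_right_mono) auto
      also have "\<dots> \<le> K * jac s \<theta> * (1 / ((?x + d) * (L ?x)\<^sup>2))"
        using jac_bound[OF s, of \<theta>] zero_le_power2[of "norm (gs s \<theta>)"] *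
        by (intro mult_right_mono) (linarith, simp)
      also have "\<dots> \<le> K * jac s \<theta> * (F ?x + ?x * F' ?x)"
        using K_pos jac_nonneg[OF s, of \<theta>] by (intro mult_left_mono psi'[OF rho_nonneg rho_le[OF s]]) auto
      finally show ?thesis by (simp add: algebra_simps)
    qed
    have int_q: "(integral {0..2*pi} (q s))\<^sup>2 \<le> pi * K * D s" if s: "s < S" for s
    proof -
      have "(integral {0..2*pi} (q s))\<^sup>2 \<le> 2 * pi * integral {0..2*pi} (\<lambda>x. (q s x)\<^sup>2)"
        by (rule square_integral_circle[OF q_cont[OF s]])
      also have "\<dots> = pi * integral {0..2*pi} (\<lambda>x. 2 * (q s x)\<^sup>2)" by simp
      also have "\<dots> \<le> pi * integral {0..2*pi} (\<lambda>\<theta>. K * (2 * (F (rho s \<theta>) + rho s \<theta> * F' (rho s \<theta>)) * jac s \<theta>))"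
        using s by (intro mult_left_mono integral_le q_sq integrable_continuous_real continuous_intros q_cont
            cont_chi_rho cF chi' cont_compose) auto
      finally show ?thesis unfolding D_def integral_mult_right by simp
    qed
    have flux_q: "flux F s \<le> integral {0..2*pi} (q s)" if "s < S" for s
      using flux_le[OF cF F_nonneg that] by (simp add: q_def[abs_def])
    have flux0: "0 \<le> flux F s" if "s < S" for s
      by (rule flux_nonneg[OF chi chi' F_nonneg pos that])
    have osc: "osc d \<le> 2 * integral {0..2*pi} (q s)" if s: "s \<in> {a..b}" for s
    proof -
      have sS: "s < S" using s ab by auto
      obtain \<theta>0 where \<theta>0: "\<theta>0 \<in> {0..2*pi}" "g s \<theta>0 = 0" using zero[OF s] by blast
      obtain \<theta>1 where \<theta>1: "\<theta>1 \<in> {0..2*pi}" "\<epsilon> \<le> norm (g s \<theta>1)" using large[OF s] by blast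
      \<comment> \<open>Its derivative is -F(rho) times that of rho, hence at most 2 q in modulus:
        the same \<open>q\<close> bounds both the flux and the oscillation.\<close>
      define V where "V \<theta> = ln (L (rho s \<theta>))" for \<theta>
      define V' where "V' \<theta> = - (2 * Re (cnj (g s \<theta>) * gt s \<theta>)) * F (rho s \<theta>)" for \<theta>
      have V: "(V has_real_derivative V' \<theta>) (at \<theta>)" for \<theta>
      proof -
        have *: "L (rho s \<theta>) > 0" "rho s \<theta> + d > 0"
          using L_pos[OF rho_nonneg rho_le_1[OF sS]] rho_nonneg[of s \<theta>] d by (auto intro: add_nonneg_pos)
        define r where "r = Re (cnj (g s \<theta>) * gt s \<theta>)"
        have "((\<lambda>\<theta>. rho s \<theta> + d) has_real_derivative 2 * r + 0) (at \<theta>)"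
          unfolding r_def by (intro DERIV_add rho_deriv_t sS DERIV_const)
        from DERIV_chain2[where f=ln, OF DERIV_ln[OF *(2)] this]
        have "((\<lambda>\<theta>. L (rho s \<theta>)) has_real_derivative 0 - inverse (rho s \<theta> + d) * (2 * r + 0)) (at \<theta>)"
          unfolding L_def by (intro DERIV_diff DERIV_const)
        from DERIV_chain2[where f=ln, OF DERIV_ln[OF *(1)] this]
        show ?thesis
          unfolding V_def[abs_def] V'_def F_def r_def[symmetric] by (simp add: divide_inverse ac_simps)
      qed
      have V'_le: "\<bar>V' \<theta>\<bar> \<le> 2 * q s \<theta>" for \<theta>
      proof -
        define r where "r = Re (cnj (g s \<theta>) * gt s \<theta>)"
        have "\<bar>r\<bar> \<le> norm (g s \<theta>) * norm (gt s \<theta>)"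
          unfolding r_def by (metis abs_Re_le_cmod norm_mult complex_mod_cnj)
        then show ?thesis
          using F_nonneg[OF rho_nonneg rho_le_1[OF sS], of \<theta>]
          using mult_right_mono[of "\<bar>r\<bar>" "norm (g s \<theta>) * norm (gt s \<theta>)" "F (rho s \<theta>)"]
          unfolding V'_def r_def[symmetric] by (simp add: q_def abs_mult ac_simps)
      qed
      have seg: "\<bar>V y - V x\<bar> \<le> 2 * integral {0..2*pi} (q s)" if xy: "x \<le> y" "0 \<le> x" "y \<le> 2*pi" for x y
      proof -
        have I: "(V' has_integral (V y - V x)) {x..y}"
          by (rule fundamental_theorem_of_calculus[OF xy(1)])
            (auto intro!: has_field_derivative_at_within V simp flip: has_real_derivative_iff_has_vector_derivative)
        then have "norm (V y - V x) \<le> integral {x..y} (\<lambda>\<theta>. 2 * q s \<theta>)"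
          using integral_norm_bound_integral[of V' "{x..y}" "\<lambda>\<theta>. 2 * q s \<theta>"] V'_le sS
          by (auto simp: integral_unique has_integral_integrable intro!: integrable_continuous_real continuous_intros q_cont)
        also have "\<dots> \<le> integral {0..2*pi} (\<lambda>\<theta>. 2 * q s \<theta>)"
          using xy sS by (intro integral_subset_le integrable_continuous_real continuous_intros q_cont)
            (auto simp: q_nonneg)
        finally show ?thesis by simp
      qed
      have "V \<theta>0 - V \<theta>1 \<le> 2 * integral {0..2*pi} (q s)"
        using seg[of \<theta>0 \<theta>1] seg[of \<theta>1 \<theta>0] \<theta>0(1) \<theta>1(1) by (cases "\<theta>0 \<le> \<theta>1") (auto simp: abs_le_iff)
      moreover have "V \<theta>0 = ln (1 - ln d)" using \<theta>0 by (simp add: V_def L_def rho_def)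
      moreover have "V \<theta>1 \<le> ln (1 - ln (\<epsilon>\<^sup>2))"
      proof -
        have "\<epsilon>\<^sup>2 \<le> rho s \<theta>1 + d"
          using power_mono[OF \<theta>1(2), of 2] eps d unfolding rho_def by linarith
        then have "ln (\<epsilon>\<^sup>2) \<le> ln (rho s \<theta>1 + d)" using eps d rho_nonneg[of s \<theta>1] by (subst ln_le_cancel_iff) auto
        then show ?thesis
          unfolding V_def using L_pos[OF rho_nonneg rho_le_1[OF sS], of \<theta>1] by (simp add: L_def)
      qed
      ultimately show ?thesis by (simp add: osc_def)
    qed
    have D_ge: "(osc d)\<^sup>2 \<le> 4 * pi * K * D s" if s: "s \<in> {a..b}" for s
    proof -
      have sS: "s < S" using s ab by auto
      have "(osc d)\<^sup>2 \<le> (2 * integral {0..2*pi} (q s))\<^sup>2"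
        using osc[OF s] d by (intro power_mono) auto
      then show ?thesis using int_q[OF sS] by (simp add: power_mult_distrib)
    qed
    define c where "c = (osc d)\<^sup>2 / (4 * pi * K)"
    have c: "c > 0" using d K_pos by (simp add: c_def)
    have "flux F a - c * a \<le> flux F b - c * b"
    proof (rule DERIV_nonneg_imp_nondecreasing[of a b])
      fix x assume x: "a \<le> x" "x \<le> b"
      have "((\<lambda>x. flux F x - c * x) has_real_derivative D x - c) (at x)"
        using x ab by (auto intro!: derivative_eq_intros fd)
      moreover have "c \<le> D x" using D_ge[of x] x K_pos by (simp add: c_def field_simps)
      ultimately show "\<exists>y. ((\<lambda>x. flux F x - c * x) has_real_derivative y) (at x) \<and> 0 \<le> y" by fastforce
    qed (use ab in simp)
    then have Fb: "(b - a) * c \<le> flux F b" using flux0[of a] ab by (simp add: algebra_simps)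
    then have Fb0: "flux F b > 0" using c ab by (smt (verit) mult_pos_pos)
    have Fpos: "flux F x > 0" if "b \<le> x" "x \<le> s1" for x
      using flux_mono[OF chi chi' pos that(1)] that s1 Fb0 by simp
    \<comment> \<open>Monotonicity of E integrates the inequality (-1 / flux)' \<ge> 1 / (pi
      K).\<close>
    define E where "E x = - (1 / flux F x) - x / (pi * K)" for x
    have "E b \<le> E s1"
    proof (rule DERIV_nonneg_imp_nondecreasing[of b s1])
      fix x assume x: "b \<le> x" "x \<le> s1"
      then have xS: "x < S" using s1 by simp
      have "(E has_real_derivative (D x / (flux F x)\<^sup>2 - 1 / (pi * K))) (at x)"
        unfolding E_def[abs_def] using Fpos[OF x] K_pos
        by (auto intro!: derivative_eq_intros fd xS simp: power2_eq_square)
      moreover have "(flux F x)\<^sup>2 \<le> pi * K * D x"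
        using power_mono[OF flux_q[OF xS], of 2] int_q[OF xS] Fpos[OF x] by simp
      then have "1 / (pi * K) \<le> D x / (flux F x)\<^sup>2"
        using Fpos[OF x] K_pos by (simp add: field_simps)
      ultimately show "\<exists>y. (E has_real_derivative y) (at x) \<and> 0 \<le> y" by fastforce
    qed (use s1 in simp)
    then have "(s1 - b) / (pi * K) \<le> 1 / flux F b"
      using Fpos[of s1] s1 unfolding E_def by (simp add: diff_divide_distrib) (smt (verit) divide_pos_pos)
    then have "(s1 - b) * flux F b \<le> pi * K"
      using Fb0 K_pos by (simp add: field_simps)
    moreover have "(s1 - b) * ((b - a) * c) \<le> (s1 - b) * flux F b"
      using Fb s1 by (intro mult_left_mono) auto
    ultimately have "(s1 - b) * ((b - a) * c) \<le> pi * K" by simp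
    then show ?thesis using K_pos by (simp add: c_def field_simps)
  qed
  have "LIM d at_right 0. osc d :> at_top"
    unfolding osc_def by real_asymp
  then have lim: "LIM d at_right 0. (b - a) * (s1 - b) * (osc d)\<^sup>2 :> at_top"
    using ab s1 by (intro filterlim_tendsto_pos_mult_at_top[OF tendsto_const] filterlim_pow_at_top) auto
  have "\<forall>\<^sub>F d in at_right 0. (4 * pi * K) * (pi * K) < (b - a) * (s1 - b) * (osc d)\<^sup>2"
    using lim by (simp add: filterlim_at_top_dense)
  moreover have "\<forall>\<^sub>F d in at_right 0. 0 < osc d"
    using \<open>LIM d at_right 0. osc d :> at_top\<close> by (simp add: filterlim_at_top_dense)
  moreover have "\<forall>\<^sub>F d in at_right (0::real). 0 < d \<and> d < 1/4"
    unfolding eventually_at_right_field by (intro exI[of _ "1/4"]) auto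
  ultimately have "\<forall>\<^sub>F d in at_right (0::real). False"
    by eventually_elim (use key in force)
  then show False by simp
qed

text \<open>On a zero-free circle the flux for \<open>\<rho> F(\<rho>) \<approx> ln (1 + \<rho> / d)\<close> is \<open>O(ln (1 / d))\<close>, and it controls the
  energy of \<open>ln (\<rho> + d)\<close> inside. Flatness with \<open>d = exp (2 n s)\<close> makes this energy at least of order
  \<open>n ln (1 / d)\<close>, which is impossible for large \<open>n\<close>.\<close>

lemma no_good_circle:
  assumes s0: "s0 < S" shows "\<exists>\<theta>\<in>{0..2*pi}. g s0 \<theta> = 0"
proof (rule ccontr)
  assume "\<not> ?thesis"
  then have nz: "g s0 \<theta> \<noteq> 0" if "\<theta> \<in> {0..2*pi}" for \<theta> using that by blast
  have "continuous_on {0..2*pi} (\<lambda>\<theta>. norm (g s0 \<theta>))"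
    using s0 by (intro continuous_intros cont_compose) auto
  then obtain \<theta>0 where "\<theta>0 \<in> {0..2*pi}" and min: "\<And>\<theta>. \<theta> \<in> {0..2*pi} \<Longrightarrow> norm (g s0 \<theta>0) \<le> norm (g s0 \<theta>)"
    using continuous_attains_inf[of "{0..2*pi}" "\<lambda>\<theta>. norm (g s0 \<theta>)"] by auto
  define \<epsilon> where "\<epsilon> = norm (g s0 \<theta>0)"
  have eps: "\<epsilon> > 0" using nz[OF \<open>\<theta>0 \<in> _\<close>] by (simp add: \<epsilon>_def)
  have large: "\<epsilon> \<le> norm (g s0 \<theta>)" if "\<theta> \<in> {0..2*pi}" for \<theta>
    using min[OF that] by (simp add: \<epsilon>_def)
  \<comment> \<open>Cauchy-Schwarz between the circles s and s0. The constant combines 12 pi K from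
    \<open>v_sq\<close> with 2 pi ln(1 / d) / \<epsilon> from the flux bound on the circle
    s0.\<close>
  have key: "(w0 - w)\<^sup>2 * \<epsilon> \<le> 24 * pi\<^sup>2 * K * (s0 - s) * ln (1 / d)"
    if d: "0 < d" "d \<le> 1/4" and s: "s < s0"
      and w: "w = integral {0..2*pi} (\<lambda>\<theta>. ln (rho s \<theta> + d))"
      and w0: "w0 = integral {0..2*pi} (\<lambda>\<theta>. ln (rho s0 \<theta> + d))" for s d w w0
  proof -
    \<comment> \<open>The 2 inside the logarithm keeps it above ln 2 \<ge> 2/3, so that (x F)' is
      comparable with 1 / (x + d) even near x = 0; as 2 d + x \<le> 1 on the range of rho, the
      logarithm is still at most ln(1 / d).\<close>
    define F where "F x = ln (2 + x / d) / (x + d)" for x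
    define F' where "F' x = (1 / (2 * d + x)) / (x + d) - ln (2 + x / d) / (x + d)\<^sup>2" for x
    have chi: "(F has_real_derivative F' x) (at x)" if x: "0 \<le> x" "x \<le> 1" for x
    proof -
      have *: "2 + x / d > 0" "x + d > 0" using x d by (auto intro: add_pos_nonneg)
      have "((\<lambda>x. ln (2 + x / d)) has_real_derivative inverse (2 + x / d) * (1 / d)) (at x)"
        by (rule DERIV_chain2[where f=ln and g="\<lambda>x. 2 + x / d", OF DERIV_ln[OF *(1)]])
          (use d in \<open>auto intro!: derivative_eq_intros\<close>)
      moreover have "((\<lambda>x. x + d) has_real_derivative 1) (at x)" by (auto intro!: derivative_eq_intros)
      ultimately have "(F has_real_derivative
          (inverse (2 + x / d) * (1 / d) * (x + d) - ln (2 + x / d) * 1) / ((x + d) * (x + d))) (at x)"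
        unfolding F_def[abs_def] using * by (intro DERIV_divide) auto
      moreover have "(inverse (2 + x / d) * (1 / d) * (x + d) - ln (2 + x / d) * 1) / ((x + d) * (x + d)) = F' x"
      proof -
        have "inverse (2 + x / d) * (1 / d) = 1 / (2 * d + x)" using * d x by (simp add: field_simps)
        then show ?thesis using * by (simp add: F'_def diff_divide_distrib power2_eq_square)
      qed
      ultimately show ?thesis by simp
    qed
    have cF: "continuous_on {0..1} F" by (rule chi_cont[OF chi])
    have chi': "continuous_on {0..1} F'"
    proof -
      have "x + d \<noteq> 0" "2 * d + x \<noteq> 0" "2 + x / d > 0" "d \<noteq> 0" if "x \<in> {0..1}" for x
        using that d add_pos_nonneg[of 2 "x / d"] by auto
      then show ?thesis
        unfolding F'_def by (intro continuous_intros) (auto simp: less_imp_neq[symmetric])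
    qed
    have F_nonneg: "0 \<le> F x" if "0 \<le> x" "x \<le> 1" for x
      using that d by (auto simp: F_def intro!: divide_nonneg_pos)
    have psi': "1 / (x + d) \<le> 3 * (F x + x * F' x)" if x: "0 \<le> x" "x \<le> 1/4" for x
    proof -
      have *: "x + d > 0" "2 * d + x > 0" using x d by auto
      define l where "l = ln (2 + x / d)"
      have l: "l \<ge> 2/3"
        using ln2_ge_two_thirds ln_mono[of 2 "2 + x / d"] x d by (simp add: l_def)
      \<comment> \<open>X is (x + d) times the derivative of x F. Its second summand is at least 1/3
        for x \<ge> d, its first for x < d.\<close>
      define X where "X = d * l / (x + d) + x / (2 * d + x)"
      have "X \<ge> 1/3"
      proof (cases "x \<ge> d")
        case True
        then have "x / (2 * d + x) \<ge> 1/3" using * by (simp add: field_simps)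
        moreover have "d * l / (x + d) \<ge> 0" using l d * by simp
        ultimately show ?thesis unfolding X_def by linarith
      next
        case False
        have "1/3 * (x + d) \<le> 2/3 * d" using False by simp
        also have "\<dots> \<le> d * l" using l d by simp
        finally have "d * l / (x + d) \<ge> 1/3" using * by (simp add: field_simps)
        moreover have "x / (2 * d + x) \<ge> 0" using x * by simp
        ultimately show ?thesis unfolding X_def by linarith
      qed
      then have "1 / (x + d) \<le> (3 * X) / (x + d)" using * by (intro divide_right_mono) auto
      moreover have "F x + x * F' x = X / (x + d)"
        using * unfolding F_def F'_def X_def l_def[symmetric] by (simp add: divide_simps power2_eq_square) algebra
      ultimately show ?thesis by simp
    qed
    have pos: "0 \<le> F x + x * F' x" if "0 \<le> x" "x \<le> 1/4" for x
      using psi'[OF that] that d by (smt (verit) divide_nonneg_nonneg)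
    define D where "D s = integral {0..2*pi} (\<lambda>\<theta>. 2 * (F (rho s \<theta>) + rho s \<theta> * F' (rho s \<theta>)) * jac s \<theta>)" for s
    have fd: "(flux F has_real_derivative D s) (at s)" if "s < S" for s
      unfolding D_def by (rule flux_deriv[OF chi chi' that])
    define v where "v s = integral {0..2*pi} (\<lambda>\<theta>. ln (rho s \<theta> + d))" for s
    define q where "q s \<theta> = 2 * Re (cnj (g s \<theta>) * gs s \<theta>) / (rho s \<theta> + d)" for s \<theta>
    have rd: "rho s \<theta> + d > 0" for s \<theta> using rho_nonneg[of s \<theta>] d by simp
    have q_cont: "continuous_on A (\<lambda>x. q (p x) (r x))"
      if "continuous_on A p" "continuous_on A r" "\<And>x. x \<in> A \<Longrightarrow> p x < S"
      for A :: "'z::topological_space set" and p r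
      unfolding q_def using that rd by (intro continuous_intros cont_compose) (auto simp: less_imp_neq[symmetric])
    have v: "(v has_real_derivative integral {0..2*pi} (q s)) (at s)" if s: "s < S" for s
    proof -
      have "((\<lambda>s. integral (cbox 0 (2*pi)) (\<lambda>\<theta>. ln (rho s \<theta> + d)))
          has_real_derivative integral (cbox 0 (2*pi)) (q s)) (at s within {..<S})"
      proof (rule leibniz_rule_field_derivative)
        fix x \<theta> :: real assume "x \<in> {..<S}"
        then have x: "x < S" by simp
        have "((\<lambda>s. rho s \<theta> + d) has_real_derivative 2 * Re (cnj (g x \<theta>) * gs x \<theta>) + 0) (at x)"
          by (intro DERIV_add rho_deriv_s x DERIV_const)
        from DERIV_chain2[where f=ln, OF DERIV_ln[OF rd] this]
        have "((\<lambda>s. ln (rho s \<theta> + d)) has_real_derivative q x \<theta>) (at x)"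
          by (simp add: q_def divide_inverse mult.commute)
        then show "((\<lambda>s. ln (rho s \<theta> + d)) has_real_derivative q x \<theta>) (at x within {..<S})"
          by (rule has_field_derivative_at_within)
      next
        fix x assume "x \<in> {..<S}"
        then show "(\<lambda>\<theta>. ln (rho x \<theta> + d)) integrable_on cbox 0 (2 * pi)"
          using rd by (intro integrable_continuous continuous_intros cont_compose) (auto simp: less_imp_neq[symmetric])
      next
        show "continuous_on ({..<S} \<times> cbox 0 (2 * pi)) (\<lambda>(s, \<theta>). q s \<theta>)"
          unfolding split_beta by (intro q_cont continuous_intros) auto
      qed (use s in auto)
      then show ?thesis
        using s by (simp add: v_def[abs_def] at_within_open[of s "{..<S}"])
    qed
    have q_sq: "(q s \<theta>)\<^sup>2 \<le> 6 * K * (2 * (F (rho s \<theta>) + rho s \<theta> * F' (rho s \<theta>)) * jac s \<theta>)" if s: "s < S" for s \<theta>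
    proof -
      let ?x = "rho s \<theta>"
      define r where "r = Re (cnj (g s \<theta>) * gs s \<theta>)"
      have "\<bar>r\<bar> \<le> norm (g s \<theta>) * norm (gs s \<theta>)"
        unfolding r_def by (metis abs_Re_le_cmod norm_mult complex_mod_cnj)
      then have "r\<^sup>2 \<le> (norm (g s \<theta>) * norm (gs s \<theta>))\<^sup>2"
        using power_mono[of "\<bar>r\<bar>" _ 2] by simp
      then have "4 * r\<^sup>2 / (?x + d)\<^sup>2 \<le> 4 * (?x * (norm (gs s \<theta>))\<^sup>2) / (?x + d)\<^sup>2"
        by (intro divide_right_mono) (auto simp: power_mult_distrib rho_def)
      then have "(q s \<theta>)\<^sup>2 \<le> 4 * (?x * (norm (gs s \<theta>))\<^sup>2) / (?x + d)\<^sup>2"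
        unfolding q_def r_def[symmetric] by (simp add: power_divide power_mult_distrib)
      also have "\<dots> = 4 * (?x / (?x + d)) * (norm (gs s \<theta>))\<^sup>2 * (1 / (?x + d))"
        using rd[of s \<theta>] by (simp add: power2_eq_square)
      also have "\<dots> \<le> 4 * 1 * (norm (gs s \<theta>))\<^sup>2 * (1 / (?x + d))"
        using rd[of s \<theta>] d by (intro mult_right_mono mult_left_mono) auto
      also have "\<dots> \<le> 4 * 1 * (K * jac s \<theta>) * (1 / (?x + d))"
        using jac_bound[OF s, of \<theta>] zero_le_power2[of "norm (gt s \<theta>)"] rd[of s \<theta>]
        by (intro mult_right_mono mult_left_mono) (linarith, auto)
      also have "\<dots> \<le> 4 * 1 * (K * jac s \<theta>) * (3 * (F ?x + ?x * F' ?x))"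
        using K_pos jac_nonneg[OF s, of \<theta>] by (intro mult_left_mono psi'[OF rho_nonneg rho_le[OF s]]) auto
      finally show ?thesis using rd[of s \<theta>] by (simp add: algebra_simps divide_right_mono)
    qed
    have v_sq: "(integral {0..2*pi} (q s))\<^sup>2 \<le> 12 * pi * K * D s" if s: "s < S" for s
    proof -
      have "(integral {0..2*pi} (q s))\<^sup>2 \<le> 2 * pi * integral {0..2*pi} (\<lambda>x. (q s x)\<^sup>2)"
        using s by (intro square_integral_circle q_cont) auto
      also have "\<dots> \<le> 2 * pi * integral {0..2*pi} (\<lambda>\<theta>. 6 * K * (2 * (F (rho s \<theta>) + rho s \<theta> * F' (rho s \<theta>)) * jac s \<theta>))"
        using s by (intro mult_left_mono integral_le q_sq integrable_continuous_real continuous_intros q_cont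
            cont_chi_rho cF chi' cont_compose) auto
      finally show ?thesis unfolding D_def integral_mult_right by simp
    qed
    \<comment> \<open>With \<beta> the mean slope of v, the pointwise bound v'^2 \<ge> 2 \<beta> v'
      - \<beta>^2 makes E increasing. This is the Cauchy-Schwarz inequality in s without any
      integration of D.\<close>
    define \<beta> where "\<beta> = (v s0 - v s) / (s0 - s)"
    define E where "E x = 12 * pi * K * flux F x - (2 * \<beta> * v x - \<beta>\<^sup>2 * x)" for x
    have "E s \<le> E s0"
    proof (rule DERIV_nonneg_imp_nondecreasing[of s s0])
      fix x assume "s \<le> x" "x \<le> s0"
      then have x: "x < S" using s0 by simp
      let ?q = "integral {0..2*pi} (q x)"
      have "(E has_real_derivative (12 * pi * K * D x - (2 * \<beta> * ?q - \<beta>\<^sup>2 * 1))) (at x)"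
        unfolding E_def[abs_def]
        by (intro DERIV_diff DERIV_cmult fd x v DERIV_ident)
      moreover have "0 \<le> (?q - \<beta>)\<^sup>2" by simp
      then have "0 \<le> 12 * pi * K * D x - (2 * \<beta> * ?q - \<beta>\<^sup>2 * 1)"
        using v_sq[OF x] unfolding power2_eq_square by (simp add: algebra_simps)
      ultimately show "\<exists>y. (E has_real_derivative y) (at x) \<and> 0 \<le> y" by blast
    qed (use s in simp)
    moreover have "0 \<le> flux F s"
      using s s0 by (intro flux_nonneg[OF chi chi' F_nonneg pos]) auto
    ultimately have "2 * \<beta> * (v s0 - v s) - \<beta>\<^sup>2 * (s0 - s) \<le> 12 * pi * K * flux F s0"
      using K_pos unfolding E_def by (simp add: algebra_simps) (smt (verit) mult_nonneg_nonneg pi_ge_zero)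
    moreover have "2 * \<beta> * (v s0 - v s) - \<beta>\<^sup>2 * (s0 - s) = (v s0 - v s)\<^sup>2 / (s0 - s)"
    proof -
      have "2 * (D / p) * D - (D / p)\<^sup>2 * p = D\<^sup>2 / p" if "p > 0" for D p :: real
        using that by (simp add: power2_eq_square)
      then show ?thesis using s unfolding \<beta>_def by (metis diff_gt_0_iff_gt)
    qed
    ultimately have "(v s0 - v s)\<^sup>2 / (s0 - s) \<le> 12 * pi * K * flux F s0" by simp
    then have "(v s0 - v s)\<^sup>2 \<le> 12 * pi * K * flux F s0 * (s0 - s)"
      using s by (simp add: pos_divide_le_eq)
    then have 1: "(w0 - w)\<^sup>2 \<le> 12 * pi * K * (s0 - s) * flux F s0"
      unfolding w w0 v_def by (simp only: ac_simps)
    have "\<bar>flux F s0\<bar> \<le> integral {0..2*pi} (\<lambda>\<theta>. F (rho s0 \<theta>) * (norm (g s0 \<theta>) * norm (gt s0 \<theta>)))"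
      by (rule flux_le[OF cF F_nonneg s0])
    also have "\<dots> \<le> integral {0..2*pi} (\<lambda>\<theta>. ln (1 / d) * (1 / \<epsilon>))"
    proof (intro integral_le)
      fix \<theta> assume th: "\<theta> \<in> {0..2*pi}"
      let ?x = "rho s0 \<theta>"
      have l: "ln (2 + ?x / d) \<le> ln (1 / d)"
      proof (rule ln_mono)
        have "2 * d + ?x \<le> 1" using rho_le[OF s0, of \<theta>] d by simp
        then show "2 + ?x / d \<le> 1 / d" using d by (simp add: pos_le_divide_eq distrib_right)
      qed (use d rho_nonneg[of s0 \<theta>] in \<open>auto simp: add_pos_nonneg\<close>)
      have l0: "0 \<le> ln (2 + ?x / d)" using d rho_nonneg[of s0 \<theta>] by simp
      have "norm (g s0 \<theta>) * norm (gt s0 \<theta>) / (?x + d) \<le> norm (g s0 \<theta>) * 1 / ?x"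
        using large[OF th] eps gt_small[OF s0, of \<theta>] d by (intro frac_le mult_left_mono) (auto simp: rho_def)
      also have "\<dots> = 1 / norm (g s0 \<theta>)"
        using large[OF th] eps by (auto simp: rho_def power2_eq_square)
      also have "\<dots> \<le> 1 / \<epsilon>" using large[OF th] eps by (intro divide_left_mono mult_pos_pos) auto
      finally have "norm (g s0 \<theta>) * norm (gt s0 \<theta>) / (?x + d) \<le> 1 / \<epsilon>" .
      from mult_mono[OF l this] l0 l rd[of s0 \<theta>]
      show "F ?x * (norm (g s0 \<theta>) * norm (gt s0 \<theta>)) \<le> ln (1 / d) * (1 / \<epsilon>)"
        by (simp add: F_def)
    qed (use s0 in \<open>auto intro!: integrable_continuous_real continuous_intros cont_chi_rho cF cont_compose\<close>)
    also have "\<dots> = 2 * pi * ln (1 / d) / \<epsilon>" by simp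
    finally have "flux F s0 \<le> 2 * pi * ln (1 / d) / \<epsilon>" by simp
    then have "12 * pi * K * (s0 - s) * flux F s0 \<le> 12 * pi * K * (s0 - s) * (2 * pi * ln (1 / d) / \<epsilon>)"
      using K_pos s by (intro mult_left_mono) auto
    with 1 have "(w0 - w)\<^sup>2 \<le> 12 * pi * K * (s0 - s) * (2 * pi * ln (1 / d) / \<epsilon>)" by simp
    then show ?thesis using eps by (simp add: field_simps power2_eq_square)
  qed
  \<comment> \<open>In the final inequality T^2 cancels and n \<epsilon> \<le> 24 K is left, which
    this n contradicts.\<close>
  obtain n :: nat where n: "real n > 24 * K / \<epsilon>" "n > 0"
    using reals_Archimedean2[of "max 1 (24 * K / \<epsilon>)"] by (metis gr0I max_less_iff_conj not_one_less_zero of_nat_0)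
  obtain s1 where s1: "\<And>s \<theta>. s \<le> s1 \<Longrightarrow> norm (g s \<theta>) \<le> exp (real n * s)"
    using flat[of n] by blast
  define c where "c = ln 2 - 2 * ln \<epsilon>"
  \<comment> \<open>The entries give, in order, T > 0, s < s0, s \<le> s1, domination of the
    constant c by n T, and d \<le> 1/4.\<close>
  define T where "T = Max {1, \<bar>s0\<bar> + 1, \<bar>s1\<bar>, \<bar>c\<bar>, ln 4}"
  have T: "1 \<le> T" "\<bar>s0\<bar> + 1 \<le> T" "\<bar>s1\<bar> \<le> T" "\<bar>c\<bar> \<le> T" "ln 4 \<le> T"
    unfolding T_def by (intro Max_ge; simp)+
  define s where "s = - T"
  \<comment> \<open>Flatness gives rho \<le> d on the circle s, so the integrand there is at most
    ln(2 d).\<close>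
  define d where "d = exp (2 * real n * s)"
  have n1: "real n \<ge> 1" using n by simp
  have nT: "T \<le> real n * T" using n1 T by (simp add: mult_le_cancel_right1)
  have lnd: "ln d = - 2 * (real n * T)" by (simp add: d_def s_def)
  have d: "0 < d" "d \<le> 1/4"
  proof -
    show "0 < d" by (simp add: d_def)
    have "ln 4 \<le> 2 * (real n * T)" using nT T by linarith
    then have "ln d \<le> ln (1/4)" unfolding lnd by (simp add: ln_div)
    then show "d \<le> 1/4" using \<open>0 < d\<close> by (subst (asm) ln_le_cancel_iff) auto
  qed
  have ss0: "s < s0" "s \<le> s1" using T by (auto simp: s_def)
  define w where "w = integral {0..2*pi} (\<lambda>\<theta>. ln (rho s \<theta> + d))"
  define w0 where "w0 = integral {0..2*pi} (\<lambda>\<theta>. ln (rho s0 \<theta> + d))"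
  have rd: "rho s \<theta> + d > 0" for s \<theta> using rho_nonneg[of s \<theta>] d by simp
  have int: "(\<lambda>\<theta>. ln (rho r \<theta> + d)) integrable_on {0..2*pi}" if "r < S" for r
    using rd that by (intro integrable_continuous_real continuous_intros cont_compose) (auto simp: less_imp_neq[symmetric])
  have "w \<le> integral {0..2*pi} (\<lambda>\<theta>. ln (2 * d))"
    unfolding w_def
  proof (intro integral_le int)
    fix \<theta>
    have "rho s \<theta> \<le> (exp (real n * s))\<^sup>2"
      unfolding rho_def by (intro power_mono s1 ss0) auto
    also have "\<dots> = d" unfolding d_def by (simp add: mult.assoc flip: exp_double)
    finally show "ln (rho s \<theta> + d) \<le> ln (2 * d)" using rd d by (intro ln_mono) auto
  qed (use ss0 s0 in auto)
  then have w: "w \<le> 2 * pi * (ln 2 - 2 * (real n * T))" using d by (simp add: ln_mult lnd)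
  have "integral {0..2*pi} (\<lambda>\<theta>. 2 * ln \<epsilon>) \<le> w0"
    unfolding w0_def
  proof (intro integral_le int s0)
    fix \<theta> assume "\<theta> \<in> {0..2*pi}"
    then have "\<epsilon>\<^sup>2 \<le> rho s0 \<theta> + d"
      using power_mono[OF large, of \<theta> 2] eps d unfolding rho_def by (smt (verit))
    then have "ln (\<epsilon>\<^sup>2) \<le> ln (rho s0 \<theta> + d)" using eps by (intro ln_mono) auto
    then show "2 * ln \<epsilon> \<le> ln (rho s0 \<theta> + d)" using eps by (simp add: ln_realpow)
  qed auto
  then have w0: "2 * pi * (2 * ln \<epsilon>) \<le> w0" by simp
  have "2 * pi * (real n * T) \<le> 2 * pi * (2 * (real n * T) - c)"
  proof (rule mult_left_mono)
    show "real n * T \<le> 2 * (real n * T) - c" using T nT by linarith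
  qed simp
  also have "\<dots> \<le> w0 - w" using w w0 unfolding c_def by (simp add: algebra_simps)
  finally have "(2 * pi * (real n * T))\<^sup>2 \<le> (w0 - w)\<^sup>2" using T by (intro power_mono) auto
  then have "(2 * pi * (real n * T))\<^sup>2 * \<epsilon> \<le> (w0 - w)\<^sup>2 * \<epsilon>" using eps by simp
  also have "\<dots> \<le> 24 * pi\<^sup>2 * K * (s0 - s) * ln (1 / d)"
    by (rule key[OF d ss0(1) w_def w0_def])
  also have "\<dots> \<le> 24 * pi\<^sup>2 * K * (2 * T) * (2 * (real n * T))"
    using K_pos T d lnd by (intro mult_mono) (auto simp: s_def ln_div)
  finally have "(pi\<^sup>2 * 4 * real n * T\<^sup>2) * (real n * \<epsilon>) \<le> (pi\<^sup>2 * 4 * real n * T\<^sup>2) * (24 * K)"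
    by (simp add: power2_eq_square algebra_simps)
  moreover have "0 < pi\<^sup>2 * 4 * real n * T\<^sup>2" using n T by simp
  ultimately have "real n * \<epsilon> \<le> 24 * K" by (simp only: mult_le_cancel_left_pos)
  with n eps show False by (simp add: field_simps)
qed

text \<open>A nonzero value persists along the ray of angle \<theta> over a band of radii, so every
  circle of the band has a point with |g| \<ge> \<epsilon>. Then \<open>good_circle\<close> yields a
  zero-free circle, which \<open>no_good_circle\<close> forbids.\<close>

lemma vanishes:
  assumes "s < S" "\<theta> \<in> {0..2*pi}"
  shows "g s \<theta> = 0"
proof (rule ccontr)
  assume nz: "g s \<theta> \<noteq> 0"
  define \<epsilon> where "\<epsilon> = norm (g s \<theta>) / 2"
  have eps: "\<epsilon> > 0" "\<epsilon> < norm (g s \<theta>)" using nz by (auto simp: \<epsilon>_def)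
  have "((\<lambda>s. norm (g s \<theta>)) \<longlongrightarrow> norm (g s \<theta>)) (at s)"
    using deriv_s[OF assms(1)] by (intro tendsto_norm) (metis continuous_within has_vector_derivative_continuous)
  then have "\<forall>\<^sub>F r in at s. \<epsilon> < norm (g r \<theta>)" using eps(2) by (rule order_tendstoD(1))
  then obtain e where e: "e > 0" "\<And>r. r \<noteq> s \<Longrightarrow> dist r s < e \<Longrightarrow> \<epsilon> < norm (g r \<theta>)"
    unfolding eventually_at by auto
  define b where "b = s + min (e / 2) ((S - s) / 2)"
  have b: "s < b" "b < S" "b - s < e" using e assms by (auto simp: b_def min_def field_simps)
  have "\<exists>\<theta>\<in>{0..2*pi}. \<epsilon> \<le> norm (g r \<theta>)" if "r \<in> {s..b}" for r
    using e(2)[of r] eps that b assms by (cases "r = s") (force simp: dist_real_def intro!: bexI[of _ \<theta>])+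
  from good_circle[OF b(1,2) eps(1) this] obtain r where "r \<in> {s..b}" "\<forall>\<theta>\<in>{0..2*pi}. g r \<theta> \<noteq> 0" by blast
  with no_good_circle[of r] b show False by auto
qed

end

section \<open>Smooth maps and Wirtinger derivatives\<close>

lemma Ck_on_open_cong:
  assumes "open U" "\<And>x. x \<in> U \<Longrightarrow> f x = g x" "Ck_on_open k U f"
  shows "Ck_on_open k U g"
  using assms(2,3)
proof (induction k arbitrary: f g)
  case 0
  then show ?case by (simp cong: continuous_on_cong)
next
  case (Suc k)
  have D: "(g has_derivative frechet_derivative f (at x)) (at x)" if "x \<in> U" for x
  proof -
    have "(f has_derivative frechet_derivative f (at x)) (at x)"
      using Suc.prems(2) that frechet_derivative_works by auto
    then show ?thesis
      by (rule has_derivative_transform_within_open[OF _ assms(1) that]) (use Suc.prems(1) in auto)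
  qed
  then have eq: "frechet_derivative g (at x) = frechet_derivative f (at x)" if "x \<in> U" for x
    using frechet_derivative_at that by metis
  have "Ck_on_open k U (\<lambda>x. frechet_derivative g (at x) v)" for v
    by (rule Suc.IH[of "\<lambda>x. frechet_derivative f (at x) v"]) (use eq Suc.prems(2) in auto)
  then show ?case using D by (auto simp: differentiable_def)
qed

lemma Ck_on_open_subset: "Ck_on_open k U f \<Longrightarrow> V \<subseteq> U \<Longrightarrow> Ck_on_open k V f"
  by (induction k arbitrary: f) (auto intro: continuous_on_subset)

lemma Ck_on_open_const [simp]: "Ck_on_open k U (\<lambda>_. c)"
  by (induction k arbitrary: c) auto

lemma Ck_on_open_linear:
  assumes "open U" "bounded_linear L" "Ck_on_open k U f"
  shows "Ck_on_open k U (\<lambda>x. L (f x))"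
  using assms(3)
proof (induction k arbitrary: f)
  case 0
  then show ?case using assms(2) by (auto intro: linear_continuous_on_compose bounded_linear.continuous_on)
next
  case (Suc k)
  have D: "((\<lambda>x. L (f x)) has_derivative (\<lambda>v. L (frechet_derivative f (at x) v))) (at x)" if "x \<in> U" for x
    using Suc.prems that frechet_derivative_works by (auto intro: bounded_linear.has_derivative[OF assms(2)])
  have "Ck_on_open k U (\<lambda>x. frechet_derivative (\<lambda>x. L (f x)) (at x) v)" for v
    by (rule Ck_on_open_cong[OF assms(1) _ Suc.IH[of "\<lambda>x. frechet_derivative f (at x) v"]])
      (use Suc.prems fun_cong[OF frechet_derivative_at[OF D]] in auto)
  then show ?case using D by (auto simp: differentiable_def)
qed

lemma Ck_on_open_add:
  assumes "open U" "Ck_on_open k U f" "Ck_on_open k U g"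
  shows "Ck_on_open k U (\<lambda>x. f x + g x)"
  using assms(2,3)
proof (induction k arbitrary: f g)
  case 0
  then show ?case by (auto intro: continuous_on_add)
next
  case (Suc k)
  have D: "((\<lambda>x. f x + g x) has_derivative (\<lambda>v. frechet_derivative f (at x) v + frechet_derivative g (at x) v)) (at x)"
    if "x \<in> U" for x
    using Suc.prems that frechet_derivative_works by (auto intro!: has_derivative_add)
  have "Ck_on_open k U (\<lambda>x. frechet_derivative (\<lambda>x. f x + g x) (at x) v)" for v
    by (rule Ck_on_open_cong[OF assms(1) _
          Suc.IH[of "\<lambda>x. frechet_derivative f (at x) v" "\<lambda>x. frechet_derivative g (at x) v"]])
      (use Suc.prems fun_cong[OF frechet_derivative_at[OF D]] in auto)
  then show ?case using D by (auto simp: differentiable_def)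
qed

lemma Ck_on_open_affine:
  assumes "open V" "bounded_linear L" "Ck_on_open k U f" "\<And>z. z \<in> V \<Longrightarrow> c + L z \<in> U"
  shows "Ck_on_open k V (\<lambda>z. f (c + L z))"
  using assms(3)
proof (induction k arbitrary: f)
  case 0
  have "continuous_on V (\<lambda>z. c + L z)"
    using assms(2) by (intro continuous_on_add continuous_on_const linear_continuous_on)
  with 0 show ?case using assms(4) by (auto intro: continuous_on_compose2[of U f V "\<lambda>z. c + L z"])
next
  case (Suc k)
  have D: "((\<lambda>z. f (c + L z)) has_derivative (\<lambda>v. frechet_derivative f (at (c + L z)) (L v))) (at z)" if "z \<in> V" for z
  proof -
    have "((\<lambda>z. c + L z) has_derivative L) (at z)"
      using bounded_linear_imp_has_derivative[OF assms(2)] by (auto intro!: derivative_eq_intros)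
    moreover have "(f has_derivative frechet_derivative f (at (c + L z))) (at (c + L z))"
      using Suc.prems assms(4)[OF that] frechet_derivative_works by auto
    ultimately show ?thesis
      using has_derivative_compose[of "\<lambda>z. c + L z" L z UNIV f] by auto
  qed
  have "Ck_on_open k V (\<lambda>z. frechet_derivative (\<lambda>z. f (c + L z)) (at z) v)" for v
    by (rule Ck_on_open_cong[OF assms(1) _ Suc.IH[of "\<lambda>x. frechet_derivative f (at x) (L v)"]])
      (use Suc.prems fun_cong[OF frechet_derivative_at[OF D]] in auto)
  then show ?case using D by (auto simp: differentiable_def)
qed

definition smooth_open :: "'a::euclidean_space set \<Rightarrow> ('a \<Rightarrow> 'b::euclidean_space) \<Rightarrow> bool" where
  "smooth_open U f \<longleftrightarrow> (\<forall>k. Ck_on_open k U f)"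

lemma smooth_open_cong:
  "open U \<Longrightarrow> (\<And>x. x \<in> U \<Longrightarrow> f x = g x) \<Longrightarrow> smooth_open U f \<Longrightarrow> smooth_open U g"
  unfolding smooth_open_def using Ck_on_open_cong by blast

lemma smooth_open_subset: "smooth_open U f \<Longrightarrow> V \<subseteq> U \<Longrightarrow> smooth_open V f"
  unfolding smooth_open_def using Ck_on_open_subset by blast

lemma smooth_open_const: "smooth_open U (\<lambda>_. c)"
  by (simp add: smooth_open_def)

lemma smooth_open_linear: "open U \<Longrightarrow> bounded_linear L \<Longrightarrow> smooth_open U f \<Longrightarrow> smooth_open U (\<lambda>x. L (f x))"
  unfolding smooth_open_def using Ck_on_open_linear by blast

lemma smooth_open_add: "open U \<Longrightarrow> smooth_open U f \<Longrightarrow> smooth_open U g \<Longrightarrow> smooth_open U (\<lambda>x. f x + g x)"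
  unfolding smooth_open_def using Ck_on_open_add by blast

lemma smooth_open_affine:
  "open V \<Longrightarrow> bounded_linear L \<Longrightarrow> smooth_open U f \<Longrightarrow> (\<And>z. z \<in> V \<Longrightarrow> c + L z \<in> U) \<Longrightarrow>
    smooth_open V (\<lambda>z. f (c + L z))"
  unfolding smooth_open_def using Ck_on_open_affine by blast

lemma smooth_open_frechet: "smooth_open U f \<Longrightarrow> smooth_open U (\<lambda>x. frechet_derivative f (at x) v)"
  unfolding smooth_open_def by (metis Ck_on_open.simps(2))

lemma smooth_open_has_derivative:
  assumes "smooth_open U f" "x \<in> U"
  shows "(f has_derivative frechet_derivative f (at x)) (at x)"
proof -
  have "Ck_on_open (Suc 0) U f" using assms(1) unfolding smooth_open_def by blast
  then show ?thesis using assms(2) frechet_derivative_works by auto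
qed

lemma smooth_open_continuous_on: "smooth_open U f \<Longrightarrow> continuous_on U f"
  unfolding smooth_open_def by (metis Ck_on_open.simps(1))

text \<open>The second difference over the parallelogram with edges h u and h v is, by two mean
  value theorems, h^2 times a mixed derivative at a nearby point, in either order of u and v.
  Continuity at x then identifies the two limits.\<close>

lemma second_derivative_symmetric_real:
  fixes f :: "'a::euclidean_space \<Rightarrow> real"
  assumes "open U" "smooth_open U f" "x \<in> U"
  shows "frechet_derivative (\<lambda>x. frechet_derivative f (at x) u) (at x) v =
         frechet_derivative (\<lambda>x. frechet_derivative f (at x) v) (at x) u"
proof -
  have mvt: "\<exists>y\<in>ball x e. a + b = a' + b' + h\<^sup>2 * frechet_derivative (\<lambda>x. frechet_derivative f (at x) u) (at y) v"
    if e: "ball x e \<subseteq> U" and h: "h > 0" "h * (norm u + norm v) < e"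
      and ab: "a = f (x + h *\<^sub>R u + h *\<^sub>R v)" "b = f x" "a' = f (x + h *\<^sub>R u)" "b' = f (x + h *\<^sub>R v)"
    for u v h e a b a' b'
  proof -
    have in_ball: "x + s *\<^sub>R u + t *\<^sub>R v \<in> ball x e" if "0 \<le> s" "s \<le> h" "0 \<le> t" "t \<le> h" for s t
    proof -
      have "norm (s *\<^sub>R u + t *\<^sub>R v) \<le> s * norm u + t * norm v"
        using that by (metis abs_of_nonneg norm_scaleR norm_triangle_ineq)
      also have "\<dots> \<le> h * norm u + h * norm v" using that by (intro add_mono mult_right_mono) auto
      also have "\<dots> < e" using h(2) by (simp add: distrib_left)
      finally have "norm (s *\<^sub>R u + t *\<^sub>R v) < e" .
      moreover have "dist x (x + (s *\<^sub>R u + t *\<^sub>R v)) = norm (s *\<^sub>R u + t *\<^sub>R v)"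
        using dist_add_cancel[of x 0 "s *\<^sub>R u + t *\<^sub>R v"] by simp
      ultimately show ?thesis by (simp add: add.assoc)
    qed
    let ?u = "\<lambda>y. frechet_derivative f (at y) u"
    have d1: "((\<lambda>s. f (x + s *\<^sub>R u + t *\<^sub>R v)) has_real_derivative ?u (x + s *\<^sub>R u + t *\<^sub>R v)) (at s)"
      if "0 \<le> s" "s \<le> h" "0 \<le> t" "t \<le> h" for s t
    proof -
      let ?y = "x + s *\<^sub>R u + t *\<^sub>R v"
      have *: "(f has_derivative frechet_derivative f (at ?y)) (at ?y)"
        using in_ball[OF that] e assms(2) by (intro smooth_open_has_derivative) auto
      have "((\<lambda>s. x + s *\<^sub>R u + t *\<^sub>R v) has_derivative (\<lambda>d. d *\<^sub>R u)) (at s)"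
        by (auto intro!: derivative_eq_intros)
      from has_derivative_compose[OF this *]
      have "((\<lambda>s. f (x + s *\<^sub>R u + t *\<^sub>R v)) has_derivative (\<lambda>d. frechet_derivative f (at ?y) (d *\<^sub>R u))) (at s)" .
      moreover have "frechet_derivative f (at ?y) (d *\<^sub>R u) = ?u ?y * d" for d
        using linear_cmul[OF has_derivative_linear[OF *], of d u] by simp
      ultimately show ?thesis by (simp add: has_field_derivative_def)
    qed
    have d2: "((\<lambda>t. ?u (x + s *\<^sub>R u + t *\<^sub>R v)) has_real_derivative
        frechet_derivative ?u (at (x + s *\<^sub>R u + t *\<^sub>R v)) v) (at t)"
      if "0 \<le> s" "s \<le> h" "0 \<le> t" "t \<le> h" for s t
    proof -
      let ?y = "x + s *\<^sub>R u + t *\<^sub>R v"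
      have *: "(?u has_derivative frechet_derivative ?u (at ?y)) (at ?y)"
        using in_ball[OF that] e assms(2) by (intro smooth_open_has_derivative smooth_open_frechet) auto
      have "((\<lambda>t. x + s *\<^sub>R u + t *\<^sub>R v) has_derivative (\<lambda>d. d *\<^sub>R v)) (at t)"
        by (auto intro!: derivative_eq_intros)
      from has_derivative_compose[OF this *]
      have "((\<lambda>t. ?u (x + s *\<^sub>R u + t *\<^sub>R v)) has_derivative (\<lambda>d. frechet_derivative ?u (at ?y) (d *\<^sub>R v))) (at t)" .
      moreover have "frechet_derivative ?u (at ?y) (d *\<^sub>R v) = frechet_derivative ?u (at ?y) v * d" for d
        using linear_cmul[OF has_derivative_linear[OF *], of d v] by simp
      ultimately show ?thesis by (simp add: has_field_derivative_def)
    qed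
    have "\<exists>s>0. s < h \<and> (f (x + h *\<^sub>R u + h *\<^sub>R v) - f (x + h *\<^sub>R u + 0 *\<^sub>R v)) - (f (x + 0 *\<^sub>R u + h *\<^sub>R v) - f (x + 0 *\<^sub>R u + 0 *\<^sub>R v))
        = (h - 0) * (?u (x + s *\<^sub>R u + h *\<^sub>R v) - ?u (x + s *\<^sub>R u + 0 *\<^sub>R v))"
      using h(1) by (intro MVT2 DERIV_diff d1) auto
    then obtain s where s: "0 < s" "s < h" and 1: "a + b = a' + b' + h * (?u (x + s *\<^sub>R u + h *\<^sub>R v) - ?u (x + s *\<^sub>R u + 0 *\<^sub>R v))"
      unfolding ab by auto
    have "\<exists>t>0. t < h \<and> ?u (x + s *\<^sub>R u + h *\<^sub>R v) - ?u (x + s *\<^sub>R u + 0 *\<^sub>R v)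
        = (h - 0) * frechet_derivative ?u (at (x + s *\<^sub>R u + t *\<^sub>R v)) v"
      using h(1) s by (intro MVT2 d2) auto
    then obtain t where t: "0 < t" "t < h" "?u (x + s *\<^sub>R u + h *\<^sub>R v) - ?u (x + s *\<^sub>R u + 0 *\<^sub>R v)
        = h * frechet_derivative ?u (at (x + s *\<^sub>R u + t *\<^sub>R v)) v" by auto
    show ?thesis
      using 1 s t in_ball[of s t] unfolding t(3)
      by (intro bexI[of _ "x + s *\<^sub>R u + t *\<^sub>R v"]) (auto simp: power2_eq_square)
  qed
  define A where "A u v y = frechet_derivative (\<lambda>x. frechet_derivative f (at x) u) (at y) v" for u v y
  have contA: "continuous_on U (A u v)" for u v
    unfolding A_def by (intro smooth_open_continuous_on smooth_open_frechet assms)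
  have "\<bar>A u v x - A v u x\<bar> \<le> \<epsilon>" if \<epsilon>: "\<epsilon> > 0" for \<epsilon>
  proof -
    have "\<forall>\<^sub>F y in nhds x. \<bar>A u v y - A u v x\<bar> < \<epsilon> / 2 \<and> \<bar>A v u y - A v u x\<bar> < \<epsilon> / 2 \<and> y \<in> U"
    proof (intro eventually_conj)
      have "isCont (A u v) x" "isCont (A v u) x"
        using contA assms by (auto simp: continuous_on_eq_continuous_at)
      then show "\<forall>\<^sub>F y in nhds x. \<bar>A u v y - A u v x\<bar> < \<epsilon> / 2" "\<forall>\<^sub>F y in nhds x. \<bar>A v u y - A v u x\<bar> < \<epsilon> / 2"
        using \<epsilon> unfolding isCont_def tendsto_at_iff_tendsto_nhds
        by (auto dest!: tendstoD[where e = "\<epsilon> / 2"] simp: dist_real_def)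
      show "\<forall>\<^sub>F y in nhds x. y \<in> U" using assms by (intro eventually_nhds_in_open)
    qed
    then obtain e where e: "e > 0" and *: "\<And>y. dist y x < e \<Longrightarrow>
        \<bar>A u v y - A u v x\<bar> < \<epsilon> / 2 \<and> \<bar>A v u y - A v u x\<bar> < \<epsilon> / 2 \<and> y \<in> U"
      unfolding eventually_nhds_metric by blast
    define h where "h = e / (2 * (norm u + norm v + 1))"
    have n0: "norm u + norm v + 1 > 0" by (smt (verit) norm_ge_zero)
    have h: "h > 0" using e n0 by (simp add: h_def)
    have "h * (norm u + norm v) < h * (2 * (norm u + norm v + 1))" using h n0
      by (intro mult_strict_left_mono) (smt (verit) norm_ge_zero)+
    also have "\<dots> = e" using n0 by (simp add: h_def)
    finally have he: "h * (norm u + norm v) < e" .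
    have sub: "ball x e \<subseteq> U" using * by (auto simp: dist_commute)
    obtain y where y: "y \<in> ball x e" "f (x + h *\<^sub>R u + h *\<^sub>R v) + f x = f (x + h *\<^sub>R u) + f (x + h *\<^sub>R v) + h\<^sup>2 * A u v y"
      using mvt[OF sub h he refl refl refl refl] by (auto simp: A_def)
    obtain y' where y': "y' \<in> ball x e" "f (x + h *\<^sub>R v + h *\<^sub>R u) + f x = f (x + h *\<^sub>R v) + f (x + h *\<^sub>R u) + h\<^sup>2 * A v u y'"
      using mvt[OF sub h _ refl refl refl refl, of v u] he by (auto simp: A_def add.commute)
    have "h\<^sup>2 * A u v y = h\<^sup>2 * A v u y'"
      using y(2) y'(2) by (simp add: add.commute add.left_commute)
    then have "A u v y = A v u y'" using h by simp
    moreover have "\<bar>A u v y - A u v x\<bar> < \<epsilon> / 2" "\<bar>A v u y' - A v u x\<bar> < \<epsilon> / 2"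
      using * y(1) y'(1) by (auto simp: dist_commute)
    ultimately show ?thesis by linarith
  qed
  then have "\<bar>A u v x - A v u x\<bar> \<le> 0" by (rule field_le_epsilon) simp
  then show ?thesis by (simp add: A_def)
qed

lemma second_derivative_symmetric:
  fixes f :: "'a::euclidean_space \<Rightarrow> 'b::euclidean_space"
  assumes "open U" "smooth_open U f" "x \<in> U"
  shows "frechet_derivative (\<lambda>x. frechet_derivative f (at x) u) (at x) v =
         frechet_derivative (\<lambda>x. frechet_derivative f (at x) v) (at x) u"
proof (rule euclidean_eqI)
  fix b :: 'b assume "b \<in> Basis"
  have L: "bounded_linear (\<lambda>y. y \<bullet> b)" by (rule bounded_linear_inner_left)
  have D: "frechet_derivative (\<lambda>y. g y \<bullet> b) (at y) w = frechet_derivative g (at y) w \<bullet> b"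
    if "smooth_open U g" "y \<in> U" for g :: "'a \<Rightarrow> 'b" and y w
    using bounded_linear.has_derivative[OF L smooth_open_has_derivative[OF that]] frechet_derivative_at by metis
  have DD: "frechet_derivative (\<lambda>y. frechet_derivative f (at y) u) (at x) v \<bullet> b
      = frechet_derivative (\<lambda>y. frechet_derivative (\<lambda>y. f y \<bullet> b) (at y) u) (at x) v" for u v
  proof -
    have 1: "((\<lambda>y. frechet_derivative f (at y) u \<bullet> b) has_derivative
       (\<lambda>v. frechet_derivative (\<lambda>y. frechet_derivative f (at y) u) (at x) v \<bullet> b)) (at x)"
      by (rule bounded_linear.has_derivative[OF L smooth_open_has_derivative[OF smooth_open_frechet[OF assms(2)] assms(3)]])
    have "((\<lambda>y. frechet_derivative (\<lambda>y. f y \<bullet> b) (at y) u) has_derivative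
       (\<lambda>v. frechet_derivative (\<lambda>y. frechet_derivative f (at y) u) (at x) v \<bullet> b)) (at x)"
      by (rule has_derivative_transform_within_open[OF 1 assms(1,3)]) (simp add: D assms(2))
    then show ?thesis using frechet_derivative_at by metis
  qed
  show "frechet_derivative (\<lambda>x. frechet_derivative f (at x) u) (at x) v \<bullet> b =
         frechet_derivative (\<lambda>x. frechet_derivative f (at x) v) (at x) u \<bullet> b"
    unfolding DD by (rule second_derivative_symmetric_real[OF assms(1) smooth_open_linear[OF assms(1) L assms(2)] assms(3)])
qed

section \<open>Wirtinger derivatives\<close>

definition Dz :: "(complex \<Rightarrow> complex) \<Rightarrow> complex \<Rightarrow> complex" where
  "Dz f z = (frechet_derivative f (at z) 1 - \<i> * frechet_derivative f (at z) \<i>) / 2"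

definition Dw :: "(complex \<Rightarrow> complex) \<Rightarrow> complex \<Rightarrow> complex" where
  "Dw f z = (frechet_derivative f (at z) 1 + \<i> * frechet_derivative f (at z) \<i>) / 2"

lemma has_derivative_Dz_Dw:
  assumes "smooth_open U f" "z \<in> U"
  shows "(f has_derivative (\<lambda>v. v * Dz f z + cnj v * Dw f z)) (at z)"
proof -
  let ?D = "frechet_derivative f (at z)"
  have D: "(f has_derivative ?D) (at z)" by (rule smooth_open_has_derivative[OF assms])
  have "?D v = v * Dz f z + cnj v * Dw f z" for v
  proof -
    have "v = Re v *\<^sub>R 1 + Im v *\<^sub>R \<i>" by (simp add: complex_eq_iff)
    then have "?D v = ?D (Re v *\<^sub>R 1 + Im v *\<^sub>R \<i>)" by (rule arg_cong)
    then have "?D v = Re v *\<^sub>R ?D 1 + Im v *\<^sub>R ?D \<i>"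
      by (simp only: linear_add[OF has_derivative_linear[OF D]] linear_cmul[OF has_derivative_linear[OF D]])
    then have "?D v = of_real (Re v) * ?D 1 + of_real (Im v) * ?D \<i>"
      by (simp only: scaleR_conv_of_real)
    also have "\<dots> = v * Dz f z + cnj v * Dw f z"
      by (simp add: Dz_def Dw_def complex_eq_iff algebra_simps) (simp add: field_simps)
    finally show ?thesis .
  qed
  then have "?D = (\<lambda>v. v * Dz f z + cnj v * Dw f z)" by blast
  then show ?thesis using D by simp
qed

lemma Dz_Dw_unique:
  assumes "(f has_derivative (\<lambda>v. v * a + cnj v * b)) (at z)"
  shows "Dz f z = a" "Dw f z = b"
proof -
  have "frechet_derivative f (at z) = (\<lambda>v. v * a + cnj v * b)"
    using frechet_derivative_at[OF assms] by simp
  then show "Dz f z = a" "Dw f z = b"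
    by (auto simp: Dz_def Dw_def algebra_simps)
qed

lemma smooth_Dz: "open U \<Longrightarrow> smooth_open U f \<Longrightarrow> smooth_open U (Dz f)"
proof -
  assume U: "open U" "smooth_open U f"
  have "smooth_open U (\<lambda>z. (1/2) * frechet_derivative f (at z) 1 + (- \<i> / 2) * frechet_derivative f (at z) \<i>)"
    using U by (intro smooth_open_add smooth_open_linear[OF U(1) bounded_linear_mult_right] smooth_open_frechet)
  then show ?thesis
    by (rule smooth_open_cong[OF U(1), rotated]) (simp add: Dz_def field_simps)
qed

lemma smooth_Dw: "open U \<Longrightarrow> smooth_open U f \<Longrightarrow> smooth_open U (Dw f)"
proof -
  assume U: "open U" "smooth_open U f"
  have "smooth_open U (\<lambda>z. (1/2) * frechet_derivative f (at z) 1 + (\<i> / 2) * frechet_derivative f (at z) \<i>)"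
    using U by (intro smooth_open_add smooth_open_linear[OF U(1) bounded_linear_mult_right] smooth_open_frechet)
  then show ?thesis
    by (rule smooth_open_cong[OF U(1), rotated]) (simp add: Dw_def field_simps)
qed

lemma Dz_Dw_cong:
  assumes "open U" "smooth_open U f" "\<And>z. z \<in> U \<Longrightarrow> f z = g z" "z \<in> U"
  shows "Dz f z = Dz g z" "Dw f z = Dw g z"
proof -
  have "(g has_derivative (\<lambda>v. v * Dz f z + cnj v * Dw f z)) (at z)"
    by (rule has_derivative_transform_within_open[OF has_derivative_Dz_Dw[OF assms(2,4)] assms(1,4)]) (use assms in auto)
  from Dz_Dw_unique[OF this] show "Dz f z = Dz g z" "Dw f z = Dw g z" by auto
qed

lemma Dz_Dw_commute:
  assumes "open U" "smooth_open U f" "z \<in> U"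
  shows "Dz (Dw f) z = Dw (Dz f) z"
proof -
  let ?x = "\<lambda>z. frechet_derivative f (at z) 1" and ?y = "\<lambda>z. frechet_derivative f (at z) \<i>"
  note D = smooth_open_has_derivative[OF smooth_open_frechet[OF assms(2)] assms(3)]
  have "((\<lambda>z. (?x z - \<i> * ?y z) / 2) has_derivative (\<lambda>v. (frechet_derivative ?x (at z) v - \<i> * frechet_derivative ?y (at z) v) / 2)) (at z)"
    by (auto intro!: derivative_eq_intros D)
  then have 1: "frechet_derivative (Dz f) (at z) = (\<lambda>v. (frechet_derivative ?x (at z) v - \<i> * frechet_derivative ?y (at z) v) / 2)"
    unfolding Dz_def[abs_def] by (simp add: frechet_derivative_at[symmetric])
  have "((\<lambda>z. (?x z + \<i> * ?y z) / 2) has_derivative (\<lambda>v. (frechet_derivative ?x (at z) v + \<i> * frechet_derivative ?y (at z) v) / 2)) (at z)"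
    by (auto intro!: derivative_eq_intros D)
  then have 2: "frechet_derivative (Dw f) (at z) = (\<lambda>v. (frechet_derivative ?x (at z) v + \<i> * frechet_derivative ?y (at z) v) / 2)"
    unfolding Dw_def[abs_def] by (simp add: frechet_derivative_at[symmetric])
  show ?thesis
    unfolding Dz_def[of "Dw f"] Dw_def[of "Dz f"] 1 2
    using second_derivative_symmetric[OF assms, of 1 \<i>] by (simp add: field_simps)
qed

text \<open>The z-derivatives act last. Absorbing an inner \<open>Dw\<close> is then free
  (\<open>DD_Dw\<close>), while absorbing an inner \<open>Dz\<close> needs commutation, hence
  smoothness (\<open>DD_Dz\<close>).\<close>

definition DD :: "nat \<Rightarrow> nat \<Rightarrow> (complex \<Rightarrow> complex) \<Rightarrow> complex \<Rightarrow> complex" where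
  "DD i j f = (Dz ^^ i) ((Dw ^^ j) f)"

lemma smooth_Dw_pow: "open U \<Longrightarrow> smooth_open U f \<Longrightarrow> smooth_open U ((Dw ^^ j) f)"
  by (induction j) (auto intro: smooth_Dw)

lemma DD_Dw: "DD i j (Dw f) = DD i (Suc j) f"
  by (simp add: DD_def funpow_swap1)

lemma Dz_pow_cong:
  assumes "open U" "smooth_open U f" "\<And>z. z \<in> U \<Longrightarrow> f z = g z" "z \<in> U"
  shows "(Dz ^^ j) f z = (Dz ^^ j) g z"
  using assms(4)
proof (induction j arbitrary: z)
  case (Suc j)
  have "smooth_open U ((Dz ^^ j) f)" by (induction j) (auto intro: smooth_Dz assms)
  then show ?case using Dz_Dw_cong(1)[OF assms(1)] Suc by simp
qed (use assms in simp)

lemma Dw_pow_Dz: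
  assumes "open U" "smooth_open U f" "z \<in> U"
  shows "(Dw ^^ j) (Dz f) z = Dz ((Dw ^^ j) f) z"
  using assms(3)
proof (induction j arbitrary: z)
  case (Suc j)
  have "(Dw ^^ Suc j) (Dz f) z = Dw (Dz ((Dw ^^ j) f)) z"
    using Dz_Dw_cong(2)[OF assms(1) smooth_Dw_pow[OF assms(1) smooth_Dz[OF assms(1,2)]] Suc.IH Suc.prems] by simp
  also have "\<dots> = Dz ((Dw ^^ Suc j) f) z"
    using Dz_Dw_commute[OF assms(1) smooth_Dw_pow[OF assms(1,2)] Suc.prems] by simp
  finally show ?case .
qed simp

lemma DD_Dz:
  assumes "open U" "smooth_open U f" "z \<in> U"
  shows "DD i j (Dz f) z = DD (Suc i) j f z"
proof -
  have "DD i j (Dz f) z = (Dz ^^ i) (Dz ((Dw ^^ j) f)) z"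
    unfolding DD_def
    by (rule Dz_pow_cong[OF assms(1) smooth_Dw_pow[OF assms(1) smooth_Dz[OF assms(1,2)]] Dw_pow_Dz[OF assms(1,2)] assms(3)])
  then show ?thesis by (simp add: DD_def funpow_swap1)
qed

text \<open>The homogeneous part of degree n of the Taylor expansion at 0, in the variables z and
  cnj z.\<close>

definition taylor_form :: "nat \<Rightarrow> (complex \<Rightarrow> complex) \<Rightarrow> complex \<Rightarrow> complex" where
  "taylor_form n f z = (\<Sum>i\<le>n. DD i (n - i) f 0 / (fact i * fact (n - i)) * (z ^ i * cnj z ^ (n - i)))"

lemma taylor_form_0: "taylor_form 0 f z = f 0"
  by (simp add: taylor_form_def DD_def)

text \<open>Lowering an exponent cancels one factor of the matching factorial, so a Wirtinger
  derivative of a homogeneous part is the homogeneous part of the derivative, one degree lower. This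
  drives the induction in \<open>taylor_leading\<close>.\<close>

lemma taylor_form_derivative:
  assumes "open U" "smooth_open U f" "0 \<in> U"
  shows "(taylor_form (Suc n) f has_derivative
    (\<lambda>v. v * taylor_form n (Dz f) z + cnj v * taylor_form n (Dw f) z)) (at z)"
proof -
  define a where "a i j = DD i j f 0 / (fact i * fact j)" for i j
  have cnj: "(cnj has_derivative cnj) F" for F
    by (rule bounded_linear_imp_has_derivative[OF bounded_linear_cnj])
  have mono: "((\<lambda>z. c * (z ^ i * cnj z ^ j)) has_derivative
      (\<lambda>v. v * (c * (of_nat i * z ^ (i - 1) * cnj z ^ j)) + cnj v * (c * (of_nat j * z ^ i * cnj z ^ (j - 1))))) (at z)"
    for c i j
    by (rule has_derivative_eq_rhs, (rule derivative_intros cnj)+) (auto simp: algebra_simps)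
  have "((\<lambda>z. \<Sum>i\<le>Suc n. a i (Suc n - i) * (z ^ i * cnj z ^ (Suc n - i))) has_derivative
      (\<lambda>v. \<Sum>i\<le>Suc n. v * (a i (Suc n - i) * (of_nat i * z ^ (i - 1) * cnj z ^ (Suc n - i))) +
          cnj v * (a i (Suc n - i) * (of_nat (Suc n - i) * z ^ i * cnj z ^ (Suc n - i - 1))))) (at z)"
    by (intro has_derivative_sum mono)
  moreover have "(\<Sum>i\<le>Suc n. v * (a i (Suc n - i) * (of_nat i * z ^ (i - 1) * cnj z ^ (Suc n - i))) +
          cnj v * (a i (Suc n - i) * (of_nat (Suc n - i) * z ^ i * cnj z ^ (Suc n - i - 1))))
      = v * taylor_form n (Dz f) z + cnj v * taylor_form n (Dw f) z" for v
  proof -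
    have 1: "(\<Sum>i\<le>Suc n. a i (Suc n - i) * (of_nat i * z ^ (i - 1) * cnj z ^ (Suc n - i))) = taylor_form n (Dz f) z"
    proof -
      have "(\<Sum>i\<le>Suc n. a i (Suc n - i) * (of_nat i * z ^ (i - 1) * cnj z ^ (Suc n - i)))
          = (\<Sum>i\<le>n. a (Suc i) (n - i) * (of_nat (Suc i) * z ^ i * cnj z ^ (n - i)))"
        by (subst sum.atMost_Suc_shift) simp
      also have "\<dots> = taylor_form n (Dz f) z"
        unfolding taylor_form_def a_def DD_Dz[OF assms]
        by (intro sum.cong refl) (simp add: divide_simps del: of_nat_Suc)
      finally show ?thesis .
    qed
    have 2: "(\<Sum>i\<le>Suc n. a i (Suc n - i) * (of_nat (Suc n - i) * z ^ i * cnj z ^ (Suc n - i - 1))) = taylor_form n (Dw f) z"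
    proof -
      have "(\<Sum>i\<le>Suc n. a i (Suc n - i) * (of_nat (Suc n - i) * z ^ i * cnj z ^ (Suc n - i - 1)))
          = (\<Sum>i\<le>n. a i (Suc (n - i)) * (of_nat (Suc (n - i)) * z ^ i * cnj z ^ (n - i)))"
        by (simp add: Suc_diff_le del: of_nat_diff)
      also have "\<dots> = taylor_form n (Dw f) z"
        unfolding taylor_form_def a_def DD_Dw
        by (intro sum.cong refl) (simp add: divide_simps del: of_nat_Suc)
      finally show ?thesis .
    qed
    show ?thesis unfolding sum.distrib sum_distrib_left[symmetric] 1 2 ..
  qed
  ultimately show ?thesis unfolding taylor_form_def[abs_def] a_def by simp
qed

text \<open>Induction on n: the Wirtinger derivatives of the error are the errors of
  \<open>Dz f\<close> and \<open>Dw f\<close> one degree lower, each at most \<epsilon>/2 |z|^n, and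
  the mean value inequality on a ball contributes the missing factor |z|.\<close>

lemma taylor_leading:
  assumes "open U" "smooth_open U f" "0 \<in> U" "\<And>i j. i + j < n \<Longrightarrow> DD i j f 0 = 0" "\<epsilon> > 0"
  shows "\<forall>\<^sub>F z in nhds 0. norm (f z - taylor_form n f z) \<le> \<epsilon> * norm z ^ n"
  using assms(2,4,5)
proof (induction n arbitrary: f \<epsilon>)
  case 0
  have "isCont f 0"
    using smooth_open_continuous_on[OF 0(1)] assms(1,3) by (simp add: continuous_on_eq_continuous_at)
  then have "\<forall>\<^sub>F z in nhds 0. dist (f z) (f 0) < \<epsilon>"
    using 0 unfolding isCont_def tendsto_at_iff_tendsto_nhds by (intro tendstoD) auto
  then show ?case by eventually_elim (simp add: taylor_form_0 dist_norm)
next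
  case (Suc n)
  have z: "\<forall>\<^sub>F z in nhds 0. norm (Dz f z - taylor_form n (Dz f) z) \<le> \<epsilon> / 2 * norm z ^ n"
    using Suc.prems by (intro Suc.IH smooth_Dz assms) (auto simp: DD_Dz[OF assms(1) Suc.prems(1) assms(3)])
  have w: "\<forall>\<^sub>F z in nhds 0. norm (Dw f z - taylor_form n (Dw f) z) \<le> \<epsilon> / 2 * norm z ^ n"
    using Suc.prems by (intro Suc.IH smooth_Dw assms) (auto simp: DD_Dw)
  have "\<forall>\<^sub>F z in nhds 0. z \<in> U" using assms by (intro eventually_nhds_in_open)
  with z w have "\<forall>\<^sub>F z in nhds 0. norm (Dz f z - taylor_form n (Dz f) z) \<le> \<epsilon> / 2 * norm z ^ n \<and>
      norm (Dw f z - taylor_form n (Dw f) z) \<le> \<epsilon> / 2 * norm z ^ n \<and> z \<in> U"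
    by eventually_elim simp
  then obtain e where e: "e > 0" and *: "\<And>z. dist z 0 < e \<Longrightarrow>
      norm (Dz f z - taylor_form n (Dz f) z) \<le> \<epsilon> / 2 * norm z ^ n \<and>
      norm (Dw f z - taylor_form n (Dw f) z) \<le> \<epsilon> / 2 * norm z ^ n \<and> z \<in> U"
    unfolding eventually_nhds_metric by blast
  have "norm (f z - taylor_form (Suc n) f z) \<le> \<epsilon> * norm z ^ Suc n" if "dist z 0 < e" for z
  proof -
    define E where "E z = f z - taylor_form (Suc n) f z" for z
    define E' where "E' z v = v * (Dz f z - taylor_form n (Dz f) z) + cnj v * (Dw f z - taylor_form n (Dw f) z)" for z v
    have "norm (E z - E 0) \<le> (\<epsilon> * norm z ^ n) * norm (z - 0)"
    proof (rule differentiable_bound[where S="cball 0 (norm z)" and f'=E'])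
      fix x :: complex assume "x \<in> cball 0 (norm z)"
      then have x: "norm x \<le> norm z" "dist x 0 < e" using that by auto
      have "(E has_derivative (\<lambda>v. (v * Dz f x + cnj v * Dw f x) -
          (v * taylor_form n (Dz f) x + cnj v * taylor_form n (Dw f) x))) (at x)"
        unfolding E_def[abs_def] using *[OF x(2)]
        by (intro has_derivative_diff has_derivative_Dz_Dw[OF Suc.prems(1)] taylor_form_derivative[OF assms(1) Suc.prems(1) assms(3)]) auto
      then have "(E has_derivative E' x) (at x)"
        by (rule has_derivative_eq_rhs) (auto simp: E'_def algebra_simps)
      then show "(E has_derivative E' x) (at x within cball 0 (norm z))"
        by (rule has_derivative_at_withinI)
      show "onorm (E' x) \<le> \<epsilon> * norm z ^ n"
      proof (rule onorm_le)
        fix v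
        have "norm (E' x v) \<le> norm v * norm (Dz f x - taylor_form n (Dz f) x) + norm v * norm (Dw f x - taylor_form n (Dw f) x)"
          unfolding E'_def by (rule order_trans[OF norm_triangle_ineq]) (simp add: norm_mult)
        also have "\<dots> \<le> norm v * (\<epsilon> / 2 * norm x ^ n) + norm v * (\<epsilon> / 2 * norm x ^ n)"
          using *[OF x(2)] by (intro add_mono mult_left_mono) auto
        also have "\<dots> = norm v * \<epsilon> * norm x ^ n" by simp
        also have "\<dots> \<le> norm v * \<epsilon> * norm z ^ n"
          using x Suc.prems(3) by (intro mult_left_mono power_mono) auto
        finally show "norm (E' x v) \<le> \<epsilon> * norm z ^ n * norm v" by (simp add: ac_simps)
      qed
    qed auto
    moreover have "E 0 = 0"
    proof -
      have "taylor_form (Suc n) f 0 = 0"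
        unfolding taylor_form_def by (intro sum.neutral) (auto simp: power_0_left)
      moreover have "f 0 = 0" using Suc.prems(2)[of 0 0] by (simp add: DD_def)
      ultimately show ?thesis by (simp add: E_def)
    qed
    ultimately show ?thesis by (simp add: E_def ac_simps)
  qed
  then show ?case unfolding eventually_nhds_metric using e by blast
qed

lemma taylor_form_scale:
  "taylor_form n f (of_real t * z) = of_real t ^ n * taylor_form n f z"
proof -
  have "of_real t ^ i * of_real t ^ (n - i) = (of_real t ^ n :: complex)" if "i \<le> n" for i
    using that by (simp flip: power_add)
  then show ?thesis
    unfolding taylor_form_def sum_distrib_left
    by (intro sum.cong refl) (simp add: power_mult_distrib ac_simps)
qed

text \<open>By homogeneity the form is constant along a ray after division by t^n, so relations
  between maps pass to their leading forms.\<close>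

lemma taylor_form_limit:
  assumes "open U" "smooth_open U f" "0 \<in> U" "\<And>i j. i + j < n \<Longrightarrow> DD i j f 0 = 0" "norm u = 1"
  shows "((\<lambda>t. f (of_real t * u) / of_real t ^ n) \<longlongrightarrow> taylor_form n f u) (at_right 0)"
proof (rule tendstoI)
  fix \<epsilon> :: real assume \<epsilon>: "\<epsilon> > 0"
  have lim: "filterlim (\<lambda>t. of_real t * u) (nhds 0) (at_right 0)"
    by (auto intro!: tendsto_eq_intros)
  have "\<forall>\<^sub>F t in at_right 0. norm (f (of_real t * u) - taylor_form n f (of_real t * u)) \<le> \<epsilon> / 2 * norm (of_real t * u) ^ n"
    using taylor_leading[where \<epsilon>="\<epsilon> / 2", OF assms(1-4)] \<epsilon> lim by (auto simp: filterlim_iff)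
  moreover have "\<forall>\<^sub>F t in at_right 0. (t::real) > 0" by (simp add: eventually_at_right_less)
  ultimately show "\<forall>\<^sub>F t in at_right 0. dist (f (of_real t * u) / of_real t ^ n) (taylor_form n f u) < \<epsilon>"
  proof eventually_elim
    case (elim t)
    have "dist (f (of_real t * u) / of_real t ^ n) (taylor_form n f u)
        = norm ((f (of_real t * u) - taylor_form n f (of_real t * u)) / of_real t ^ n)"
      using elim unfolding taylor_form_scale by (simp add: dist_norm diff_divide_distrib)
    also have "\<dots> = norm (f (of_real t * u) - taylor_form n f (of_real t * u)) / t ^ n"
      using elim by (simp add: norm_divide norm_power)
    also have "\<dots> \<le> \<epsilon> / 2"
      using elim assms(5) by (simp add: norm_mult pos_divide_le_eq)
    finally show ?case using \<epsilon> by simp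
  qed
qed

section \<open>Binary forms with Hessian eigenvalues in constant ratio\<close>

text \<open>Split the common power t^a, t = x - z, off H and P, leaving Q and R that do not both
  vanish at z. The lowest-order terms give Q(z) = -z R(z) from \<open>dH\<close> and then (1 - k)
  Q(z)^2 = 0 from \<open>HE\<close>, so both vanish after all.\<close>

lemma no_common_root:
  fixes H P :: "complex poly"
  assumes z: "z \<noteq> 0" and nz: "H \<noteq> 0" "P \<noteq> 0"
    and dH: "pderiv H = [:of_nat n:] * P - [:0,1:] * pderiv P"
    and HE: "pderiv H * ([:k:] * H\<^sup>2 + 2 * [:k:] * [:0,1:] * H * P + [:0,1:]\<^sup>2 * P\<^sup>2) =
        [:of_nat n:] * H * P * ([:k:] * H + [:0,1:] * P)"
    and k: "k \<noteq> 1" and roots: "poly H z = 0" "poly P z = 0"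
  shows False
proof -
  define t where "t = [:-z, 1:]"
  have t: "poly t z = 0" "pderiv t = 1" "t \<noteq> 0" by (auto simp: t_def pderiv_pCons)
  define a where "a = min (order z H) (order z P)"
  have a: "a > 0" using roots nz by (simp add: a_def order_root)
  obtain Q where Q: "H = t ^ a * Q"
    using order_1[of z H] unfolding a_def t_def by (metis dvd_def min.cobounded1 power_le_dvd)
  obtain R where R: "P = t ^ a * R"
    using order_1[of z P] unfolding a_def t_def by (metis dvd_def min.cobounded2 power_le_dvd)
  have ne: "poly Q z \<noteq> 0 \<or> poly R z \<noteq> 0"
  proof (rule ccontr)
    assume "\<not> ?thesis"
    then have "t dvd Q" "t dvd R" by (auto simp: t_def poly_eq_0_iff_dvd)
    then have "t ^ Suc a dvd H" "t ^ Suc a dvd P" unfolding Q R power_Suc2 by (auto intro: mult_dvd_mono)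
    then have "Suc a \<le> order z H" "Suc a \<le> order z P" 
      using order_divides[of z "Suc a" H] order_divides[of z "Suc a" P] nz unfolding t_def by blast+
    then show False by (simp add: a_def)
  qed
  obtain b where b: "a = Suc b" using a by (cases a) auto
  have ta: "t ^ a = t ^ b * t" unfolding b by simp
  have dt: "pderiv (t ^ a) = t ^ b * [:of_nat a:]"
    by (simp add: b pderiv_power_Suc t del: power_Suc)
  have dH': "pderiv H = t ^ b * ([:of_nat a:] * Q + t * pderiv Q)"
    unfolding Q pderiv_mult unfolding dt unfolding ta by (simp add: algebra_simps)
  have dP': "pderiv P = t ^ b * ([:of_nat a:] * R + t * pderiv R)"
    unfolding R pderiv_mult unfolding dt unfolding ta by (simp add: algebra_simps)
  have "t ^ b * ([:of_nat a:] * Q + t * pderiv Q) = t ^ b * ([:of_nat n:] * t * R - [:0,1:] * ([:of_nat a:] * R + t * pderiv R))"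
    using dH unfolding dH' dP' unfolding R ta by (simp only: algebra_simps)
  then have "[:of_nat a:] * Q + t * pderiv Q = [:of_nat n:] * t * R - [:0,1:] * ([:of_nat a:] * R + t * pderiv R)"
    using t by (simp only: mult_cancel_left power_eq_0_iff) auto
  then have "poly ([:of_nat a:] * Q + t * pderiv Q) z = poly ([:of_nat n:] * t * R - [:0,1:] * ([:of_nat a:] * R + t * pderiv R)) z"
    by simp
  then have "of_nat a * poly Q z = of_nat a * (- z * poly R z)" by (simp add: t algebra_simps)
  then have qr: "poly Q z = - z * poly R z" using a by (metis mult_cancel_left of_nat_eq_0_iff neq0_conv)
  with ne z have q0: "poly Q z \<noteq> 0" by auto
  have "(t ^ b * t ^ a * t ^ a) * (([:of_nat a:] * Q + t * pderiv Q) * ([:k:] * Q\<^sup>2 + 2 * [:k:] * [:0,1:] * Q * R + [:0,1:]\<^sup>2 * R\<^sup>2)) =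
        (t ^ b * t ^ a * t ^ a) * ([:of_nat n:] * t * Q * R * ([:k:] * Q + [:0,1:] * R))"
    using HE unfolding dH' unfolding Q R unfolding ta power2_eq_square by (simp only: algebra_simps)
  then have "([:of_nat a:] * Q + t * pderiv Q) * ([:k:] * Q\<^sup>2 + 2 * [:k:] * [:0,1:] * Q * R + [:0,1:]\<^sup>2 * R\<^sup>2) =
        [:of_nat n:] * t * Q * R * ([:k:] * Q + [:0,1:] * R)"
    using t by (simp only: mult_cancel_left power_eq_0_iff mult_eq_0_iff) auto
  then have "poly (([:of_nat a:] * Q + t * pderiv Q) * ([:k:] * Q\<^sup>2 + 2 * [:k:] * [:0,1:] * Q * R + [:0,1:]\<^sup>2 * R\<^sup>2)) z =
        poly ([:of_nat n:] * t * Q * R * ([:k:] * Q + [:0,1:] * R)) z" by simp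
  then have "of_nat a * poly Q z * (k * (poly Q z)\<^sup>2 + 2 * k * z * poly Q z * poly R z + z\<^sup>2 * (poly R z)\<^sup>2) = 0"
    by (simp add: t algebra_simps)
  then have "k * (poly Q z)\<^sup>2 + 2 * k * poly Q z * (z * poly R z) + (z * poly R z)\<^sup>2 = 0"
    using a q0 by (simp add: power_mult_distrib ac_simps)
  moreover have "z * poly R z = - poly Q z" using qr by simp
  ultimately have "(1 - k) * (poly Q z)\<^sup>2 = 0" by (simp add: algebra_simps power2_eq_square)
  then show False using q0 k by simp
qed

text \<open>Dividing out the power of x at 0 leaves a polynomial without roots, which is
  constant.\<close>

lemma monomial_if_no_nonzero_root:
  fixes R :: "complex poly"
  assumes "\<And>z. z \<noteq> 0 \<Longrightarrow> poly R z = 0 \<Longrightarrow> R = 0"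
  shows "\<exists>\<kappa> q. R = monom \<kappa> q"
proof (cases "R = 0")
  case True
  then show ?thesis by (metis monom_0 pCons_0_0)
next
  case False
  then obtain S where S: "R = [:0, 1:] ^ order 0 R * S" and nd: "\<not> [:0, 1:] dvd S"
    using order_decomp[of R 0] by auto
  have "poly S z \<noteq> 0" for z
  proof (cases "z = 0")
    case True
    then show ?thesis using nd poly_eq_0_iff_dvd[of S 0] by simp
  next
    case nz: False
    show ?thesis
    proof
      assume "poly S z = 0"
      then have "poly R z = 0" by (subst S) simp
      then show False using assms nz False by blast
    qed
  qed
  then have "constant (poly S)" using fundamental_theorem_of_algebra by blast
  then obtain s where "S = [:s:]" by (metis constant_degree degree_eq_zeroE)
  then have "R = monom s (order 0 R)" using S by (simp add: monom_altdef)
  then show ?thesis by blast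
qed

text \<open>\<open>P\<close>, \<open>H\<close>, \<open>Q\<close> are the dehomogenised derivatives \<open>F\<^sub>z\<^sub>z\<close>, \<open>F\<^sub>z\<^sub>w\<close>, \<open>F\<^sub>w\<^sub>w\<close> of a binary form of degree \<open>n + 2\<close>. The
  quotient \<open>x P / H\<close> solves an autonomous equation in \<open>ln x\<close> whose stationary points are the roots \<open>l\<close>
  of the quadratic, and so cannot take the value \<open>l\<close> without being constant.\<close>

lemma rational_solution_roots:
  fixes H P Q :: "complex poly" and n :: nat and k l :: complex
  assumes dQ: "pderiv Q = [:of_nat n:] * H - [:0,1:] * pderiv H"
    and dH: "pderiv H = [:of_nat n:] * P - [:0,1:] * pderiv P"
    and PQ: "P * Q = [:k:] * H\<^sup>2" and k: "k \<noteq> 0" "k \<noteq> 1" and n: "n > 0"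
    and l: "l\<^sup>2 + l * (k * (of_nat n + 2) - of_nat n) + k = 0"
    and nz: "H \<noteq> 0" "P \<noteq> 0" and z: "z \<noteq> 0" and root: "poly ([:0,1:] * P - [:l:] * H) z = 0"
  shows "[:0,1:] * P - [:l:] * H = 0"
proof (rule ccontr)
  define X :: "complex poly" where "X = [:0,1:]"
  define K where "K = [:k:]"
  define N where "N = [:of_nat n :: complex:]"
  define \<Lambda> where "\<Lambda> = [:l:]"
  define E where "E = K * H\<^sup>2 + 2 * K * X * H * P + X\<^sup>2 * P\<^sup>2"
  \<comment> \<open>Zeros of R away from 0 are the points where x P / H takes the value l, or where
    H and P both vanish.\<close>
  define R where "R = X * P - \<Lambda> * H"
  assume "[:0,1:] * P - [:l:] * H \<noteq> 0"
  then have R0: "R \<noteq> 0" by (simp add: R_def X_def \<Lambda>_def)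
  have Rz: "poly R z = 0" using root by (simp add: R_def X_def \<Lambda>_def)
  have L: "\<Lambda>\<^sup>2 + \<Lambda> * (K * (N + 2) - N) + K = 0"
    using l by (simp add: \<Lambda>_def K_def N_def power2_eq_square numeral_poly algebra_simps)
  note dQ = dQ[folded X_def N_def] and dH = dH[folded X_def N_def] and PQ = PQ[folded K_def]
  have "pderiv (P * Q) = pderiv (K * H\<^sup>2)" using PQ by simp
  then have "pderiv P * Q + P * pderiv Q = 2 * K * H * pderiv H"
    by (simp add: pderiv_mult K_def pderiv_pCons power2_eq_square pderiv_smult algebra_simps)
  then have "X * pderiv P * Q + X * P * pderiv Q = 2 * K * X * H * pderiv H"
    by algebra
  then have "pderiv H * (Q + X\<^sup>2 * P + 2 * K * X * H) = N * H * (K * H + X * P)"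
    using dQ dH PQ by algebra
  \<comment> \<open>The autonomous equation with denominators cleared: \<open>dQ\<close> and
    \<open>dH\<close> have removed the derivatives of Q and P, and \<open>PQ\<close> has removed
    Q.\<close>
  then have HE: "pderiv H * E = N * H * P * (K * H + X * P)"
    unfolding E_def using PQ by algebra
  have pX: "pderiv X = 1" by (simp add: X_def pderiv_pCons)
  have "pderiv R = P + X * pderiv P - \<Lambda> * pderiv H"
    by (simp add: R_def pderiv_diff pderiv_mult pX \<Lambda>_def pderiv_smult)
  then have "pderiv R = (1 + N) * P - (1 + \<Lambda>) * pderiv H" using dH by algebra
  then have "pderiv R * E = (1 + N) * P * E - (1 + \<Lambda>) * (N * H * P * (K * H + X * P))"
    using HE by algebra
  \<comment> \<open>R divides the left side precisely because l is a root of the quadratic in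
    \<open>L\<close>.\<close>
  then have RE: "pderiv R * E = R * (P * ((N + 1) * X * P + (\<Lambda> * (N + 1) + 2 * K * (N + 1) - (1 + \<Lambda>) * N) * H))"
    using L unfolding E_def R_def by algebra
  have "pderiv R \<noteq> 0"
  proof
    assume "pderiv R = 0"
    then obtain r where "R = [:r:]" using pderiv_eq_0_iff degree_eq_zeroE by metis
    with Rz R0 show False by simp
  qed
  then have ord: "order z R = Suc (order z (pderiv R))"
    using order_pderiv[of R z] Rz R0 order_root[of R z] by (metis neq0_conv)
  \<comment> \<open>At z the order of R' is one less than that of R, so by \<open>RE\<close> the
    missing zero must come from E.\<close>
  have Ez: "poly E z = 0"
  proof (rule ccontr)
    assume "poly E z \<noteq> 0"
    then have E: "E \<noteq> 0" "order z E = 0" by (auto simp: order_root)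
    then have *: "pderiv R * E \<noteq> 0" using \<open>pderiv R \<noteq> 0\<close> by simp
    then have "order z (pderiv R * E) = order z (pderiv R)" using E by (simp add: order_mult)
    moreover have "order z (pderiv R * E) \<ge> order z R" using * unfolding RE by (subst order_mult) auto
    ultimately show False using ord by simp
  qed
  have u: "z * poly P z = l * poly H z" using Rz by (simp add: R_def X_def \<Lambda>_def)
  have "poly E z = k * (poly H z)\<^sup>2 + 2 * k * poly H z * (z * poly P z) + (z * poly P z)\<^sup>2"
    by (simp add: E_def X_def K_def power_mult_distrib)
  also have "\<dots> = (poly H z)\<^sup>2 * (k + 2 * k * l + l\<^sup>2)" unfolding u by (simp add: algebra_simps power2_eq_square)
  \<comment> \<open>The quadratic for l replaces l^2, leaving a factor that is nonzero as n > 0, l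
    \<noteq> 0 and k \<noteq> 1; so H, and then P, vanishes at z.\<close>
  also have "k + 2 * k * l + l\<^sup>2 = of_nat n * l * (1 - k)" using l by algebra
  finally have "(poly H z)\<^sup>2 * (of_nat n * l * (1 - k)) = 0" using Ez by simp
  moreover have "l \<noteq> 0" using l k by auto
  ultimately have H: "poly H z = 0" using n k by simp
  then have "poly P z = 0" using u z by simp
  from no_common_root[OF z nz dH[unfolded N_def X_def] HE[unfolded E_def N_def X_def K_def] k(2) H this]
  show False .
qed

text \<open>Cross-multiplication eliminates l and leaves i (i + 1) = (n - i)(n - i + 1), where j (j
  + 1) is strictly increasing in j. It is applied to an index and its mirror image in the support of
  H.\<close>

lemma balanced_index:
  fixes l :: complex and i n :: nat
  assumes "i \<le> n" "of_nat i = l * of_nat (Suc n - i)" "of_nat (n - i) = l * of_nat (Suc i)"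
  shows "2 * i = n"
proof -
  have "(of_nat (i * Suc i) :: complex) = of_nat ((n - i) * (Suc n - i))"
    using assms(2,3) by (metis (no_types, lifting) mult.assoc mult.commute of_nat_mult)
  then have e: "i * Suc i = (n - i) * (Suc n - i)" by (simp only: of_nat_eq_iff)
  obtain m where m: "n = i + m" using assms(1) le_Suc_ex by blast
  then have "i * Suc i = m * Suc m" using e by simp
  moreover have "i * Suc i < m * Suc m" if "i < m" using that by (intro mult_strict_mono) auto
  moreover have "m * Suc m < i * Suc i" if "m < i" using that by (intro mult_strict_mono) auto
  ultimately have "i = m" by (cases i m rule: linorder_cases) auto
  then show ?thesis using m by simp
qed

text \<open>By \<open>rational_solution_roots\<close> the polynomial x P - l H is a monomial. All
  nonzero coefficients of H but at most one therefore satisfy the same linear relation i = l (n + 1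
  - i), and by reflection H lives at n/2 or on a symmetric pair of indices. Comparing coefficients
  in P Q = k H^2 gives k in the first case and a contradiction in the second.\<close>

lemma leading_form_exponent:
  fixes H P Q :: "complex poly" and n :: nat and k :: complex
  assumes n: "n > 0" and deg: "degree H \<le> n" "degree P \<le> n" "degree Q \<le> n"
    and dQ: "pderiv Q = [:of_nat n:] * H - [:0,1:] * pderiv H"
    and dH: "pderiv H = [:of_nat n:] * P - [:0,1:] * pderiv P"
    and PQ: "P * Q = [:k:] * H\<^sup>2" and k1: "k \<noteq> 1"
    and reflP: "\<And>i. i \<le> n \<Longrightarrow> coeff Q (n - i) = cnj (coeff P i)"
    and reflH: "\<And>i. i \<le> n \<Longrightarrow> coeff H (n - i) = cnj (coeff H i)"
    and nz: "H \<noteq> 0 \<or> Q \<noteq> 0"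
  shows "even n \<and> k = (of_nat n / (of_nat n + 2))\<^sup>2"
proof -
  have P0: "P = 0 \<longleftrightarrow> Q = 0"
  proof
    assume "P = 0"
    have "coeff Q i = 0" for i
      using reflP[of "n - i"] deg(3) \<open>P = 0\<close> coeff_eq_0[of Q i] by (cases "i \<le> n") auto
    then show "Q = 0" by (simp add: poly_eqI)
  next
    assume "Q = 0"
    have "coeff P i = 0" for i
      using reflP[of i] deg(2) \<open>Q = 0\<close> coeff_eq_0[of P i] by (cases "i \<le> n") auto
    then show "P = 0" by (simp add: poly_eqI)
  qed
  have cH: "of_nat (Suc i) * coeff H (Suc i) = of_nat (n - i) * coeff P i" if "i \<le> n" for i
  proof -
    have "coeff (pderiv H) i = of_nat n * coeff P i - coeff ([:0,1:] * pderiv P) i"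
      unfolding dH by simp
    moreover have "coeff ([:0,1:] * pderiv P) i = of_nat i * coeff P i"
      by (cases i) (auto simp: coeff_pderiv)
    ultimately show ?thesis using that by (simp add: coeff_pderiv of_nat_diff algebra_simps)
  qed
  have PnQ: "P \<noteq> 0"
  proof
    assume "P = 0"
    then have "Q = 0" using P0 by simp
    have "pderiv H = 0" using dH \<open>P = 0\<close> by simp
    moreover have "[:of_nat n:] * H - [:0,1:] * pderiv H = 0" using dQ \<open>Q = 0\<close> by simp
    ultimately have "H = 0" using n by simp
    then show False using nz \<open>Q = 0\<close> by simp
  qed
  then have Q0: "Q \<noteq> 0" using P0 by simp
  have k0: "k \<noteq> 0" and H0: "H \<noteq> 0" using PQ PnQ Q0 by auto
  obtain l where l: "l\<^sup>2 + l * (k * (of_nat n + 2) - of_nat n) + k = 0"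
  proof -
    define b where "b = k * (of_nat n + 2) - of_nat n"
    define r where "r = csqrt (b\<^sup>2 - 4 * k)"
    have r: "r * r = b * b - 4 * k" using power2_csqrt[of "b\<^sup>2 - 4 * k"] by (simp add: r_def power2_eq_square)
    define l where "l = (r - b) / 2"
    have "4 * (l * l + l * b + k) = (2 * l) * (2 * l) + 2 * (2 * l) * b + 4 * k" by (simp add: algebra_simps)
    also have "2 * l = r - b" by (simp add: l_def)
    also have "(r - b) * (r - b) + 2 * (r - b) * b + 4 * k = 0" using r by (simp add: algebra_simps)
    finally have "l * l + l * b + k = 0" by (simp only: mult_eq_0_iff) simp
    then show ?thesis using that b_def by (simp add: power2_eq_square)
  qed
  define R where "R = [:0,1:] * P - [:l:] * H"
  obtain \<kappa> q where R: "R = monom \<kappa> q"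
    using monomial_if_no_nonzero_root[of R] rational_solution_roots[OF dQ dH PQ k0 k1 n l H0 PnQ]
    unfolding R_def by blast
  \<comment> \<open>By \<open>cH\<close> the coefficient of degree i in x P is i / (n + 1 - i) times
    that of H; clearing this denominator gives the factor on the left.\<close>
  have cR: "of_nat (Suc n - i) * coeff R i = coeff H i * (of_nat i - l * of_nat (Suc n - i))" if "i \<le> n" for i
  proof (cases i)
    case 0
    then show ?thesis by (simp add: R_def)
  next
    case (Suc j)
    then have "of_nat (Suc n - i) * coeff R i = of_nat (n - j) * coeff P j - of_nat (n - j) * (l * coeff H i)"
      by (simp add: R_def algebra_simps)
    also have "of_nat (n - j) * coeff P j = of_nat i * coeff H i" using cH[of j] that Suc by simp
    finally show ?thesis using Suc by (simp add: algebra_simps)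
  qed
  have bal: "of_nat i = l * of_nat (Suc n - i)" if "i \<le> n" "coeff H i \<noteq> 0" "i \<noteq> q" for i
    using cR[OF that(1)] that by (simp add: R)
  have refl0: "coeff H (n - i) \<noteq> 0" if "i \<le> n" "coeff H i \<noteq> 0" for i
    using reflH[OF that(1)] that by simp
  have cP: "coeff P i = of_nat (Suc i) * coeff H (Suc i) / of_nat (n - i)" if "i < n" for i
    using cH[of i] that by (simp add: field_simps)
  show ?thesis
  proof (cases "\<forall>i\<le>n. coeff H i \<noteq> 0 \<longrightarrow> 2 * i = n")
    case True
    have ex: "\<exists>i\<le>n. coeff H i \<noteq> 0"
      using H0 deg(1) by (metis coeff_eq_0 leading_coeff_0_iff order.trans)
    then obtain m where m: "2 * m = n" "coeff H m \<noteq> 0" using True by blast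
    define h where "h = coeff H m"
    have Hm: "H = monom h m"
    proof (rule poly_eqI)
      fix i show "coeff H i = coeff (monom h m) i"
        using True m deg(1) coeff_eq_0[of H i] by (cases "i \<le> n") (auto simp: h_def)
    qed
    have m0: "m > 0" using m n by simp
    define p where "p = of_nat m * h / of_nat (Suc m)"
    \<comment> \<open>The relation \<open>cH\<close> leaves the top coefficient of P free, because
      its factor n - i is 0 there. The term of degree m - 1 in P Q forces it to vanish.\<close>
    define f where "f = coeff P n"
    have Pm: "P = monom p (m - 1) + monom f n"
    proof (rule poly_eqI)
      fix i consider "i < n" | "i = n" | "i > n" by linarith
      then show "coeff P i = coeff (monom p (m - 1) + monom f n) i"
      proof cases
        case 1
        then show ?thesis using cP[of i] m m0 by (auto simp: Hm p_def)
      qed (use m m0 deg(2) coeff_eq_0[of P i] in \<open>auto simp: f_def\<close>)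
    qed
    have Qm: "Q = monom (cnj p) (m + 1) + monom (cnj f) 0"
    proof (rule poly_eqI)
      fix i show "coeff Q i = coeff (monom (cnj p) (m + 1) + monom (cnj f) 0) i"
      proof (cases "i \<le> n")
        case True
        then have "coeff Q i = cnj (coeff P (n - i))" using reflP[of "n - i"] by simp
        then show ?thesis using True m m0 by (auto simp: Pm)
      next
        case False
        then show ?thesis using deg(3) m m0 coeff_eq_0[of Q i] by auto
      qed
    qed
    have prod: "monom (p * cnj p) (m + m) + monom (p * cnj f) (m - 1) + monom (f * cnj p) (n + m + 1) + monom (f * cnj f) n
        = monom (k * h\<^sup>2) (m + m)"
      using PQ m0 unfolding Pm Qm Hm by (simp add: algebra_simps mult_monom power2_eq_square smult_monom)
    have "coeff (monom (p * cnj p) (m + m) + monom (p * cnj f) (m - 1) + monom (f * cnj p) (n + m + 1) + monom (f * cnj f) n) (m - 1)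
      = p * cnj f" using m m0 by auto
    moreover have "m + m \<noteq> m - 1" using m0 by linarith
    ultimately have "p * cnj f = 0" unfolding prod by simp
    moreover have "p \<noteq> 0" using m m0 by (simp add: p_def h_def del: of_nat_Suc)
    ultimately have "f = 0" by simp
    have "coeff (monom (p * cnj p) (m + m)) (m + m) = k * h\<^sup>2" using prod \<open>f = 0\<close> by simp
    moreover have "n - m = m" using m by simp
    then have "cnj h = h" using reflH[of m] m by (simp add: h_def)
    then have "cnj p = p" by (simp add: p_def)
    ultimately have "p\<^sup>2 = k * h\<^sup>2" by (simp add: power2_eq_square)
    then have "(of_nat m / of_nat (Suc m))\<^sup>2 * h\<^sup>2 = k * h\<^sup>2"
      by (simp add: p_def power_mult_distrib power_divide del: of_nat_Suc)
    then have "k = (of_nat m / of_nat (Suc m))\<^sup>2" using m by (simp add: h_def)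
    also have "(of_nat m / of_nat (Suc m) :: complex) = of_nat n / (of_nat n + 2)"
    proof -
      have "(of_nat n + 2 :: complex) = 2 * of_nat (Suc m)" "(of_nat n :: complex) = 2 * of_nat m"
        unfolding m(1)[symmetric] by simp_all
      then show ?thesis by (simp del: of_nat_Suc)
    qed
    finally show ?thesis using m by auto
  next
    case False
    then obtain j where j: "j \<le> n" "coeff H j \<noteq> 0" "2 * j \<noteq> n" by blast
    define x where "x = min j (n - j)"
    have x: "x < n - x" "coeff H x \<noteq> 0" "coeff H (n - x) \<noteq> 0"
      using j refl0[OF j(1,2)] by (auto simp: x_def min_def)
    have qx: "q = x \<or> q = n - x"
    proof (rule ccontr)
      assume "\<not> ?thesis"
      then have "of_nat x = l * of_nat (Suc n - x)" "of_nat (n - x) = l * of_nat (Suc n - (n - x))"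
        using bal[of x] bal[of "n - x"] x by auto
      then have "2 * x = n" using x by (intro balanced_index[of x n l]) auto
      then show False using x by simp
    qed
    have uniq: "i = i'" if "i \<le> n" "i' \<le> n" "of_nat i = l * of_nat (Suc n - i)" "of_nat i' = l * of_nat (Suc n - i')" for i i'
    proof -
      have "of_nat i * (of_nat (Suc n - i') :: complex) = of_nat i' * of_nat (Suc n - i)"
        using that(3,4) by (metis mult.assoc mult.commute)
      then have "i * (Suc n - i') = i' * (Suc n - i)" by (metis of_nat_eq_iff of_nat_mult)
      then have "int i * (int n + 1 - int i') = int i' * (int n + 1 - int i)"
        using that(1,2) by (metis of_nat_mult of_nat_diff of_nat_Suc le_SucI add.commute)
      then have "int i * (int n + 1) = int i' * (int n + 1)" by (simp add: algebra_simps)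
      then have "int i = int i'" by (subst (asm) mult_cancel_right) auto
      then show ?thesis by simp
    qed
    \<comment> \<open>The member y of the pair other than q satisfies the linear relation, as would
      a third index; by \<open>uniq\<close> they coincide.\<close>
    have supp: "i = x \<or> i = n - x" if "i \<le> n" "coeff H i \<noteq> 0" for i
    proof (rule ccontr)
      assume *: "\<not> ?thesis"
      define y where "y = (if q = x then n - x else x)"
      have y: "y \<le> n" "coeff H y \<noteq> 0" "y \<noteq> q" "i \<noteq> y" using x qx * by (auto simp: y_def)
      have "i \<noteq> q" using qx * by auto
      then show False using uniq[OF that(1) y(1) bal bal] that y by blast
    qed
    define h where "h = coeff H x"
    have h': "coeff H (n - x) = cnj h" using reflH[of x] x by (simp add: h_def)
    have Hm: "H = monom h x + monom (cnj h) (n - x)"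
    proof (rule poly_eqI)
      fix i show "coeff H i = coeff (monom h x + monom (cnj h) (n - x)) i"
        using supp[of i] x h' deg(1) coeff_eq_0[of H i] by (cases "i \<le> n") (auto simp: h_def)
    qed
    define a :: real where "a = real x / real (Suc n - x)"
    define b :: real where "b = real (n - x) / real (Suc x)"
    have "coeff P n = coeff R (Suc n)" using deg(1) coeff_eq_0[of H "Suc n"] by (simp add: R_def)
    then have Pn: "coeff P n = 0" using qx x by (auto simp: R)
    have XP: "[:0,1:] * P = monom (of_real a * h) x + monom (of_real b * cnj h) (n - x)"
    proof (rule poly_eqI)
      fix i
      have "i = 0 \<or> (\<exists>j<n. i = Suc j) \<or> i = Suc n \<or> i > Suc n" by (cases i) auto
      then consider "i = 0" | j where "i = Suc j" "j < n" | "i = Suc n" | "i > Suc n" by blast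
      then show "coeff ([:0,1:] * P) i = coeff (monom (of_real a * h) x + monom (of_real b * cnj h) (n - x)) i"
      proof cases
        case 1
        then show ?thesis using x by (auto simp: a_def)
      next
        case (2 j)
        consider "Suc j = x" | "Suc j = n - x" | "Suc j \<noteq> x" "Suc j \<noteq> n - x" by blast
        then have "coeff P j = coeff (monom (of_real a * h) x + monom (of_real b * cnj h) (n - x)) (Suc j)"
        proof cases
          case j: 1
          then have "n - j = Suc n - x" using 2 by simp
          then show ?thesis
            using cP[OF 2(2)] x j unfolding h_def a_def by (simp del: of_nat_diff of_nat_Suc)
        next
          case j: 2
          then have "n - j = Suc x" using 2 by simp
          then show ?thesis
            using cP[OF 2(2)] x j h' unfolding b_def by (simp del: of_nat_diff of_nat_Suc)
        next
          case j: 3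
          then have "coeff H (Suc j) = 0" using supp[of "Suc j"] 2 by auto
          then show ?thesis using cP[OF 2(2)] j by simp
        qed
        then show ?thesis using 2 by simp
      next
        case 3
        then show ?thesis using Pn x by auto
      next
        case 4
        then show ?thesis using x deg(2) coeff_eq_0[of P "i - 1"] by (cases i) auto
      qed
    qed
    have Qm: "Q = monom (of_real a * cnj h) (n - x + 1) + monom (of_real b * h) (x + 1)"
    proof (rule poly_eqI)
      fix i show "coeff Q i = coeff (monom (of_real a * cnj h) (n - x + 1) + monom (of_real b * h) (x + 1)) i"
      proof (cases "i \<le> n")
        case True
        then have "coeff Q i = cnj (coeff P (n - i))" using reflP[of "n - i"] by simp
        also have "coeff P (n - i) = coeff ([:0,1:] * P) (Suc (n - i))" by simp
        finally show ?thesis unfolding XP using True x by auto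
      next
        case False
        then show ?thesis using deg(3) x coeff_eq_0[of Q i] by (auto simp: a_def)
      qed
    qed
    have X1: "[:0,1:] = monom (1::complex) 1" by (simp add: monom_altdef)
    have "(monom (of_real a * h) x + monom (of_real b * cnj h) (n - x)) *
        (monom (of_real a * cnj h) (n - x + 1) + monom (of_real b * h) (x + 1)) = [:0,1:] * P * Q"
      by (simp only: XP Qm)
    also have "\<dots> = [:0,1:] * ([:k:] * H\<^sup>2)" using PQ by (simp only: mult.assoc)
    also have "\<dots> = monom 1 1 * ([:k:] * (monom h x + monom (cnj h) (n - x))\<^sup>2)"
      by (simp only: X1 Hm)
    finally have "(monom (of_real a * h) x + monom (of_real b * cnj h) (n - x)) *
        (monom (of_real a * cnj h) (n - x + 1) + monom (of_real b * h) (x + 1)) =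
        monom 1 1 * ([:k:] * (monom h x + monom (cnj h) (n - x))\<^sup>2)" .
    then have prod: "monom (of_real a * h * (of_real a * cnj h)) (n + 1) + monom (of_real b * cnj h * (of_real b * h)) (n + 1)
        + monom (of_real a * h * (of_real b * h)) (x + x + 1)
        + monom (of_real b * cnj h * (of_real a * cnj h)) ((n - x) + (n - x) + 1)
      = monom (k * (h * cnj h)) (n + 1) + monom (k * (h * cnj h)) (n + 1) + monom (k * (h * h)) (x + x + 1)
        + monom (k * (cnj h * cnj h)) ((n - x) + (n - x) + 1)" (is "?L = ?R")
      using x by (simp add: power2_eq_square distrib_left distrib_right mult_monom smult_monom smult_add_right ac_simps)
    have hn: "h \<noteq> 0" "h * cnj h \<noteq> 0" using x by (auto simp: h_def)
    have ne: "n \<noteq> x + x" "n \<noteq> (n - x) + (n - x)" "x + x \<noteq> (n - x) + (n - x)" using x by auto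
    \<comment> \<open>The coefficients at 2 x + 1 and n + 1 give a b = k and a^2 + b^2 = 2 k, so a =
      b; but x < n - x makes a < b.\<close>
    have "coeff ?L (x + x + 1) = coeff ?R (x + x + 1)" by (rule arg_cong[OF prod])
    then have "of_real a * h * (of_real b * h) = k * (h * h)"
      unfolding coeff_add coeff_monom using ne by simp
    then have "(of_real a * of_real b - k) * (h * h) = 0" by algebra
    then have "of_real a * of_real b - k = 0" using hn(1) by (metis mult_eq_0_iff)
    then have ab: "of_real (a * b) = k" by simp
    have "coeff ?L (n + 1) = coeff ?R (n + 1)" by (rule arg_cong[OF prod])
    then have "of_real a * h * (of_real a * cnj h) + of_real b * cnj h * (of_real b * h) = k * (h * cnj h) + k * (h * cnj h)"
      unfolding coeff_add coeff_monom using ne by simp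
    then have "(of_real a * of_real a + of_real b * of_real b - 2 * k) * (h * cnj h) = 0" by algebra
    then have "of_real a * of_real a + of_real b * of_real b - 2 * k = 0" using hn(2) by (metis mult_eq_0_iff)
    then have "of_real (a * a + b * b) = 2 * k" by simp
    then have "complex_of_real (a * a + b * b) = of_real (2 * (a * b))" unfolding ab[symmetric] by simp
    then have "a * a + b * b = 2 * (a * b)" by (simp only: of_real_eq_iff)
    then have "(a - b)\<^sup>2 = 0" by (simp add: power2_eq_square algebra_simps)
    then have "a = b" by simp
    moreover have "a < b"
    proof -
      have "a \<le> real x / real (Suc x)" unfolding a_def using x by (intro divide_left_mono) auto
      also have "\<dots> < b" unfolding b_def using x by (intro divide_strict_right_mono) auto
      finally show ?thesis .
    qed
    ultimately show ?thesis by simp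
  qed
qed

section \<open>Plane maps with nearly symmetric differential\<close>

text \<open>The chain rule: z = exp(s + \<i> \<theta>) has s-derivative z and \<theta>-derivative
  \<i> z.\<close>

lemma polar_derivatives:
  assumes "smooth_open U f" "of_real (exp s) * cis \<theta> \<in> U"
  defines "z \<equiv> of_real (exp s) * cis \<theta>"
  shows "((\<lambda>s. f (of_real (exp s) * cis \<theta>)) has_vector_derivative (z * Dz f z + cnj z * Dw f z)) (at s)"
    and "((\<lambda>\<theta>. f (of_real (exp s) * cis \<theta>)) has_vector_derivative \<i> * (z * Dz f z - cnj z * Dw f z)) (at \<theta>)"
proof -
  have D: "(f has_derivative (\<lambda>v. v * Dz f z + cnj v * Dw f z)) (at z within A)" for A
    using has_derivative_Dz_Dw[OF assms(1)] assms(2) has_derivative_at_withinI unfolding z_def by blast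
  have 1: "((\<lambda>s. of_real (exp s) * cis \<theta>) has_vector_derivative z) (at s)"
    unfolding z_def by (auto intro!: derivative_eq_intros simp: has_vector_derivative_def scaleR_conv_of_real)
  have 2: "((\<lambda>\<theta>. of_real (exp s) * cis \<theta>) has_vector_derivative \<i> * z) (at \<theta>)"
    unfolding z_def by (auto intro!: derivative_eq_intros simp: has_vector_derivative_def scaleR_conv_of_real)
  show "((\<lambda>s. f (of_real (exp s) * cis \<theta>)) has_vector_derivative (z * Dz f z + cnj z * Dw f z)) (at s)"
    using vector_derivative_diff_chain_within[OF 1, of f "\<lambda>v. v * Dz f z + cnj v * Dw f z"] D
    by (simp add: o_def z_def)
  show "((\<lambda>\<theta>. f (of_real (exp s) * cis \<theta>)) has_vector_derivative \<i> * (z * Dz f z - cnj z * Dw f z)) (at \<theta>)"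
    using vector_derivative_diff_chain_within[OF 2, of f "\<lambda>v. v * Dz f z + cnj v * Dw f z"] D
    by (simp add: o_def z_def algebra_simps)
qed

text \<open>With A = z f_z and B = cnj z f_w the polar derivatives are A + B and \<i> (A - B). Their
  squared norms add up to 2 (|A|^2 + |B|^2) and their Jacobian is |A|^2 - |B|^2, so the inequality
  carries over with 2 K in place of K.\<close>

lemma flat_quasiregular_vanishes:
  assumes U: "open U" "0 \<in> U" and f: "smooth_open U f"
    and flat: "\<And>n. \<forall>\<^sub>F z in nhds 0. norm (f z) \<le> norm z ^ n"
    and K: "K > 0" and qr: "\<forall>\<^sub>F z in nhds 0. (norm (Dz f z))\<^sup>2 + (norm (Dw f z))\<^sup>2 \<le> K * ((norm (Dz f z))\<^sup>2 - (norm (Dw f z))\<^sup>2)"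
  shows "\<forall>\<^sub>F z in nhds 0. f z = 0"
proof -
  define P where "P s \<theta> = of_real (exp s) * cis \<theta>" for s \<theta>
  have nP: "norm (P s \<theta>) = exp s" for s \<theta> by (simp add: P_def norm_mult)
  have small: "\<forall>\<^sub>F z in nhds 0. norm (f z) \<le> 1 / 2"
    using flat[of 1] eventually_nhds_ball[of "1/2" "0::complex"] by (auto elim: eventually_elim2)
  have "((\<lambda>z. norm (\<i> * (z * Dz f z - cnj z * Dw f z))) \<longlongrightarrow> norm (\<i> * (0 * Dz f 0 - cnj 0 * Dw f 0))) (nhds 0)"
  proof -
    have "isCont (Dz f) 0" "isCont (Dw f) 0"
      using smooth_open_continuous_on[OF smooth_Dz[OF U(1) f]] smooth_open_continuous_on[OF smooth_Dw[OF U(1) f]] U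
      by (auto simp: continuous_on_eq_continuous_at)
    then have "(Dz f \<longlongrightarrow> Dz f 0) (nhds 0)" "(Dw f \<longlongrightarrow> Dw f 0) (nhds 0)"
      by (auto simp: isCont_def tendsto_at_iff_tendsto_nhds)
    then show ?thesis by (intro tendsto_intros filterlim_ident)
  qed
  then have "\<forall>\<^sub>F z in nhds 0. norm (\<i> * (z * Dz f z - cnj z * Dw f z)) < 1"
    by (rule order_tendstoD(2)) simp
  moreover have "\<forall>\<^sub>F z in nhds 0. z \<in> U" using U by (intro eventually_nhds_in_open)
  ultimately have "\<forall>\<^sub>F z in nhds 0. norm (\<i> * (z * Dz f z - cnj z * Dw f z)) < 1 \<and> z \<in> U \<and> norm (f z) \<le> 1/2 \<and>
      (norm (Dz f z))\<^sup>2 + (norm (Dw f z))\<^sup>2 \<le> K * ((norm (Dz f z))\<^sup>2 - (norm (Dw f z))\<^sup>2)"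
    using small qr by eventually_elim simp
  then obtain e where e: "e > 0" and *: "\<And>z. norm z < e \<Longrightarrow> norm (\<i> * (z * Dz f z - cnj z * Dw f z)) < 1 \<and> z \<in> U \<and> norm (f z) \<le> 1/2 \<and>
      (norm (Dz f z))\<^sup>2 + (norm (Dw f z))\<^sup>2 \<le> K * ((norm (Dz f z))\<^sup>2 - (norm (Dw f z))\<^sup>2)"
    unfolding eventually_nhds_metric by auto
  define S where "S = ln e"
  have S: "exp s < e" if "s < S" for s using that e by (metis S_def exp_less_mono exp_ln)
  define A where "A z = z * Dz f z" for z
  define B where "B z = cnj z * Dw f z" for z
  \<comment> \<open>This is z times the \<open>Dz\<close>-derivative of A; likewise
    \<open>B'\<close> is cnj z times the \<open>Dw\<close>-derivative of B. In the mixed polar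
    derivative the terms with \<open>Dw (Dz f)\<close> cancel.\<close>
  define A' where "A' z = z * Dz f z + z * z * Dz (Dz f) z" for z
  define B' where "B' z = cnj z * Dw f z + cnj z * cnj z * Dw (Dw f) z" for z
  have PU: "P s \<theta> \<in> U" if "s < S" for s \<theta> using * S[OF that] by (simp add: nP)
  have comm: "Dw (Dz f) (P s \<theta>) = Dz (Dw f) (P s \<theta>)" if "s < S" for s \<theta>
    using Dz_Dw_commute[OF U(1) f PU[OF that]] by simp
  have Ps: "((\<lambda>s. P s \<theta>) has_vector_derivative P s \<theta>) (at s)" for s \<theta>
    unfolding P_def by (auto intro!: derivative_eq_intros simp: has_vector_derivative_def scaleR_conv_of_real)
  have Pt: "(P s has_vector_derivative \<i> * P s \<theta>) (at \<theta>)" for s \<theta>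
    unfolding P_def[abs_def] by (auto intro!: derivative_eq_intros simp: has_vector_derivative_def scaleR_conv_of_real)
  have cPs: "((\<lambda>s. cnj (P s \<theta>)) has_vector_derivative cnj (P s \<theta>)) (at s)" for s \<theta>
    by (rule has_vector_derivative_cnj[OF Ps])
  have cPt: "((\<lambda>\<theta>. cnj (P s \<theta>)) has_vector_derivative cnj (\<i> * P s \<theta>)) (at \<theta>)" for s \<theta>
    by (rule has_vector_derivative_cnj[OF Pt])
  note pd = polar_derivatives[folded P_def]
  note smz = smooth_Dz[OF U(1) f] and smw = smooth_Dw[OF U(1) f]
  have contP: "continuous_on ({..<S} \<times> UNIV) (\<lambda>x. h (P (fst x) (snd x)))" if "smooth_open U h" for h :: "complex \<Rightarrow> complex"
  proof (rule continuous_on_compose2[OF smooth_open_continuous_on[OF that]])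
    show "continuous_on ({..<S} \<times> UNIV) (\<lambda>x. P (fst x) (snd x))"
      unfolding P_def cis_conv_exp by (intro continuous_intros)
  qed (auto simp: PU)
  have contPP: "continuous_on ({..<S} \<times> UNIV) (\<lambda>x. P (fst x) (snd x))"
    unfolding P_def cis_conv_exp by (intro continuous_intros)
  interpret flat_quasiregular_polar "\<lambda>s \<theta>. f (P s \<theta>)" "\<lambda>s \<theta>. A (P s \<theta>) + B (P s \<theta>)" "\<lambda>s \<theta>. \<i> * (A (P s \<theta>) - B (P s \<theta>))"
    "\<lambda>s \<theta>. \<i> * (A' (P s \<theta>) - B' (P s \<theta>))" S "2 * K"
  proof unfold_locales
    fix s \<theta> :: real assume s: "s < S"
    show "((\<lambda>s. f (P s \<theta>)) has_vector_derivative A (P s \<theta>) + B (P s \<theta>)) (at s)"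
      unfolding A_def B_def by (rule pd(1)[OF f PU[OF s]])
    show "((\<lambda>\<theta>. f (P s \<theta>)) has_vector_derivative \<i> * (A (P s \<theta>) - B (P s \<theta>))) (at \<theta>)"
      unfolding A_def B_def by (rule pd(2)[OF f PU[OF s]])
    let ?z = "P s \<theta>"
    have zs: "((\<lambda>s. P s \<theta> * Dz f (P s \<theta>)) has_vector_derivative
        ?z * (?z * Dz (Dz f) ?z + cnj ?z * Dw (Dz f) ?z) + ?z * Dz f ?z) (at s)"
      by (rule has_vector_derivative_mult[OF Ps pd(1)[OF smz PU[OF s]]])
    have ws: "((\<lambda>s. cnj (P s \<theta>) * Dw f (P s \<theta>)) has_vector_derivative
        cnj ?z * (?z * Dz (Dw f) ?z + cnj ?z * Dw (Dw f) ?z) + cnj ?z * Dw f ?z) (at s)"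
      by (rule has_vector_derivative_mult[OF cPs pd(1)[OF smw PU[OF s]]])
    have zt: "((\<lambda>\<theta>. P s \<theta> * Dz f (P s \<theta>)) has_vector_derivative
        ?z * (\<i> * (?z * Dz (Dz f) ?z - cnj ?z * Dw (Dz f) ?z)) + \<i> * ?z * Dz f ?z) (at \<theta>)"
      by (rule has_vector_derivative_mult[OF Pt pd(2)[OF smz PU[OF s]]])
    have wt: "((\<lambda>\<theta>. cnj (P s \<theta>) * Dw f (P s \<theta>)) has_vector_derivative
        cnj ?z * (\<i> * (?z * Dz (Dw f) ?z - cnj ?z * Dw (Dw f) ?z)) + cnj (\<i> * ?z) * Dw f ?z) (at \<theta>)"
      by (rule has_vector_derivative_mult[OF cPt pd(2)[OF smw PU[OF s]]])
    show "((\<lambda>s. \<i> * (A (P s \<theta>) - B (P s \<theta>))) has_vector_derivative \<i> * (A' ?z - B' ?z)) (at s)"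
      unfolding A_def B_def
      by (rule has_vector_derivative_eq_rhs[OF has_vector_derivative_mult_right[OF has_vector_derivative_diff[OF zs ws]]])
        (simp add: A'_def B'_def comm[OF s] algebra_simps)
    show "((\<lambda>\<theta>. A (P s \<theta>) + B (P s \<theta>)) has_vector_derivative \<i> * (A' ?z - B' ?z)) (at \<theta>)"
      unfolding A_def B_def
      by (rule has_vector_derivative_eq_rhs[OF has_vector_derivative_add[OF zt wt]])
        (simp add: A'_def B'_def comm[OF s] algebra_simps)
    have z: "norm ?z < e" using S[OF s] by (simp add: nP)
    show "norm (f ?z) \<le> 1 / 2" using *[OF z] by simp
    show "norm (\<i> * (A ?z - B ?z)) \<le> 1" using *[OF z] unfolding A_def B_def by linarith
    show "(norm (A ?z + B ?z))\<^sup>2 + (norm (\<i> * (A ?z - B ?z)))\<^sup>2 \<le> 2 * K * Im (cnj (A ?z + B ?z) * (\<i> * (A ?z - B ?z)))"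
    proof -
      have 1: "(norm (a + b))\<^sup>2 + (norm (\<i> * (a - b)))\<^sup>2 = 2 * ((norm a)\<^sup>2 + (norm b)\<^sup>2)"
        and 2: "Im (cnj (a + b) * (\<i> * (a - b))) = (norm a)\<^sup>2 - (norm b)\<^sup>2" for a b
        by (simp_all add: cmod_power2 norm_mult) (simp_all add: power2_eq_square algebra_simps)
      have "(norm ?z)\<^sup>2 * ((norm (Dz f ?z))\<^sup>2 + (norm (Dw f ?z))\<^sup>2) \<le> (norm ?z)\<^sup>2 * (K * ((norm (Dz f ?z))\<^sup>2 - (norm (Dw f ?z))\<^sup>2))"
        using *[OF z] by (intro mult_left_mono) auto
      then show ?thesis
        unfolding 1 2 by (simp add: A_def B_def norm_mult power_mult_distrib algebra_simps)
    qed
  next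
    show "continuous_on ({..<S} \<times> UNIV) (\<lambda>(s, \<theta>). f (P s \<theta>))"
      unfolding split_beta by (rule contP[OF f])
    show "continuous_on ({..<S} \<times> UNIV) (\<lambda>(s, \<theta>). A (P s \<theta>) + B (P s \<theta>))"
      unfolding split_beta A_def B_def by (intro continuous_intros contP contPP smz smw)
    show "continuous_on ({..<S} \<times> UNIV) (\<lambda>(s, \<theta>). \<i> * (A (P s \<theta>) - B (P s \<theta>)))"
      unfolding split_beta A_def B_def by (intro continuous_intros contP contPP smz smw)
    show "continuous_on ({..<S} \<times> UNIV) (\<lambda>(s, \<theta>). \<i> * (A' (P s \<theta>) - B' (P s \<theta>)))"
      unfolding split_beta A'_def B'_def
      by (intro continuous_intros contP contPP smooth_Dz[OF U(1) smz] smooth_Dw[OF U(1) smw] smz smw)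
  next
    fix s \<theta> :: real
    have "P s (\<theta> + 2 * pi) = P s \<theta>" by (simp add: P_def complex_eq_iff)
    then show "f (P s (\<theta> + 2 * pi)) = f (P s \<theta>)" "A (P s (\<theta> + 2 * pi)) + B (P s (\<theta> + 2 * pi)) = A (P s \<theta>) + B (P s \<theta>)"
      by simp_all
  next
    show "2 * K > 0" using K by simp
  next
    fix n :: nat
    obtain d where d: "d > 0" "\<And>z. norm z < d \<Longrightarrow> norm (f z) \<le> norm z ^ n"
      using flat[of n] unfolding eventually_nhds_metric by auto
    have "norm (f (P s \<theta>)) \<le> exp (real n * s)" if "s \<le> ln d - 1" for s \<theta>
    proof -
      have "s < ln d" using that by simp
      then have "exp s < d" using d(1) by (metis exp_less_mono exp_ln)
      then show ?thesis using d(2)[of "P s \<theta>"] by (simp add: nP exp_of_nat_mult)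
    qed
    then show "\<exists>s1. \<forall>s\<le>s1. \<forall>\<theta>. norm (f (P s \<theta>)) \<le> exp (real n * s)" by blast
  qed
  have "f z = 0" if z: "norm z < e" for z
  proof (cases "z = 0")
    \<comment> \<open>Polar coordinates miss the origin, where flatness of order 1 gives the value
      0.\<close>
    case True
    obtain d where "d > 0" "\<And>z. norm z < d \<Longrightarrow> norm (f z) \<le> norm z ^ 1"
      using assms(4)[of 1] unfolding eventually_nhds_metric by auto
    then have "norm (f 0) \<le> norm (0::complex) ^ 1" by (metis norm_zero)
    then show ?thesis using True by simp
  next
    case False
    have "ln (norm z) < S" using z False e unfolding S_def by (subst ln_less_cancel_iff) auto
    moreover have "Arg2pi z \<in> {0..2*pi}" using Arg2pi_ge_0[of z] Arg2pi_lt_2pi[of z] by simp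
    moreover have "P (ln (norm z)) (Arg2pi z) = z"
      using False Arg2pi_eq[of z] by (simp add: P_def cis_conv_exp exp_ln)
    ultimately show ?thesis using vanishes[of "ln (norm z)" "Arg2pi z"] by simp
  qed
  then show ?thesis unfolding eventually_nhds_metric using e by auto
qed

text \<open>Passing to the limit gives |a| \<le> \<epsilon> b for all \<epsilon> > 0. This turns the
  little-o hypotheses on a map into exact identities for its leading forms.\<close>

lemma limit_eq_0_if_small:
  fixes f g :: "'a \<Rightarrow> real"
  assumes f: "(f \<longlongrightarrow> a) F" and g: "(g \<longlongrightarrow> b) F" and "F \<noteq> bot"
    and small: "\<And>\<epsilon>. \<epsilon> > 0 \<Longrightarrow> \<forall>\<^sub>F x in F. \<bar>f x\<bar> \<le> \<epsilon> * g x"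
  shows "a = 0"
proof -
  have *: "\<bar>a\<bar> \<le> \<epsilon> * b" if "\<epsilon> > 0" for \<epsilon>
    by (rule tendsto_le[OF assms(3) tendsto_mult_left[OF g] tendsto_rabs[OF f] small[OF that]])
  have "\<bar>a\<bar> \<le> 0"
  proof (rule tendsto_le[of "at_right 0"])
    show "((\<lambda>\<epsilon>. \<epsilon> * b) \<longlongrightarrow> 0) (at_right 0)" by (auto intro!: tendsto_eq_intros)
    show "\<forall>\<^sub>F \<epsilon> in at_right 0. \<bar>a\<bar> \<le> \<epsilon> * b"
      using eventually_at_right_less[of 0] by eventually_elim (rule *)
  qed auto
  then show ?thesis by simp
qed

lemma poly_eq_on_circle:
  fixes p q :: "complex poly"
  assumes "\<And>z. norm z = 1 \<Longrightarrow> poly p z = poly q z"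
  shows "p = q"
proof (rule ccontr)
  assume "p \<noteq> q"
  then have "finite {z. poly (p - q) z = 0}" by (intro poly_roots_finite) simp
  moreover have "sphere (0::complex) 1 \<subseteq> {z. poly (p - q) z = 0}" using assms by auto
  ultimately have "finite (sphere (0::complex) 1)" by (rule rev_finite_subset)
  moreover have "{0..1} \<subseteq> Re ` sphere 0 1"
  proof
    fix t :: real assume "t \<in> {0..1}"
    then have "norm (Complex t (sqrt (1 - t\<^sup>2))) = 1"
      by (simp add: cmod_def power_le_one)
    then show "t \<in> Re ` sphere 0 1" by (intro image_eqI[of _ _ "Complex t (sqrt (1 - t\<^sup>2))"]) auto
  qed
  ultimately have "finite {0..1::real}" using finite_subset by blast
  then show False by (simp add: infinite_Icc)
qed

text \<open>With n = 2 j the right-hand quotient is j / (j + 1). The two signs of the square root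
  correspond to m and 1 / m, that is, to exchanging the two curvatures.\<close>

lemma even_slope:
  fixes m :: real and n :: nat
  assumes "even n" "n > 0" "m \<noteq> -1" "((1 - m) / (1 + m))\<^sup>2 = (real n / (real n + 2))\<^sup>2"
  shows "\<exists>j\<ge>1. m = 2 * real j + 1 \<or> m = 1 / (2 * real j + 1)"
proof -
  obtain j where j: "n = 2 * j" using assms(1) by blast
  have j1: "j \<ge> 1" using assms(2) j by simp
  have e: "real n / (real n + 2) = real j / (real j + 1)" using j by (simp add: divide_simps)
  have m: "1 + m \<noteq> 0" using assms(3) by auto
  from assms(4) have "(1 - m) / (1 + m) = real j / (real j + 1) \<or> (1 - m) / (1 + m) = - (real j / (real j + 1))"
    unfolding e by (simp only: power2_eq_iff)
  then show ?thesis
  proof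
    assume "(1 - m) / (1 + m) = real j / (real j + 1)"
    then have "(1 - m) * (real j + 1) = real j * (1 + m)" using m j1 by (simp add: field_simps)
    then have "m * (2 * real j + 1) = 1" by (simp add: algebra_simps)
    then have "m = 1 / (2 * real j + 1)" using j1 by (simp add: field_simps)
    then show ?thesis using j1 by blast
  next
    assume "(1 - m) / (1 + m) = - (real j / (real j + 1))"
    then have "(1 - m) * (real j + 1) = - real j * (1 + m)" using m j1 by (simp add: field_simps)
    then have "m = 2 * real j + 1" by (simp add: algebra_simps)
    then show ?thesis using j1 by blast
  qed
qed

lemma poly_monom_sum:
  fixes z :: complex
  shows "poly (\<Sum>i\<le>n. monom (c i) i) z = (\<Sum>i\<le>n. c i * z ^ i)"
  by (simp add: poly_sum poly_monom)

lemma coeff_monom_sum: "coeff (\<Sum>i\<le>n. monom (c i) i) k = (if k \<le> n then c k else 0)"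
  by (simp add: coeff_sum)

lemma degree_monom_sum: "degree (\<Sum>i\<le>n. monom (c i) i) \<le> n"
  by (rule degree_le) (simp add: coeff_sum)

text \<open>On the unit circle, multiplying a binary form of degree \<open>n\<close> in \<open>z\<close> and its conjugate by
  \<open>z ^ n\<close> turns it into a polynomial in \<open>z\<^sup>2\<close>.\<close>

lemma circle_form:
  fixes c :: "nat \<Rightarrow> complex"
  assumes "norm z = 1"
  shows "(\<Sum>i\<le>n. c i * (z\<^sup>2) ^ i) = z ^ n * (\<Sum>i\<le>n. c i * (z ^ i * cnj z ^ (n - i)))"
  unfolding sum_distrib_left
proof (rule sum.cong[OF refl])
  fix i assume "i \<in> {..n}"
  then have i: "i \<le> n" by simp
  have zz: "z * cnj z = 1" using complex_norm_square[of z] assms by simp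
  have "z ^ n * cnj z ^ (n - i) = z ^ i * (z * cnj z) ^ (n - i)"
    using i by (simp add: power_mult_distrib flip: power_add mult.assoc)
  then have "z ^ n * cnj z ^ (n - i) = z ^ i" by (simp add: zz)
  then have "z ^ n * (c i * (z ^ i * cnj z ^ (n - i))) = c i * (z ^ i * z ^ i)"
    by (metis mult.assoc mult.left_commute)
  moreover have "c i * (z\<^sup>2) ^ i = c i * (z ^ i * z ^ i)" by (simp add: power2_eq_square power_mult_distrib)
  ultimately show "c i * (z\<^sup>2) ^ i = z ^ n * (c i * (z ^ i * cnj z ^ (n - i)))" by (simp only:)
qed

text \<open>On the unit circle cnj w = 1 / w, so the product is the polynomial with reversed,
  conjugated coefficients.\<close>

lemma cnj_circle_form:
  fixes c :: "nat \<Rightarrow> complex"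
  assumes "norm w = 1"
  shows "w ^ n * cnj (\<Sum>i\<le>n. c i * w ^ i) = (\<Sum>i\<le>n. cnj (c (n - i)) * w ^ i)"
proof -
  have ww: "w * cnj w = 1" using complex_norm_square[of w] assms by simp
  have "w ^ n * cnj (\<Sum>i\<le>n. c i * w ^ i) = (\<Sum>i\<le>n. w ^ n * (cnj (c i) * cnj w ^ i))"
    by (simp add: sum_distrib_left)
  also have "\<dots> = (\<Sum>i\<le>n. cnj (c i) * w ^ (n - i))"
  proof (rule sum.cong[OF refl])
    fix i assume "i \<in> {..n}"
    then have "w ^ n * cnj w ^ i = w ^ (n - i) * (w * cnj w) ^ i"
      by (simp add: power_mult_distrib flip: power_add mult.assoc)
    then show "w ^ n * (cnj (c i) * cnj w ^ i) = cnj (c i) * w ^ (n - i)"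
      by (simp add: ww mult.left_commute)
  qed
  also have "\<dots> = (\<Sum>i\<le>n. cnj (c (n - i)) * w ^ i)"
    by (rule sum.reindex_bij_witness[of _ "\<lambda>i. n - i" "\<lambda>i. n - i"]) auto
  finally show ?thesis .
qed

text \<open>The curl condition \<open>Im (Dz G) = o(\<bar>DG\<bar>)\<close> says that the Jacobian is nearly symmetric; the
  trace is \<open>2 Re (Dz G)\<close> and the determinant \<open>\<bar>Dz G\<bar>\<^sup>2 - \<bar>Dw G\<bar>\<^sup>2\<close>, so the second condition says that the
  eigenvalues are nearly in ratio \<open>m\<close>.\<close>

lemma slope_of_gradient_like_map:
  fixes G :: "complex \<Rightarrow> complex" and m :: real
  assumes U: "open U" "0 \<in> U" and G: "smooth_open U G"
    and m: "m \<noteq> 0" "m \<noteq> -1"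
    and curl: "\<And>\<epsilon>. \<epsilon> > 0 \<Longrightarrow> \<forall>\<^sub>F z in nhds 0. \<bar>Im (Dz G z)\<bar> \<le> \<epsilon> * (norm (Dz G z) + norm (Dw G z))"
    and ratio: "\<And>\<epsilon>. \<epsilon> > 0 \<Longrightarrow> \<forall>\<^sub>F z in nhds 0.
      \<bar>(1 + m)\<^sup>2 * (norm (Dw G z))\<^sup>2 - (1 - m)\<^sup>2 * (norm (Dz G z))\<^sup>2\<bar> \<le> \<epsilon> * ((norm (Dz G z))\<^sup>2 + (norm (Dw G z))\<^sup>2)"
    and zero: "Dz G 0 = 0" "Dw G 0 = 0"
    and nonconst: "\<not> (\<forall>\<^sub>F z in nhds 0. Dz G z = 0 \<and> Dw G z = 0)"
  shows "\<exists>j\<ge>1. m = 2 * real j + 1 \<or> m = 1 / (2 * real j + 1)"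
proof -
  define f where "f z = G z - G 0" for z
  have f: "smooth_open U f"
    using smooth_open_add[OF U(1) G smooth_open_const[of U "- G 0"]] by (simp add: f_def[abs_def])
  have D: "Dz f z = Dz G z" "Dw f z = Dw G z" if "z \<in> U" for z
  proof -
    have "(f has_derivative (\<lambda>v. v * Dz G z + cnj v * Dw G z)) (at z)"
      unfolding f_def[abs_def] using has_derivative_Dz_Dw[OF G that] by (auto intro!: derivative_eq_intros)
    from Dz_Dw_unique[OF this] show "Dz f z = Dz G z" "Dw f z = Dw G z" by auto
  qed
  have inU: "\<forall>\<^sub>F z in nhds 0. z \<in> U" using U by (intro eventually_nhds_in_open)
  define h where "h = Dz f"
  define q where "q = Dw f"
  have smh: "smooth_open U h" and smq: "smooth_open U q"
    unfolding h_def q_def using smooth_Dz[OF U(1) f] smooth_Dw[OF U(1) f] by auto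
  have curl: "\<forall>\<^sub>F z in nhds 0. \<bar>Im (h z)\<bar> \<le> \<epsilon> * (norm (h z) + norm (q z))" if "\<epsilon> > 0" for \<epsilon>
    using curl[OF that] inU by eventually_elim (simp add: h_def q_def D)
  have ratio: "\<forall>\<^sub>F z in nhds 0. \<bar>(1 + m)\<^sup>2 * (norm (q z))\<^sup>2 - (1 - m)\<^sup>2 * (norm (h z))\<^sup>2\<bar> \<le> \<epsilon> * ((norm (h z))\<^sup>2 + (norm (q z))\<^sup>2)"
    if "\<epsilon> > 0" for \<epsilon>
    using ratio[OF that] inU by eventually_elim (simp add: h_def q_def D)
  have zero: "f 0 = 0" "h 0 = 0" "q 0 = 0" using zero D U by (auto simp: f_def h_def q_def)
  have nonzero: "\<not> (\<forall>\<^sub>F z in nhds 0. f z = 0)"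
  proof
    assume "\<forall>\<^sub>F z in nhds 0. f z = 0"
    then obtain V where V: "open V" "0 \<in> V" "\<And>z. z \<in> V \<Longrightarrow> f z = 0" unfolding eventually_nhds by blast
    have "Dz G z = 0 \<and> Dw G z = 0" if "z \<in> V \<inter> U" for z
    proof -
      have "((\<lambda>_. 0) has_derivative (\<lambda>v. v * 0 + cnj v * 0 :: complex)) (at z)" by simp
      then have "(f has_derivative (\<lambda>v. v * 0 + cnj v * 0)) (at z)"
        by (rule has_derivative_transform_within_open[of _ _ _ _ V]) (use V that in auto)
      from Dz_Dw_unique[OF this] show ?thesis using D that by auto
    qed
    then have "\<forall>\<^sub>F z in nhds 0. Dz G z = 0 \<and> Dw G z = 0"
      unfolding eventually_nhds using U V by (intro exI[of _ "V \<inter> U"]) auto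
    then show False using nonconst by simp
  qed
  \<comment> \<open>Unique continuation enters here: if all derivatives vanished at 0, then f would
    be flat and hence locally zero.\<close>
  have notflat: "\<exists>N. \<exists>i j. i + j = N \<and> DD i j f 0 \<noteq> 0"
  proof (rule ccontr)
    assume "\<not> ?thesis"
    then have all0: "DD i j f 0 = 0" for i j by blast
    have flat: "\<forall>\<^sub>F z in nhds 0. norm (f z) \<le> norm z ^ n" for n
    proof -
      have "taylor_form n f z = 0" for z by (simp add: taylor_form_def all0)
      then show ?thesis using taylor_leading[where \<epsilon>=1 and n=n, OF U(1) f U(2) all0] by simp
    qed
    have sq: "(1 + m)\<^sup>2 = (1 - m)\<^sup>2 + 4 * m" by (simp add: power2_eq_square algebra_simps)
    have "\<forall>\<^sub>F z in nhds 0. f z = 0"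
    proof (cases "m > 0")
      case True
      \<comment> \<open>Taking \<epsilon> = m in \<open>ratio\<close>, together with (1 + m)^2 - (1
        - m)^2 = 4 m, leaves exactly this distortion bound.\<close>
      define K where "K = ((1 + m)\<^sup>2 + (1 - m)\<^sup>2) / (2 * m)"
      have "\<forall>\<^sub>F z in nhds 0. (norm (Dz f z))\<^sup>2 + (norm (Dw f z))\<^sup>2 \<le> K * ((norm (Dz f z))\<^sup>2 - (norm (Dw f z))\<^sup>2)"
        using ratio[OF True]
      proof eventually_elim
        case (elim z)
        define a where "a = (norm (h z))\<^sup>2"
        define b where "b = (norm (q z))\<^sup>2"
        have ab: "a \<ge> 0" "b \<ge> 0" by (auto simp: a_def b_def)
        have "(1 + m)\<^sup>2 * b - (1 - m)\<^sup>2 * a \<le> m * (a + b)" using elim unfolding a_def b_def by linarith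
        then have "2 * m * (a + b) \<le> ((1 + m)\<^sup>2 + (1 - m)\<^sup>2) * (a - b)"
          unfolding sq by (simp add: algebra_simps)
        then have "a + b \<le> K * (a - b)" using True by (simp add: K_def field_simps)
        then show ?case by (simp add: a_def b_def h_def q_def)
      qed
      moreover have "K > 0" unfolding K_def using True by (intro divide_pos_pos add_pos_nonneg) auto
      ultimately show ?thesis using flat_quasiregular_vanishes[OF U f flat] by blast
    next
      case False
      with m have mneg: "m < 0" by simp
      \<comment> \<open>For m < 0 the Jacobian determinant is at most 0 near the origin; conjugation
        reverses orientation and exchanges the moduli of h and q.\<close>
      define g where "g z = cnj (f z)" for z
      have g: "smooth_open U g" unfolding g_def[abs_def] by (rule smooth_open_linear[OF U(1) bounded_linear_cnj f])
      have Dg: "Dz g z = cnj (q z)" "Dw g z = cnj (h z)" if "z \<in> U" for z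
      proof -
        have "(g has_derivative (\<lambda>v. cnj (v * h z + cnj v * q z))) (at z)"
          unfolding g_def[abs_def] h_def q_def
          by (rule bounded_linear.has_derivative[OF bounded_linear_cnj has_derivative_Dz_Dw[OF f that]])
        then have "(g has_derivative (\<lambda>v. v * cnj (q z) + cnj v * cnj (h z))) (at z)"
          by (simp add: add.commute)
        from Dz_Dw_unique[OF this] show "Dz g z = cnj (q z)" "Dw g z = cnj (h z)" by auto
      qed
      define K where "K = ((1 + m)\<^sup>2 + (1 - m)\<^sup>2) / (2 * (- m))"
      have "- m > 0" using mneg by simp
      have "\<forall>\<^sub>F z in nhds 0. (norm (Dz g z))\<^sup>2 + (norm (Dw g z))\<^sup>2 \<le> K * ((norm (Dz g z))\<^sup>2 - (norm (Dw g z))\<^sup>2)"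
        using ratio[OF \<open>- m > 0\<close>] inU
      proof eventually_elim
        case (elim z)
        define a where "a = (norm (h z))\<^sup>2"
        define b where "b = (norm (q z))\<^sup>2"
        have ab: "a \<ge> 0" "b \<ge> 0" by (auto simp: a_def b_def)
        have "(1 - m)\<^sup>2 * a - (1 + m)\<^sup>2 * b \<le> - m * (a + b)" using elim unfolding a_def b_def by linarith
        then have "2 * (- m) * (a + b) \<le> ((1 + m)\<^sup>2 + (1 - m)\<^sup>2) * (b - a)"
          unfolding sq by (simp add: algebra_simps)
        then have "b + a \<le> K * (b - a)" using mneg by (simp add: K_def field_simps)
        then show ?case using elim by (simp add: a_def b_def Dg)
      qed
      moreover have "K > 0" unfolding K_def using mneg by (intro divide_pos_pos add_nonneg_pos) auto
      moreover have "\<forall>\<^sub>F z in nhds 0. norm (g z) \<le> norm z ^ n" for n using flat by (simp add: g_def)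
      ultimately have "\<forall>\<^sub>F z in nhds 0. g z = 0" using flat_quasiregular_vanishes[OF U g] by blast
      then show ?thesis by (simp add: g_def)
    qed
    then show False using nonzero by simp
  qed
  define N where "N = (LEAST N. \<exists>i j. i + j = N \<and> DD i j f 0 \<noteq> 0)"
  obtain i0 j0 where ij: "i0 + j0 = N" "DD i0 j0 f 0 \<noteq> 0"
    using LeastI_ex[OF notflat] unfolding N_def by blast
  have below: "DD i j f 0 = 0" if "i + j < N" for i j
    using not_less_Least[of "i + j" "\<lambda>N. \<exists>i j. i + j = N \<and> DD i j f 0 \<noteq> 0"] that unfolding N_def by blast
  have "N \<noteq> 0" "N \<noteq> 1"
  proof -
    show "N \<noteq> 0"
    proof
      assume "N = 0"
      then have "i0 = 0" "j0 = 0" using ij by auto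
      then show False using ij zero by (simp add: DD_def)
    qed
    show "N \<noteq> 1"
    proof
      assume "N = 1"
      then have "i0 = 1 \<and> j0 = 0 \<or> i0 = 0 \<and> j0 = 1" using ij by auto
      then show False using ij zero by (auto simp: DD_def h_def q_def)
    qed
  qed
  then obtain n where n: "N = Suc n" "n > 0" by (cases N) auto
  \<comment> \<open>If f is to leading order 2 F_w for a real form F of degree n + 2, then hn and qn
    are 2 F_zw and 2 F_ww. F itself is not built: what is needed of it is encoded in the reality of
    hn and the relation \<open>codazzi\<close>.\<close>
  define hn where "hn = taylor_form n h"
  define qn where "qn = taylor_form n q"
  have limh: "((\<lambda>t. h (of_real t * u) / of_real t ^ n) \<longlongrightarrow> hn u) (at_right 0)" if "norm u = 1" for u
    unfolding hn_def using n below DD_Dz[OF U(1) f U(2)]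
    by (intro taylor_form_limit[OF U(1) smh U(2) _ that]) (auto simp: h_def)
  have limq: "((\<lambda>t. q (of_real t * u) / of_real t ^ n) \<longlongrightarrow> qn u) (at_right 0)" if "norm u = 1" for u
    unfolding qn_def using n below
    by (intro taylor_form_limit[OF U(1) smq U(2) _ that]) (auto simp: q_def DD_Dw)
  have at0: "filterlim (\<lambda>t. of_real t * u :: complex) (nhds 0) (at_right 0)" for u
    by (auto intro!: tendsto_eq_intros)
  have pos: "\<forall>\<^sub>F t in at_right 0. (t::real) > 0" by (simp add: eventually_at_right_less)
  have Im0: "Im (hn u) = 0" if u: "norm u = 1" for u
  proof (rule limit_eq_0_if_small[OF tendsto_Im[OF limh[OF u]] tendsto_add[OF tendsto_norm[OF limh[OF u]] tendsto_norm[OF limq[OF u]]]])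
    fix \<epsilon> :: real assume "\<epsilon> > 0"
    then have "\<forall>\<^sub>F t in at_right 0. \<bar>Im (h (of_real t * u))\<bar> \<le> \<epsilon> * (norm (h (of_real t * u)) + norm (q (of_real t * u)))"
      using curl at0 by (auto simp: filterlim_iff)
    then show "\<forall>\<^sub>F t in at_right 0. \<bar>Im (h (of_real t * u) / of_real t ^ n)\<bar>
        \<le> \<epsilon> * (norm (h (of_real t * u) / of_real t ^ n) + norm (q (of_real t * u) / of_real t ^ n))"
      using pos
    proof eventually_elim
      case (elim t)
      have "\<bar>Im (h (of_real t * u) / of_real t ^ n)\<bar> = \<bar>Im (h (of_real t * u))\<bar> / t ^ n"
        using elim by (simp add: Im_divide_of_real abs_divide flip: of_real_power)
      also have "\<dots> \<le> \<epsilon> * (norm (h (of_real t * u)) + norm (q (of_real t * u))) / t ^ n"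
        using elim by (intro divide_right_mono) auto
      finally show ?case using elim by (simp add: norm_divide norm_power add_divide_distrib distrib_left)
    qed
  qed simp
  have ratio0: "(1 + m)\<^sup>2 * (norm (qn u))\<^sup>2 - (1 - m)\<^sup>2 * (norm (hn u))\<^sup>2 = 0" if u: "norm u = 1" for u
  proof (rule limit_eq_0_if_small)
    let ?h = "\<lambda>t. norm (h (of_real t * u) / of_real t ^ n)" and ?q = "\<lambda>t. norm (q (of_real t * u) / of_real t ^ n)"
    show "((\<lambda>t. (1 + m)\<^sup>2 * (?q t)\<^sup>2 - (1 - m)\<^sup>2 * (?h t)\<^sup>2)
        \<longlongrightarrow> (1 + m)\<^sup>2 * (norm (qn u))\<^sup>2 - (1 - m)\<^sup>2 * (norm (hn u))\<^sup>2) (at_right 0)"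
      and "((\<lambda>t. (?h t)\<^sup>2 + (?q t)\<^sup>2) \<longlongrightarrow> (norm (hn u))\<^sup>2 + (norm (qn u))\<^sup>2) (at_right 0)"
      by (intro tendsto_intros limh limq u)+
    fix \<epsilon> :: real assume "\<epsilon> > 0"
    then have "\<forall>\<^sub>F t in at_right 0. \<bar>(1 + m)\<^sup>2 * (norm (q (of_real t * u)))\<^sup>2 - (1 - m)\<^sup>2 * (norm (h (of_real t * u)))\<^sup>2\<bar>
        \<le> \<epsilon> * ((norm (h (of_real t * u)))\<^sup>2 + (norm (q (of_real t * u)))\<^sup>2)"
      using ratio at0 by (auto simp: filterlim_iff)
    then show "\<forall>\<^sub>F t in at_right 0. \<bar>(1 + m)\<^sup>2 * (?q t)\<^sup>2 - (1 - m)\<^sup>2 * (?h t)\<^sup>2\<bar> \<le> \<epsilon> * ((?h t)\<^sup>2 + (?q t)\<^sup>2)"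
      using pos
    proof eventually_elim
      case (elim t)
      define c where "c = (t ^ n)\<^sup>2"
      have c: "c > 0" using elim by (simp add: c_def)
      have e: "(?h t)\<^sup>2 = (norm (h (of_real t * u)))\<^sup>2 / c" "(?q t)\<^sup>2 = (norm (q (of_real t * u)))\<^sup>2 / c"
        using elim by (simp_all add: norm_divide norm_power power_divide c_def)
      have "\<bar>(1 + m)\<^sup>2 * (?q t)\<^sup>2 - (1 - m)\<^sup>2 * (?h t)\<^sup>2\<bar>
          = \<bar>(1 + m)\<^sup>2 * (norm (q (of_real t * u)))\<^sup>2 - (1 - m)\<^sup>2 * (norm (h (of_real t * u)))\<^sup>2\<bar> / c"
        unfolding e using c by (simp add: abs_divide flip: diff_divide_distrib)
      also have "\<dots> \<le> \<epsilon> * ((norm (h (of_real t * u)))\<^sup>2 + (norm (q (of_real t * u)))\<^sup>2) / c"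
        using elim c by (intro divide_right_mono) auto
      also have "\<dots> = \<epsilon> * ((?h t)\<^sup>2 + (?q t)\<^sup>2)"
        unfolding e by (simp only: add_divide_distrib[symmetric] times_divide_eq_right)
      finally show ?case .
    qed
  qed simp
  define ch where "ch i = DD (Suc i) (n - i) f 0 / (fact i * fact (n - i))" for i
  define cq where "cq i = DD i (Suc (n - i)) f 0 / (fact i * fact (n - i))" for i
  define H where "H = (\<Sum>i\<le>n. monom (ch i) i)"
  define Q where "Q = (\<Sum>i\<le>n. monom (cq i) i)"
  \<comment> \<open>Stands for 2 F_zz, the conjugate of 2 F_ww for a real form F, so its
    coefficients are those of Q reversed and conjugated.\<close>
  define P where "P = (\<Sum>i\<le>n. monom (cnj (cq (n - i))) i)"
  define k where "k = ((1 - m) / (1 + m))\<^sup>2"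
  have hn: "hn u = (\<Sum>i\<le>n. ch i * (u ^ i * cnj u ^ (n - i)))" for u
    unfolding hn_def taylor_form_def ch_def h_def DD_Dz[OF U(1) f U(2)] ..
  have qn: "qn u = (\<Sum>i\<le>n. cq i * (u ^ i * cnj u ^ (n - i)))" for u
    unfolding qn_def taylor_form_def cq_def q_def DD_Dw ..
  have circle: "poly H w = w ^ n * cnj (poly H w) \<and> poly P w * poly Q w = of_real k * (poly H w)\<^sup>2" if w: "norm w = 1" for w
  proof -
    \<comment> \<open>A square root of w is taken because \<open>circle_form\<close> produces
      polynomials in the square of the circle variable.\<close>
    define u where "u = csqrt w"
    have u: "u\<^sup>2 = w" "norm u = 1" using w by (simp_all add: u_def norm_csqrt)
    have uu: "u * cnj u = 1" using complex_norm_square[of u] u by simp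
    have H: "poly H w = u ^ n * hn u"
      unfolding H_def poly_monom_sum hn using circle_form[OF u(2), of ch n] u by simp
    have Q: "poly Q w = u ^ n * qn u"
      unfolding Q_def poly_monom_sum qn using circle_form[OF u(2), of cq n] u by simp
    have P: "poly P w = w ^ n * cnj (poly Q w)"
      unfolding P_def Q_def poly_monom_sum using cnj_circle_form[OF w, of n cq] by simp
    have wn: "w ^ n = u ^ n * u ^ n" unfolding u(1)[symmetric] by (simp add: power2_eq_square power_mult_distrib)
    have un: "u ^ n * cnj u ^ n = 1" by (simp add: uu flip: power_mult_distrib)
    have real: "cnj (hn u) = hn u" using Im0[OF u(2)] by (simp add: complex_eq_iff)
    have 1: "poly H w = w ^ n * cnj (poly H w)"
    proof -
      have "w ^ n * cnj (poly H w) = (u ^ n * cnj u ^ n) * (u ^ n * cnj (hn u))" unfolding H wn by (simp add: ac_simps)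
      then show ?thesis unfolding un real H by simp
    qed
    have m1: "1 + m \<noteq> 0" using m by auto
    have "(norm (qn u))\<^sup>2 = k * (norm (hn u))\<^sup>2"
      using ratio0[OF u(2)] m1 by (simp add: k_def power_divide field_simps)
    then have "qn u * cnj (qn u) = of_real k * (hn u * cnj (hn u))"
      unfolding complex_norm_square[symmetric] by (metis of_real_mult of_real_power)
    then have qh: "qn u * cnj (qn u) = of_real k * (hn u * hn u)" unfolding real .
    have "poly P w * poly Q w = (u ^ n * cnj u ^ n) * (u ^ n * u ^ n) * (qn u * cnj (qn u))"
      unfolding P Q wn by (simp add: ac_simps)
    also have "\<dots> = of_real k * (poly H w)\<^sup>2" unfolding un qh H by (simp add: power2_eq_square ac_simps)
    finally show ?thesis using 1 by simp
  qed
  have "(\<Sum>i\<le>n. monom (ch i) i) = (\<Sum>i\<le>n. monom (cnj (ch (n - i))) i)"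
  proof (rule poly_eq_on_circle)
    fix w :: complex assume "norm w = 1"
    then show "poly (\<Sum>i\<le>n. monom (ch i) i) w = poly (\<Sum>i\<le>n. monom (cnj (ch (n - i))) i) w"
      using conjunct1[OF circle] cnj_circle_form[of w n ch] unfolding H_def poly_monom_sum by (metis (no_types))
  qed
  then have "coeff (\<Sum>i\<le>n. monom (ch i) i) i = coeff (\<Sum>i\<le>n. monom (cnj (ch (n - i))) i) i" for i by simp
  then have chrefl: "ch i = cnj (ch (n - i))" if "i \<le> n" for i using that unfolding coeff_monom_sum by metis
  have PQ: "P * Q = [:of_real k:] * H\<^sup>2"
    by (rule poly_eq_on_circle) (use circle in simp)
  \<comment> \<open>Both sides contain the same derivative \<open>DD (Suc i) (n - i) f 0\<close>,
    reached through \<open>Dw f\<close> on the left and through \<open>Dz f\<close> on the right;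
    the factors adjust the factorials.\<close>
  have codazzi: "of_nat (Suc i) * cq (Suc i) = of_nat (n - i) * ch i" if "i < n" for i
  proof -
    obtain d where d: "n = Suc (i + d)" using less_imp_Suc_add[OF \<open>i < n\<close>] by blast
    show ?thesis unfolding cq_def ch_def d by (simp add: divide_simps del: of_nat_Suc)
  qed
  have mX: "coeff ([:0,1:] * pderiv R) i = of_nat i * coeff R i" for R :: "complex poly" and i
    by (cases i) (auto simp: coeff_pderiv)
  have dQ: "pderiv Q = [:of_nat n:] * H - [:0,1:] * pderiv H"
  proof (rule poly_eqI)
    fix i
    have c: "coeff ([:of_nat n:] * H - [:0,1:] * pderiv H) i = (of_nat n - of_nat i) * coeff H i"
      unfolding coeff_diff mX by (simp add: algebra_simps)
    consider "i < n" | "i = n" | "i > n" by linarith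
    then show "coeff (pderiv Q) i = coeff ([:of_nat n:] * H - [:0,1:] * pderiv H) i"
      unfolding c unfolding coeff_pderiv Q_def H_def coeff_monom_sum
      by cases (use codazzi[of i] in \<open>auto simp del: of_nat_Suc\<close>)
  qed
  have dH: "pderiv H = [:of_nat n:] * P - [:0,1:] * pderiv P"
  proof (rule poly_eqI)
    fix i
    have c: "coeff ([:of_nat n:] * P - [:0,1:] * pderiv P) i = (of_nat n - of_nat i) * coeff P i"
      unfolding coeff_diff mX by (simp add: algebra_simps)
    \<comment> \<open>The relation \<open>codazzi\<close> at the mirrored index n - i - 1,
      conjugated and combined with the symmetry \<open>chrefl\<close>.\<close>
    have s: "of_nat (Suc i) * ch (Suc i) = of_nat (n - i) * cnj (cq (n - i))" if "i < n"
    proof -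
      have 1: "Suc (n - Suc i) = n - i" "n - (n - Suc i) = Suc i" using that by auto
      have "of_nat (n - i) * cq (n - i) = of_nat (Suc i) * ch (n - Suc i)"
        using codazzi[of "n - Suc i"] that unfolding 1 by simp
      then have "cnj (of_nat (n - i) * cq (n - i)) = cnj (of_nat (Suc i) * ch (n - Suc i))" by simp
      then show ?thesis using chrefl[of "Suc i"] that by (simp del: of_nat_Suc of_nat_diff)
    qed
    consider "i < n" | "i = n" | "i > n" by linarith
    then show "coeff (pderiv H) i = coeff ([:of_nat n:] * P - [:0,1:] * pderiv P) i"
      unfolding c unfolding coeff_pderiv P_def H_def coeff_monom_sum
      by cases (use s in \<open>auto simp del: of_nat_Suc\<close>)
  qed
  \<comment> \<open>The nonvanishing derivative \<open>DD i0 j0 f 0\<close> is, up to factorials, a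
    coefficient of Q if i0 = 0 and of H otherwise.\<close>
  have HQ: "H \<noteq> 0 \<or> Q \<noteq> 0"
  proof (cases i0)
    case 0
    then have "cq 0 \<noteq> 0" using ij n by (simp add: cq_def)
    then have "coeff Q 0 \<noteq> 0" unfolding Q_def coeff_monom_sum by simp
    then show ?thesis by auto
  next
    case (Suc i)
    then have "n - i = j0" "i \<le> n" using ij n by auto
    then have "coeff H i \<noteq> 0" unfolding H_def coeff_monom_sum using ij Suc by (simp add: ch_def)
    then show ?thesis by auto
  qed
  have m1: "1 + m \<noteq> 0" using m by auto
  have k1: "complex_of_real k \<noteq> 1"
  proof
    assume "complex_of_real k = 1"
    then have "k = 1" by simp
    then have "(1 - m)\<^sup>2 = (1 + m)\<^sup>2" using m1 by (simp add: k_def power_divide)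
    then show False using m by (simp add: power2_eq_square algebra_simps)
  qed
  have "even n \<and> complex_of_real k = (of_nat n / (of_nat n + 2))\<^sup>2"
  proof (rule leading_form_exponent[OF n(2) _ _ _ dQ dH PQ k1 _ _ HQ])
    show "degree H \<le> n" "degree P \<le> n" "degree Q \<le> n"
      unfolding H_def P_def Q_def by (rule degree_monom_sum)+
    fix i assume i: "i \<le> n"
    show "coeff Q (n - i) = cnj (coeff P i)" unfolding Q_def P_def coeff_monom_sum using i by simp
    show "coeff H (n - i) = cnj (coeff H i)" unfolding H_def coeff_monom_sum using i chrefl[of "n - i"] by simp
  qed
  then have "even n" "complex_of_real k = of_real ((real n / (real n + 2))\<^sup>2)" by auto
  then have "k = (real n / (real n + 2))\<^sup>2" by (simp only: of_real_eq_iff)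
  with even_slope[OF \<open>even n\<close> n(2) m(2)] show ?thesis by (simp add: k_def)
qed

section \<open>Reduction of a surface to a plane map\<close>

text \<open>Both maps take values in the plane orthogonal to n, and by dimension the injective
  \<open>DF\<close> fills it. So -DN u has a unique preimage, and the description by
  \<open>THE\<close> denotes the actual shape operator.\<close>

lemma shape_operator_spec:
  fixes DF DN :: "real^2 \<Rightarrow> real^3"
  assumes "linear DF" "linear DN" "inj DF" "norm n = 1"
    and F: "\<And>u. n \<bullet> DF u = 0" and N: "\<And>u. n \<bullet> DN u = 0"
  shows "DF ((THE A. \<forall>u. DF (A *v u) = - DN u) *v u) = - DN u"
proof -
  have sub: "range DF \<subseteq> {y. n \<bullet> y = 0}" using F by auto
  have "dim (range DF) = dim (UNIV :: (real^2) set)"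
    using dim_image_eq[OF assms(1), of UNIV] assms(3) by simp
  moreover have "n \<noteq> 0" using assms(4) by auto
  then have "dim {y. n \<bullet> y = 0} = 2" using dim_hyperplane[of n] by simp
  ultimately have rng: "range DF = {y. n \<bullet> y = 0}"
    using sub assms(1) by (intro subspace_dim_equal linear_subspace_image subspace_UNIV subspace_hyperplane) auto
  obtain g where g: "linear g" "g \<circ> DF = id"
    using linear_injective_left_inverse[OF assms(1,3)] by blast
  have lin: "linear (\<lambda>u. g (- DN u))"
    by (rule linearI) (simp_all add: linear_add[OF assms(2)] linear_cmul[OF assms(2)] linear_diff[OF g(1)]
        linear_neg[OF g(1)] linear_cmul[OF g(1)] linear_add[OF g(1)])
  define B where "B = matrix (\<lambda>u. g (- DN u))"
  have "DF (B *v u) = - DN u" for u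
  proof -
    have "- DN u \<in> range DF" unfolding rng using N by simp
    then obtain y where "- DN u = DF y" by blast
    moreover have "g (DF y) = y" for y using g(2) by (metis comp_apply id_apply)
    ultimately show ?thesis unfolding B_def using fun_cong[OF matrix_vector_mul(2)[OF lin]] by simp
  qed
  then have "\<exists>!A. \<forall>u. DF (A *v u) = - DN u"
  proof (intro ex1I[of _ B] allI)
    fix A assume "\<forall>u. DF (A *v u) = - DN u"
    then have "DF (A *v u) = DF (B *v u)" for u using \<open>\<And>u. DF (B *v u) = - DN u\<close> by simp
    then have "A *v u = B *v u" for u using assms(3) by (meson injD)
    then show "A = B" by (simp add: matrix_eq)
  qed
  from theI'[OF this] show ?thesis by blast
qed

lemma eigenvalues_trace_det:
  assumes "eigenvalues_with_mult A k1 k2"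
  shows "A $ 1 $ 1 + A $ 2 $ 2 = k1 + k2" "A $ 1 $ 1 * A $ 2 $ 2 - A $ 1 $ 2 * A $ 2 $ 1 = k1 * k2"
proof -
  have e: "(x - A $ 1 $ 1) * (x - A $ 2 $ 2) - A $ 1 $ 2 * A $ 2 $ 1 = (x - k1) * (x - k2)" for x
    using assms unfolding eigenvalues_with_mult_def det_2 by (auto simp: mat_def)
  show d: "A $ 1 $ 1 * A $ 2 $ 2 - A $ 1 $ 2 * A $ 2 $ 1 = k1 * k2" using e[of 0] by simp
  show "A $ 1 $ 1 + A $ 2 $ 2 = k1 + k2" using e[of 1] d by (simp add: algebra_simps)
qed

lemma trace_det_in_basis:
  fixes A :: "real^2^2" and e1 e2 :: "real^2"
  assumes A: "A *v e1 = a *\<^sub>R e1 + b *\<^sub>R e2" "A *v e2 = c *\<^sub>R e1 + d *\<^sub>R e2"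
    and ind: "e1 $ 1 * e2 $ 2 - e1 $ 2 * e2 $ 1 \<noteq> 0"
  shows "a + d = A $ 1 $ 1 + A $ 2 $ 2" "a * d - b * c = A $ 1 $ 1 * A $ 2 $ 2 - A $ 1 $ 2 * A $ 2 $ 1"
proof -
  have 1: "A $ i $ 1 * e1 $ 1 + A $ i $ 2 * e1 $ 2 = a * e1 $ i + b * e2 $ i" for i
    using arg_cong[OF A(1), of "\<lambda>x. x $ i"] by (simp add: matrix_vector_mult_def sum_2)
  have 2: "A $ i $ 1 * e2 $ 1 + A $ i $ 2 * e2 $ 2 = c * e1 $ i + d * e2 $ i" for i
    using arg_cong[OF A(2), of "\<lambda>x. x $ i"] by (simp add: matrix_vector_mult_def sum_2)
  define p q r s where "p = A $ 1 $ 1" and "q = A $ 1 $ 2" and "r = A $ 2 $ 1" and "s = A $ 2 $ 2"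
  define x y z w where "x = e1 $ 1" and "y = e1 $ 2" and "z = e2 $ 1" and "w = e2 $ 2"
  note defs = p_def q_def r_def s_def x_def y_def z_def w_def
  have eqs: "p * x + q * y = a * x + b * z" "r * x + s * y = a * y + b * w"
      "p * z + q * w = c * x + d * z" "r * z + s * w = c * y + d * w"
    using 1[of 1] 1[of 2] 2[of 1] 2[of 2] by (simp_all add: defs)
  have nz: "x * w - y * z \<noteq> 0" using ind by (simp add: defs)
  have "(a + d) * (x * w - y * z) = (p + s) * (x * w - y * z)" using eqs by algebra
  then show "a + d = A $ 1 $ 1 + A $ 2 $ 2" using nz by (simp add: defs)
  have "(a * d - b * c) * (x * w - y * z) = (p * s - q * r) * (x * w - y * z)" using eqs by algebra
  then show "a * d - b * c = A $ 1 $ 1 * A $ 2 $ 2 - A $ 1 $ 2 * A $ 2 $ 1" using nz by (simp add: defs)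
qed

text \<open>Gram-Schmidt on the coordinate vectors in the metric pulled back by D. Independence is
  read off from e1 being a multiple of the first axis and u having second coordinate 1.\<close>

lemma orthonormal_frame:
  fixes D :: "real^2 \<Rightarrow> real^3"
  assumes D: "linear D" "inj D"
  obtains e1 e2 where "norm (D e1) = 1" "norm (D e2) = 1" "D e1 \<bullet> D e2 = 0"
    "e1 $ 1 * e2 $ 2 - e1 $ 2 * e2 $ 1 \<noteq> 0"
proof -
  have D0: "D x = 0 \<longleftrightarrow> x = 0" for x using D by (metis injD linear_0)
  define b1 b2 :: "real^2" where "b1 = axis 1 1" and "b2 = axis 2 1"
  have b: "b1 $ 1 = 1" "b1 $ 2 = 0" "b2 $ 1 = 0" "b2 $ 2 = 1" by (simp_all add: b1_def b2_def axis_def)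
  define e1 where "e1 = (1 / norm (D b1)) *\<^sub>R b1"
  have "b1 \<noteq> 0" using b by auto
  then have n1: "norm (D b1) > 0" using D0 by simp
  have e1: "norm (D e1) = 1" using n1 by (simp add: e1_def linear_cmul[OF D(1)])
  define u where "u = b2 - (D b2 \<bullet> D e1) *\<^sub>R e1"
  have u2: "u $ 2 = 1" using b by (simp add: u_def e1_def)
  then have "u \<noteq> 0" by auto
  then have nu: "norm (D u) > 0" using D0 by simp
  have "D u \<bullet> D e1 = 0"
    using e1 by (simp add: u_def linear_diff[OF D(1)] linear_cmul[OF D(1)] inner_diff_left dot_square_norm)
  define e2 where "e2 = (1 / norm (D u)) *\<^sub>R u"
  have "norm (D e2) = 1" using nu by (simp add: e2_def linear_cmul[OF D(1)])
  moreover have "D e1 \<bullet> D e2 = 0"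
    using \<open>D u \<bullet> D e1 = 0\<close> by (simp add: e2_def linear_cmul[OF D(1)] inner_commute)
  moreover have "e1 $ 1 * e2 $ 2 - e1 $ 2 * e2 $ 1 \<noteq> 0"
    using u2 b n1 nu by (simp add: e1_def e2_def)
  ultimately show ?thesis using that e1 by blast
qed

text \<open>Here a, b, c, d will be the entries of A - tI in the frame and p1, ..., p4 those of the
  Jacobian of G. If p = -(a, b, c, d) and b = c, then (1 + m)^2 |q|^2 - (1 - m)^2 |h|^2 = m tr^2 -
  (1 + m)^2 det, so only errors of relative size \<eta> have to be tracked.\<close>

lemma perturbed_jacobian:
  fixes p1 p2 p3 p4 a b c d \<eta> m :: real
  defines "T \<equiv> \<bar>a\<bar> + \<bar>b\<bar> + \<bar>c\<bar> + \<bar>d\<bar>"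
    and "h \<equiv> Complex ((p1 + p4) / 2) ((p2 - p3) / 2)" and "q \<equiv> Complex ((p1 - p4) / 2) ((p2 + p3) / 2)"
  assumes \<eta>: "0 < \<eta>" "\<eta> \<le> 1 / 8"
    and p: "\<bar>p1 + a\<bar> \<le> \<eta> * T" "\<bar>p2 + b\<bar> \<le> \<eta> * T" "\<bar>p3 + c\<bar> \<le> \<eta> * T" "\<bar>p4 + d\<bar> \<le> \<eta> * T"
    and bc: "\<bar>b - c\<bar> \<le> \<eta> * T"
    and r: "\<bar>m * (a + d)\<^sup>2 - (1 + m)\<^sup>2 * (a * d - b * c)\<bar> \<le> \<eta> * T\<^sup>2"
  shows "T \<le> 8 * (norm h + norm q)" "\<bar>Im h\<bar> \<le> 12 * \<eta> * (norm h + norm q)"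
    "\<bar>(1 + m)\<^sup>2 * (norm q)\<^sup>2 - (1 - m)\<^sup>2 * (norm h)\<^sup>2\<bar> \<le>
      128 * (13 * (1 + m)\<^sup>2 + 8 * (1 - m)\<^sup>2 + 4) * \<eta> * ((norm h)\<^sup>2 + (norm q)\<^sup>2)"
proof -
  have T0: "T \<ge> 0" by (simp add: T_def)
  have \<eta>T: "8 * (\<eta> * T) \<le> T" using mult_right_mono[OF \<eta>(2) T0] by simp
  have "\<bar>p1\<bar> \<le> norm h + norm q" "\<bar>p4\<bar> \<le> norm h + norm q" "\<bar>p2\<bar> \<le> norm h + norm q" "\<bar>p3\<bar> \<le> norm h + norm q"
    using abs_Re_le_cmod[of h] abs_Re_le_cmod[of q] abs_Im_le_cmod[of h] abs_Im_le_cmod[of q]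
    unfolding h_def q_def by auto
  moreover have "\<bar>a\<bar> \<le> \<bar>p1\<bar> + \<eta> * T" "\<bar>b\<bar> \<le> \<bar>p2\<bar> + \<eta> * T" "\<bar>c\<bar> \<le> \<bar>p3\<bar> + \<eta> * T" "\<bar>d\<bar> \<le> \<bar>p4\<bar> + \<eta> * T"
    using p by linarith+
  \<comment> \<open>Each entry is at most |h| + |q| + \<eta> T, and \<eta> \<le> 1/8 lets the sum of
    the four errors be absorbed as T / 2.\<close>
  moreover have "A + B + C + D \<le> 8 * S" if "P1 \<le> S" "P4 \<le> S" "P2 \<le> S" "P3 \<le> S"
    "A \<le> P1 + E" "B \<le> P2 + E" "C \<le> P3 + E" "D \<le> P4 + E" "8 * E \<le> A + B + C + D"
    for A B C D E P1 P2 P3 P4 S :: real using that by linarith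
  ultimately show T: "T \<le> 8 * (norm h + norm q)" using \<eta>T unfolding T_def by blast
  have p23: "\<bar>p2 - p3\<bar> \<le> 3 * (\<eta> * T)" using p(2,3) bc by linarith
  have "2 * \<bar>Im h\<bar> = \<bar>p2 - p3\<bar>" by (simp add: h_def)
  also note p23
  also have "3 * (\<eta> * T) \<le> 3 * (\<eta> * (8 * (norm h + norm q)))" using T \<eta> by (intro mult_left_mono) auto
  finally show "\<bar>Im h\<bar> \<le> 12 * \<eta> * (norm h + norm q)" by (simp add: algebra_simps)
  have sq: "\<bar>x\<^sup>2 - y\<^sup>2\<bar> \<le> 6 * \<eta> * T\<^sup>2" if "\<bar>x + y\<bar> \<le> 2 * (\<eta> * T)" "\<bar>y\<bar> \<le> T" for x y
  proof -
    have "\<bar>x\<^sup>2 - y\<^sup>2\<bar> = \<bar>x + y\<bar> * \<bar>x - y\<bar>"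
      by (simp add: power2_eq_square algebra_simps flip: abs_mult)
    also have "\<dots> \<le> (2 * (\<eta> * T)) * (3 * T)"
    proof (rule mult_mono)
      show "\<bar>x - y\<bar> \<le> 3 * T" using that \<eta>T T0 by linarith
    qed (use that \<eta> T0 in auto)
    finally show ?thesis by (simp add: power2_eq_square ac_simps)
  qed
  have 1: "\<bar>(p1 - p4)\<^sup>2 - (a - d)\<^sup>2\<bar> \<le> 6 * \<eta> * T\<^sup>2"
  proof (rule sq)
    show "\<bar>p1 - p4 + (a - d)\<bar> \<le> 2 * (\<eta> * T)" using p(1,4) by linarith
    show "\<bar>a - d\<bar> \<le> T" unfolding T_def by linarith
  qed
  have 2: "\<bar>(p2 + p3)\<^sup>2 - (b + c)\<^sup>2\<bar> \<le> 6 * \<eta> * T\<^sup>2"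
  proof (rule sq)
    show "\<bar>p2 + p3 + (b + c)\<bar> \<le> 2 * (\<eta> * T)" using p(2,3) by linarith
    show "\<bar>b + c\<bar> \<le> T" unfolding T_def by linarith
  qed
  have 3: "\<bar>(p1 + p4)\<^sup>2 - (a + d)\<^sup>2\<bar> \<le> 6 * \<eta> * T\<^sup>2"
  proof (rule sq)
    show "\<bar>p1 + p4 + (a + d)\<bar> \<le> 2 * (\<eta> * T)" using p(1,4) by linarith
    show "\<bar>a + d\<bar> \<le> T" unfolding T_def by linarith
  qed
  have \<eta>2: "x\<^sup>2 \<le> \<eta> * T\<^sup>2 * k\<^sup>2 / 8" if "\<bar>x\<bar> \<le> k * (\<eta> * T)" "k \<ge> 0" for x k
  proof -
    have "x\<^sup>2 \<le> (k * (\<eta> * T))\<^sup>2" using power_mono[OF that(1), of 2] by simp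
    also have "\<dots> = \<eta> * (\<eta> * (k\<^sup>2 * T\<^sup>2))" by (simp add: power2_eq_square)
    also have "\<dots> \<le> \<eta> * (1 / 8 * (k\<^sup>2 * T\<^sup>2))" using \<eta> by (intro mult_left_mono mult_right_mono) auto
    finally show ?thesis by (simp add: ac_simps)
  qed
  have 4: "(p2 - p3)\<^sup>2 \<le> 2 * \<eta> * T\<^sup>2"
  proof -
    have "(p2 - p3)\<^sup>2 \<le> \<eta> * T\<^sup>2 * 3\<^sup>2 / 8" 
    proof (rule \<eta>2)
      show "\<bar>p2 - p3\<bar> \<le> 3 * (\<eta> * T)" by (rule p23)
    qed simp
    also have "\<dots> \<le> 2 * \<eta> * T\<^sup>2" using \<eta> by simp
    finally show ?thesis .
  qed
  have 5: "(b - c)\<^sup>2 \<le> \<eta> * T\<^sup>2"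
  proof -
    have "(b - c)\<^sup>2 \<le> \<eta> * T\<^sup>2 * 1\<^sup>2 / 8" using bc by (intro \<eta>2) auto
    also have "\<dots> \<le> \<eta> * T\<^sup>2" using \<eta> by simp
    finally show ?thesis .
  qed
  define M1 where "M1 = (1 + m)\<^sup>2"
  define M2 where "M2 = (1 - m)\<^sup>2"
  have M: "M1 \<ge> 0" "M2 \<ge> 0" by (auto simp: M1_def M2_def)
  have q4: "4 * (norm q)\<^sup>2 = (p1 - p4)\<^sup>2 + (p2 + p3)\<^sup>2" and h4: "4 * (norm h)\<^sup>2 = (p1 + p4)\<^sup>2 + (p2 - p3)\<^sup>2"
    unfolding h_def q_def cmod_power2 by (simp_all add: power_divide)
  \<comment> \<open>The summand (b - c)^2 reduces (b + c)^2 to 4 b c, which completes the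
    determinant. The bounds below are 13 = 6 + 6 + 1 and 8 = 6 + 2.\<close>
  define x where "x = (p1 - p4)\<^sup>2 - (a - d)\<^sup>2 + ((p2 + p3)\<^sup>2 - (b + c)\<^sup>2) + (b - c)\<^sup>2"
  define y where "y = (p1 + p4)\<^sup>2 - (a + d)\<^sup>2 + (p2 - p3)\<^sup>2"
  have x: "\<bar>x\<bar> \<le> 13 * (\<eta> * T\<^sup>2)" unfolding x_def using 1 2 5 zero_le_power2[of "b - c"] by linarith
  have y: "\<bar>y\<bar> \<le> 8 * (\<eta> * T\<^sup>2)" unfolding y_def using 3 4 zero_le_power2[of "p2 - p3"] by linarith
  define W where "W = M1 * (norm q)\<^sup>2 - M2 * (norm h)\<^sup>2"
  have "4 * W = M1 * (4 * (norm q)\<^sup>2) - M2 * (4 * (norm h)\<^sup>2)" by (simp add: W_def)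
  also have "\<dots> = 4 * (m * (a + d)\<^sup>2 - M1 * (a * d - b * c)) + M1 * x - M2 * y"
    unfolding q4 h4 x_def y_def M1_def M2_def by (simp add: power2_eq_square algebra_simps)
  finally have "4 * W = 4 * (m * (a + d)\<^sup>2 - M1 * (a * d - b * c)) + M1 * x - M2 * y" .
  moreover have "\<bar>M1 * x\<bar> \<le> M1 * (13 * (\<eta> * T\<^sup>2))" "\<bar>M2 * y\<bar> \<le> M2 * (8 * (\<eta> * T\<^sup>2))"
    using mult_left_mono[OF x M(1)] mult_left_mono[OF y M(2)] M by (simp_all add: abs_mult)
  moreover have "4 * \<bar>w\<bar> \<le> 4 * e + f + g" if "4 * w = 4 * A + X - Y" "\<bar>X\<bar> \<le> f" "\<bar>Y\<bar> \<le> g" "\<bar>A\<bar> \<le> e"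
    for w A X Y e f g :: real using that by linarith
  ultimately have "4 * \<bar>W\<bar> \<le> 4 * (\<eta> * T\<^sup>2) + M1 * (13 * (\<eta> * T\<^sup>2)) + M2 * (8 * (\<eta> * T\<^sup>2))"
    using r[folded M1_def] by blast
  then have 6: "4 * \<bar>W\<bar> \<le> (13 * M1 + 8 * M2 + 4) * \<eta> * T\<^sup>2"
    by (simp add: algebra_simps)
  have "T\<^sup>2 \<le> (8 * (norm h + norm q))\<^sup>2" using T T0 by (intro power_mono)
  also have "\<dots> \<le> 128 * ((norm h)\<^sup>2 + (norm q)\<^sup>2)"
    using zero_le_power2[of "norm h - norm q"] by (simp add: power2_eq_square algebra_simps)
  finally have "(13 * M1 + 8 * M2 + 4) * \<eta> * T\<^sup>2 \<le> (13 * M1 + 8 * M2 + 4) * \<eta> * (128 * ((norm h)\<^sup>2 + (norm q)\<^sup>2))"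
    using M \<eta> by (intro mult_left_mono) auto
  then have "\<bar>W\<bar> \<le> (13 * M1 + 8 * M2 + 4) * \<eta> * (128 * ((norm h)\<^sup>2 + (norm q)\<^sup>2))"
  proof -
    have "w \<le> z" if "4 * w \<le> y" "y \<le> z" "0 \<le> w" for w y z :: real using that by linarith
    then show ?thesis using 6 \<open>_ \<le> (13 * M1 + 8 * M2 + 4) * \<eta> * (128 * _)\<close> abs_ge_zero[of W] by blast
  qed
  then show "\<bar>(1 + m)\<^sup>2 * (norm q)\<^sup>2 - (1 - m)\<^sup>2 * (norm h)\<^sup>2\<bar> \<le>
      128 * (13 * (1 + m)\<^sup>2 + 8 * (1 - m)\<^sup>2 + 4) * \<eta> * ((norm h)\<^sup>2 + (norm q)\<^sup>2)"
    unfolding M1_def M2_def W_def by (simp only: ac_simps)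
qed

text \<open>With k and k' the deviations, (k' - m k)(k - m k') is a polynomial in the trace and
  determinant of A - tI. So the secant hypothesis passes to the smooth map G although the principal
  curvatures need not be differentiable.\<close>

lemma plane_slope:
  fixes F Nn :: "real^2 \<Rightarrow> real^3" and k1 k2 :: "real^2 \<Rightarrow> real" and x0 :: "real^2" and m t :: real
  defines "DF \<equiv> \<lambda>x. frechet_derivative F (at x)" and "DN \<equiv> \<lambda>x. frechet_derivative Nn (at x)"
  defines "A \<equiv> \<lambda>x. THE A :: real^2^2. \<forall>u. DF x (A *v u) = - DN x u"
  assumes B: "open B" "x0 \<in> B" and smF: "smooth_open B F" and smN: "smooth_open B Nn"
    and inj: "\<And>x. x \<in> B \<Longrightarrow> inj (DF x)" and unit: "\<And>x. x \<in> B \<Longrightarrow> norm (Nn x) = 1"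
    and orth: "\<And>x u. x \<in> B \<Longrightarrow> Nn x \<bullet> DF x u = 0"
    and eig: "\<And>x. x \<in> B \<Longrightarrow> eigenvalues_with_mult (A x) (k1 x) (k2 x)"
    and umb: "A x0 = mat t"
    and m: "m \<noteq> 0" "m \<noteq> -1"
    and secant: "\<And>\<epsilon>. \<epsilon> > 0 \<Longrightarrow> \<forall>\<^sub>F x in nhds x0. \<bar>(k2 x - t) - m * (k1 x - t)\<bar> \<le> \<epsilon> * (\<bar>k1 x - t\<bar> + \<bar>k2 x - t\<bar>)"
    and nonconst: "\<not> (\<forall>\<^sub>F x in nhds x0. k1 x = t \<and> k2 x = t)"
  shows "\<exists>j\<ge>1. m = 2 * real j + 1 \<or> m = 1 / (2 * real j + 1)"
proof -
  have dF: "(F has_derivative DF x) (at x)" and dN: "(Nn has_derivative DN x) (at x)" if "x \<in> B" for x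
    unfolding DF_def DN_def using smooth_open_has_derivative[OF smF that] smooth_open_has_derivative[OF smN that] by auto
  have orthN: "Nn x \<bullet> DN x u = 0" if "x \<in> B" for x u
  proof -
    have "((\<lambda>x. Nn x \<bullet> Nn x) has_derivative (\<lambda>u. Nn x \<bullet> DN x u + DN x u \<bullet> Nn x)) (at x)"
      by (rule has_derivative_inner[OF dN[OF that] dN[OF that]])
    moreover have "((\<lambda>x. Nn x \<bullet> Nn x) has_derivative (\<lambda>u. 0)) (at x)"
      by (rule has_derivative_transform_within_open[OF has_derivative_const B(1) that])
        (use unit in \<open>simp add: dot_square_norm\<close>)
    ultimately have "(\<lambda>u. Nn x \<bullet> DN x u + DN x u \<bullet> Nn x) = (\<lambda>u. 0)" by (rule has_derivative_unique)
    from fun_cong[OF this, of u] show ?thesis by (simp add: inner_commute)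
  qed
  have Aspec: "DF x (A x *v u) = - DN x u" if "x \<in> B" for x u
    unfolding A_def using dF[OF that] dN[OF that] inj[OF that] unit[OF that] orth[OF that] orthN[OF that]
    by (intro shape_operator_spec[of _ _ "Nn x"]) (auto dest: has_derivative_linear)
  obtain e1 e2 where e: "norm (DF x0 e1) = 1" "norm (DF x0 e2) = 1" "DF x0 e1 \<bullet> DF x0 e2 = 0"
      and ind: "e1 $ 1 * e2 $ 2 - e1 $ 2 * e2 $ 1 \<noteq> 0"
    using orthonormal_frame[OF has_derivative_linear[OF dF[OF B(2)]] inj[OF B(2)]] by blast
  define l where "l z = Re z *\<^sub>R e1 + Im z *\<^sub>R e2" for z
  define D where "D = e1 $ 1 * e2 $ 2 - e1 $ 2 * e2 $ 1"
  \<comment> \<open>The inverse of l by Cramer's rule; \<open>evB'\<close> uses it to carry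
    neighbourhoods of 0 back to neighbourhoods of x0.\<close>
  define r where "r y = Complex ((y $ 1 * e2 $ 2 - y $ 2 * e2 $ 1) / D) ((e1 $ 1 * y $ 2 - e1 $ 2 * y $ 1) / D)" for y :: "real^2"
  have D: "D \<noteq> 0" using ind by (simp add: D_def)
  have lr: "l (r y) = y" for y
  proof -
    have "(y $ 1 * e2 $ 2 - y $ 2 * e2 $ 1) * e1 $ 1 + (e1 $ 1 * y $ 2 - e1 $ 2 * y $ 1) * e2 $ 1 = D * y $ 1"
      "(y $ 1 * e2 $ 2 - y $ 2 * e2 $ 1) * e1 $ 2 + (e1 $ 1 * y $ 2 - e1 $ 2 * y $ 1) * e2 $ 2 = D * y $ 2"
      unfolding D_def by (simp_all add: algebra_simps)
    moreover have "P / D * u + Q / D * w = v" if "P * u + Q * w = D * v" for P Q u w v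
    proof -
      have "P / D * u + Q / D * w = (P * u + Q * w) / D" by (simp add: add_divide_distrib)
      then show ?thesis using that D by simp
    qed
    ultimately show ?thesis unfolding l_def r_def vec_eq_iff forall_2 by simp
  qed
  have coords: "\<exists>a b. y = a *\<^sub>R e1 + b *\<^sub>R e2" for y :: "real^2"
    using lr[of y] unfolding l_def by metis
  have bl: "bounded_linear l" unfolding l_def[abs_def]
    by (intro bounded_linear_add bounded_linear_scaleR_const bounded_linear_Re bounded_linear_Im)
  have l: "l 0 = 0" "l 1 = e1" "l \<i> = e2" by (simp_all add: l_def)
  define V where "V = (\<lambda>z. x0 + l z) -` B"
  have contl: "continuous_on UNIV (\<lambda>z. x0 + l z)"
    by (intro continuous_on_add continuous_on_const linear_continuous_on bl)
  have V: "open V" unfolding V_def using contl B(1) by (simp add: open_vimage)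
  have V0: "0 \<in> V" using B l by (simp add: V_def)
  have inV: "x0 + l z \<in> B" if "z \<in> V" for z using that by (simp add: V_def)
  define Y where "Y z = F (x0 + l z)" for z
  define Mn where "Mn z = Nn (x0 + l z)" for z
  have smY: "smooth_open V Y" and smM: "smooth_open V Mn"
    unfolding Y_def[abs_def] Mn_def[abs_def] using smF smN by (auto intro!: smooth_open_affine[OF V bl] inV)
  have dl: "((\<lambda>z. x0 + l z) has_derivative l) (at z)" for z
    using bounded_linear_imp_has_derivative[OF bl] by (auto intro!: derivative_eq_intros)
  have dY: "(Y has_derivative (\<lambda>v. DF (x0 + l z) (l v))) (at z)" if "z \<in> V" for z
    unfolding Y_def[abs_def] using has_derivative_compose[OF dl dF[OF inV[OF that]]] .
  have dM: "(Mn has_derivative (\<lambda>v. DN (x0 + l z) (l v))) (at z)" if "z \<in> V" for z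
    unfolding Mn_def[abs_def] using has_derivative_compose[OF dl dN[OF inV[OF that]]] .
  define Y1 where "Y1 z = frechet_derivative Y (at z) 1" for z
  define Y2 where "Y2 z = frechet_derivative Y (at z) \<i>" for z
  define M1 where "M1 z = frechet_derivative Mn (at z) 1" for z
  define M2 where "M2 z = frechet_derivative Mn (at z) \<i>" for z
  have smY1: "smooth_open V Y1" and smY2: "smooth_open V Y2"
    unfolding Y1_def[abs_def] Y2_def[abs_def] using smooth_open_frechet[OF smY] by auto
  have Yv: "Y1 z = DF (x0 + l z) e1" "Y2 z = DF (x0 + l z) e2"
    and Mv: "M1 z = DN (x0 + l z) e1" "M2 z = DN (x0 + l z) e2" if "z \<in> V" for z
    using frechet_derivative_at[OF dY[OF that], symmetric] frechet_derivative_at[OF dM[OF that], symmetric]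
    by (simp_all add: Y1_def Y2_def M1_def M2_def l)
  \<comment> \<open>Symmetry of the second fundamental form: differentiate the orthogonality of Mn
    to Y1 along \<i> and to Y2 along 1, and use equality of the mixed derivatives of Y.\<close>
  have symm: "M1 z \<bullet> Y2 z = M2 z \<bullet> Y1 z" if z: "z \<in> V" for z
  proof -
    have deriv: "Mn z \<bullet> frechet_derivative Z (at z) v + frechet_derivative Mn (at z) v \<bullet> Z z = 0"
      if Z: "smooth_open V Z" "\<And>z. z \<in> V \<Longrightarrow> Mn z \<bullet> Z z = 0" for Z v
    proof -
      have "((\<lambda>z. Mn z \<bullet> Z z) has_derivative (\<lambda>v. Mn z \<bullet> frechet_derivative Z (at z) v + frechet_derivative Mn (at z) v \<bullet> Z z)) (at z)"
        by (rule has_derivative_inner[OF smooth_open_has_derivative[OF smM z] smooth_open_has_derivative[OF Z(1) z]])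
      moreover have "((\<lambda>z. Mn z \<bullet> Z z) has_derivative (\<lambda>u. 0)) (at z)"
        by (rule has_derivative_transform_within_open[OF has_derivative_const V z]) (simp add: Z)
      ultimately have "(\<lambda>v. Mn z \<bullet> frechet_derivative Z (at z) v + frechet_derivative Mn (at z) v \<bullet> Z z) = (\<lambda>u. 0)"
        by (rule has_derivative_unique)
      from fun_cong[OF this, of v] show ?thesis .
    qed
    have normal: "Mn z \<bullet> Y1 z = 0" "Mn z \<bullet> Y2 z = 0" if "z \<in> V" for z
      using that by (simp_all add: Yv Mn_def orth inV)
    have "Mn z \<bullet> frechet_derivative Y1 (at z) \<i> + frechet_derivative Mn (at z) \<i> \<bullet> Y1 z = 0"
      "Mn z \<bullet> frechet_derivative Y2 (at z) 1 + frechet_derivative Mn (at z) 1 \<bullet> Y2 z = 0"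
      using deriv[OF smY1 normal(1)] deriv[OF smY2 normal(2)] by blast+
    moreover have "frechet_derivative Y1 (at z) \<i> = frechet_derivative Y2 (at z) 1"
      unfolding Y1_def[abs_def] Y2_def[abs_def] by (rule second_derivative_symmetric[OF V smY z])
    ultimately show ?thesis unfolding M1_def M2_def by (metis add_left_cancel)
  qed
  define f1 where "f1 = Y1 0"
  define f2 where "f2 = Y2 0"
  have f: "f1 \<bullet> f1 = 1" "f2 \<bullet> f2 = 1" "f1 \<bullet> f2 = 0" "f2 \<bullet> f1 = 0"
    using e V0 by (simp_all add: f1_def f2_def Yv l dot_square_norm inner_commute)
  define proj where "proj y = Complex (y \<bullet> f1) (y \<bullet> f2)" for y
  have blp: "bounded_linear proj"
  proof -
    have "proj = (\<lambda>y. of_real (y \<bullet> f1) + \<i> * of_real (y \<bullet> f2))"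
      by (auto simp: proj_def complex_eq_iff)
    then show ?thesis
      by (auto intro!: bounded_linear_add bounded_linear_compose[OF bounded_linear_of_real]
          bounded_linear_compose[OF bounded_linear_mult_right] bounded_linear_inner_left)
  qed
  \<comment> \<open>The tangent plane at p is kept fixed, so G is a smooth plane map. Adding t Y
    replaces A by A - tI in the differential, which therefore vanishes at 0.\<close>
  define G where "G z = proj (Mn z + t *\<^sub>R Y z)" for z
  have smG: "smooth_open V G" unfolding G_def[abs_def]
    by (intro smooth_open_linear[OF V blp] smooth_open_add[OF V] smooth_open_linear[OF V bounded_linear_scaleR_right] smM smY)
  have dG: "frechet_derivative G (at z) 1 = proj (M1 z + t *\<^sub>R Y1 z)" "frechet_derivative G (at z) \<i> = proj (M2 z + t *\<^sub>R Y2 z)"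
    if "z \<in> V" for z
  proof -
    have "(G has_derivative (\<lambda>v. proj (frechet_derivative Mn (at z) v + t *\<^sub>R frechet_derivative Y (at z) v))) (at z)"
      unfolding G_def[abs_def]
      by (intro bounded_linear.has_derivative[OF blp] has_derivative_add has_derivative_scaleR_right
          smooth_open_has_derivative[OF smM that] smooth_open_has_derivative[OF smY that])
    from frechet_derivative_at[OF this, symmetric]
    show "frechet_derivative G (at z) 1 = proj (M1 z + t *\<^sub>R Y1 z)" "frechet_derivative G (at z) \<i> = proj (M2 z + t *\<^sub>R Y2 z)"
      by (simp_all add: M1_def M2_def Y1_def Y2_def)
  qed
  have evB: "\<forall>\<^sub>F z in nhds 0. P (x0 + l z)" if "\<forall>\<^sub>F x in nhds x0. P x" for P
  proof -
    have "isCont (\<lambda>z. x0 + l z) 0" using contl by (simp add: continuous_on_eq_continuous_at)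
    then have "((\<lambda>z. x0 + l z) \<longlongrightarrow> x0 + l 0) (nhds 0)"
      using tendsto_at_iff_tendsto_nhds[of "\<lambda>z. x0 + l z" 0] unfolding isCont_def by blast
    then have "filterlim (\<lambda>z. x0 + l z) (nhds x0) (nhds 0)" by (simp add: l)
    then show ?thesis using that by (auto simp: filterlim_iff)
  qed
  have evB': "\<forall>\<^sub>F x in nhds x0. P x" if ev: "\<forall>\<^sub>F z in nhds 0. P (x0 + l z)" for P
  proof -
    have "((\<lambda>x. r (x - x0)) \<longlongrightarrow> r (x0 - x0)) (nhds x0)"
      unfolding r_def Complex_eq by (intro tendsto_intros filterlim_ident D)
    moreover have "r 0 = 0" by (simp add: r_def complex_eq_iff)
    ultimately have "filterlim (\<lambda>x. r (x - x0)) (nhds 0) (nhds x0)" by simp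
    then have "\<forall>\<^sub>F x in nhds x0. P (x0 + l (r (x - x0)))" using ev by (auto simp: filterlim_iff)
    then show ?thesis by (simp add: lr)
  qed
  \<comment> \<open>The moving frame has almost the same components as (f1, f2), and the metric is
    almost Euclidean.\<close>
  define near where "near z \<eta> \<longleftrightarrow> \<bar>Y1 z \<bullet> f1 - 1\<bar> \<le> \<eta> \<and> \<bar>Y2 z \<bullet> f1\<bar> \<le> \<eta> \<and> \<bar>Y1 z \<bullet> f2\<bar> \<le> \<eta> \<and>
    \<bar>Y2 z \<bullet> f2 - 1\<bar> \<le> \<eta> \<and> \<bar>Y1 z \<bullet> Y1 z - 1\<bar> \<le> \<eta> \<and> \<bar>Y1 z \<bullet> Y2 z\<bar> \<le> \<eta> \<and> \<bar>Y2 z \<bullet> Y2 z - 1\<bar> \<le> \<eta>" for z \<eta>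
  have key: "\<exists>p1 p2 p3 p4 a b c d. Dz G z = Complex ((p1 + p4) / 2) ((p2 - p3) / 2) \<and> Dw G z = Complex ((p1 - p4) / 2) ((p2 + p3) / 2) \<and>
      (let T = \<bar>a\<bar> + \<bar>b\<bar> + \<bar>c\<bar> + \<bar>d\<bar>; k = k1 (x0 + l z) - t; k' = k2 (x0 + l z) - t in
      \<bar>p1 + a\<bar> \<le> \<eta> * T \<and> \<bar>p2 + b\<bar> \<le> \<eta> * T \<and> \<bar>p3 + c\<bar> \<le> \<eta> * T \<and> \<bar>p4 + d\<bar> \<le> \<eta> * T \<and> \<bar>b - c\<bar> \<le> \<eta> * T \<and>
      a + d = k + k' \<and> a * d - b * c = k * k')"
    if z: "z \<in> V" and near: "near z \<eta>" for z \<eta>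
  proof -
    have \<eta>: "\<bar>Y1 z \<bullet> f1 - 1\<bar> \<le> \<eta>" "\<bar>Y2 z \<bullet> f1\<bar> \<le> \<eta>" "\<bar>Y1 z \<bullet> f2\<bar> \<le> \<eta>" "\<bar>Y2 z \<bullet> f2 - 1\<bar> \<le> \<eta>"
      "\<bar>Y1 z \<bullet> Y1 z - 1\<bar> \<le> \<eta>" "\<bar>Y1 z \<bullet> Y2 z\<bar> \<le> \<eta>" "\<bar>Y2 z \<bullet> Y2 z - 1\<bar> \<le> \<eta>"
      using near unfolding near_def by blast+
    let ?x = "x0 + l z"
    have x: "?x \<in> B" by (rule inV[OF z])
    obtain \<alpha> b where A1: "A ?x *v e1 = \<alpha> *\<^sub>R e1 + b *\<^sub>R e2" using coords by blast
    obtain c \<delta> where A2: "A ?x *v e2 = c *\<^sub>R e1 + \<delta> *\<^sub>R e2" using coords by blast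
    define a where "a = \<alpha> - t"
    define d where "d = \<delta> - t"
    note lin = has_derivative_linear[OF dF[OF x]]
    have M1: "M1 z = - (\<alpha> *\<^sub>R Y1 z + b *\<^sub>R Y2 z)"
      using Aspec[OF x, of e1] unfolding A1 Yv[OF z] Mv[OF z] by (simp add: linear_add[OF lin] linear_cmul[OF lin])
    have M2: "M2 z = - (c *\<^sub>R Y1 z + \<delta> *\<^sub>R Y2 z)"
      using Aspec[OF x, of e2] unfolding A2 Yv[OF z] Mv[OF z] by (simp add: linear_add[OF lin] linear_cmul[OF lin])
    have W: "M1 z + t *\<^sub>R Y1 z = - (a *\<^sub>R Y1 z + b *\<^sub>R Y2 z)" "M2 z + t *\<^sub>R Y2 z = - (c *\<^sub>R Y1 z + d *\<^sub>R Y2 z)"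
      unfolding M1 M2 a_def d_def by (simp_all add: algebra_simps)
    define p1 where "p1 = - (a * (Y1 z \<bullet> f1) + b * (Y2 z \<bullet> f1))"
    define p2 where "p2 = - (a * (Y1 z \<bullet> f2) + b * (Y2 z \<bullet> f2))"
    define p3 where "p3 = - (c * (Y1 z \<bullet> f1) + d * (Y2 z \<bullet> f1))"
    define p4 where "p4 = - (c * (Y1 z \<bullet> f2) + d * (Y2 z \<bullet> f2))"
    define T where "T = \<bar>a\<bar> + \<bar>b\<bar> + \<bar>c\<bar> + \<bar>d\<bar>"
    have g1: "frechet_derivative G (at z) 1 = Complex p1 p2" and g2: "frechet_derivative G (at z) \<i> = Complex p3 p4"
      unfolding dG[OF z] W proj_def p1_def p2_def p3_def p4_def by (simp_all add: inner_add_left inner_diff_left)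
    have D: "Dz G z = Complex ((p1 + p4) / 2) ((p2 - p3) / 2)" "Dw G z = Complex ((p1 - p4) / 2) ((p2 + p3) / 2)"
      unfolding Dz_def Dw_def g1 g2 by (simp_all add: complex_eq_iff)
    have bound: "\<bar>u * r + v * s\<bar> \<le> \<eta> * (\<bar>u\<bar> + \<bar>v\<bar>)" if "\<bar>r\<bar> \<le> \<eta>" "\<bar>s\<bar> \<le> \<eta>" for u v r s :: real
    proof -
      have "\<bar>u * r + v * s\<bar> \<le> \<bar>u\<bar> * \<bar>r\<bar> + \<bar>v\<bar> * \<bar>s\<bar>" by (metis abs_mult abs_triangle_ineq)
      also have "\<dots> \<le> \<bar>u\<bar> * \<eta> + \<bar>v\<bar> * \<eta>" using that by (intro add_mono mult_left_mono) auto
      finally show ?thesis by (simp add: algebra_simps)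
    qed
    have \<eta>0: "\<eta> \<ge> 0" using \<eta>(1) by linarith
    have le1: "\<eta> * (\<bar>a\<bar> + \<bar>b\<bar>) \<le> \<eta> * T" "\<eta> * (\<bar>c\<bar> + \<bar>d\<bar>) \<le> \<eta> * T" using \<eta>0 by (auto simp: T_def intro!: mult_left_mono)
    have "p1 + a = - (a * (Y1 z \<bullet> f1 - 1) + b * (Y2 z \<bullet> f1))" "p2 + b = - (a * (Y1 z \<bullet> f2) + b * (Y2 z \<bullet> f2 - 1))"
      "p3 + c = - (c * (Y1 z \<bullet> f1 - 1) + d * (Y2 z \<bullet> f1))" "p4 + d = - (c * (Y1 z \<bullet> f2) + d * (Y2 z \<bullet> f2 - 1))"
      unfolding p1_def p2_def p3_def p4_def by (simp_all add: algebra_simps)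
    then have p: "\<bar>p1 + a\<bar> \<le> \<eta> * T" "\<bar>p2 + b\<bar> \<le> \<eta> * T" "\<bar>p3 + c\<bar> \<le> \<eta> * T" "\<bar>p4 + d\<bar> \<le> \<eta> * T"
      using le1 bound[OF \<eta>(1,2), of a b] bound[OF \<eta>(3,4), of a b] bound[OF \<eta>(1,2), of c d] bound[OF \<eta>(3,4), of c d]
      by (simp_all only: abs_minus_cancel)
    \<comment> \<open>In terms of the metric this says that A - tI is self-adjoint; as the metric is
      within \<eta> of the identity, b and c differ by at most \<eta> T.\<close>
    have "(M1 z + t *\<^sub>R Y1 z) \<bullet> Y2 z = (M2 z + t *\<^sub>R Y2 z) \<bullet> Y1 z"
      using symm[OF z] by (simp only: inner_add_left inner_scaleR_left inner_commute[of "Y2 z" "Y1 z"])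
    then have "a * (Y1 z \<bullet> Y2 z) + b * (Y2 z \<bullet> Y2 z) = c * (Y1 z \<bullet> Y1 z) + d * (Y1 z \<bullet> Y2 z)"
      unfolding W by (simp only: inner_minus_left inner_add_left inner_scaleR_left neg_equal_iff_equal
          inner_commute[of "Y2 z" "Y1 z"])
    then have "b - c = (c * (Y1 z \<bullet> Y1 z - 1) + d * (Y1 z \<bullet> Y2 z)) - (a * (Y1 z \<bullet> Y2 z) + b * (Y2 z \<bullet> Y2 z - 1))"
      by (simp add: algebra_simps)
    then have "\<bar>b - c\<bar> \<le> \<eta> * (\<bar>c\<bar> + \<bar>d\<bar>) + \<eta> * (\<bar>a\<bar> + \<bar>b\<bar>)"
      using bound[OF \<eta>(5,6), of c d] bound[OF \<eta>(6,7), of a b] by linarith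
    then have bc: "\<bar>b - c\<bar> \<le> \<eta> * T" by (simp add: T_def algebra_simps)
    have tr: "\<alpha> + \<delta> = k1 ?x + k2 ?x" "\<alpha> * \<delta> - b * c = k1 ?x * k2 ?x"
      using trace_det_in_basis[OF A1 A2 ind] eigenvalues_trace_det[OF eig[OF x]] by auto
    have tr': "a + d = (k1 ?x - t) + (k2 ?x - t)" "a * d - b * c = (k1 ?x - t) * (k2 ?x - t)"
    proof -
      show "a + d = (k1 ?x - t) + (k2 ?x - t)" using tr by (simp add: a_def d_def)
      have "a * d - b * c = (\<alpha> * \<delta> - b * c) - t * (\<alpha> + \<delta>) + t * t" by (simp add: a_def d_def algebra_simps)
      also have "\<dots> = (k1 ?x - t) * (k2 ?x - t)" unfolding tr by (simp add: algebra_simps)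
      finally show "a * d - b * c = (k1 ?x - t) * (k2 ?x - t)" .
    qed
    show ?thesis unfolding Let_def
      using D p bc tr' unfolding T_def by blast
  qed
  have close: "\<forall>\<^sub>F z in nhds 0. near z \<eta>" if "\<eta> > 0" for \<eta>
  proof -
    have c: "(Y1 \<longlongrightarrow> f1) (nhds 0)" "(Y2 \<longlongrightarrow> f2) (nhds 0)"
      using smooth_open_continuous_on[OF smY1] smooth_open_continuous_on[OF smY2] V V0
      by (auto simp: continuous_on_eq_continuous_at isCont_def tendsto_at_iff_tendsto_nhds f1_def f2_def)
    have ev: "\<forall>\<^sub>F z in nhds 0. \<bar>g z - y\<bar> \<le> \<eta>" if "(g \<longlongrightarrow> y) (nhds 0)" for g and y :: real
      using tendstoD[OF that \<open>\<eta> > 0\<close>] by eventually_elim (simp add: dist_real_def)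
    have "\<forall>\<^sub>F z in nhds 0. \<bar>Y1 z \<bullet> f1 - f1 \<bullet> f1\<bar> \<le> \<eta>" "\<forall>\<^sub>F z in nhds 0. \<bar>Y2 z \<bullet> f1 - f2 \<bullet> f1\<bar> \<le> \<eta>"
      "\<forall>\<^sub>F z in nhds 0. \<bar>Y1 z \<bullet> f2 - f1 \<bullet> f2\<bar> \<le> \<eta>" "\<forall>\<^sub>F z in nhds 0. \<bar>Y2 z \<bullet> f2 - f2 \<bullet> f2\<bar> \<le> \<eta>"
      "\<forall>\<^sub>F z in nhds 0. \<bar>Y1 z \<bullet> Y1 z - f1 \<bullet> f1\<bar> \<le> \<eta>" "\<forall>\<^sub>F z in nhds 0. \<bar>Y1 z \<bullet> Y2 z - f1 \<bullet> f2\<bar> \<le> \<eta>"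
      "\<forall>\<^sub>F z in nhds 0. \<bar>Y2 z \<bullet> Y2 z - f2 \<bullet> f2\<bar> \<le> \<eta>"
      by (intro ev tendsto_intros c)+
    then show ?thesis unfolding f near_def diff_zero by (intro eventually_conj)
  qed
  have inV': "\<forall>\<^sub>F z in nhds 0. z \<in> V" using V V0 by (intro eventually_nhds_in_open)
  define C where "C = 128 * (13 * (1 + m)\<^sup>2 + 8 * (1 - m)\<^sup>2 + 4)"
  have C: "C > 0" unfolding C_def by (intro mult_pos_pos add_nonneg_pos) auto
  \<comment> \<open>The last clause transports nonconstancy: where the differential of G vanishes, T
    = 0 and both deviations vanish.\<close>
  define small where "small \<eta> z \<longleftrightarrow> \<bar>Im (Dz G z)\<bar> \<le> 12 * \<eta> * (norm (Dz G z) + norm (Dw G z)) \<and>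
      \<bar>(1 + m)\<^sup>2 * (norm (Dw G z))\<^sup>2 - (1 - m)\<^sup>2 * (norm (Dz G z))\<^sup>2\<bar> \<le> C * \<eta> * ((norm (Dz G z))\<^sup>2 + (norm (Dw G z))\<^sup>2) \<and>
      (Dz G z = 0 \<and> Dw G z = 0 \<longrightarrow> k1 (x0 + l z) = t \<and> k2 (x0 + l z) = t)" for \<eta> z
  have main: "\<forall>\<^sub>F z in nhds 0. small \<eta> z" if \<eta>: "0 < \<eta>" "\<eta> \<le> 1 / 8" for \<eta>
  proof -
    \<comment> \<open>Chosen so that \<epsilon> (1 + |m|) times the bound 8 T^2 of \<open>kk\<close>
      is \<eta> T^2.\<close>
    define \<epsilon> where "\<epsilon> = \<eta> / (8 * (1 + \<bar>m\<bar>))"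
    have \<epsilon>: "\<epsilon> > 0" using \<eta> by (auto simp: \<epsilon>_def)
    show ?thesis using close[OF \<eta>(1)] inV' evB[OF secant[OF \<epsilon>]]
    proof eventually_elim
      case (elim z)
      define k where "k = k1 (x0 + l z) - t"
      define k' where "k' = k2 (x0 + l z) - t"
      obtain p1 p2 p3 p4 a b c d where
        D: "Dz G z = Complex ((p1 + p4) / 2) ((p2 - p3) / 2)" "Dw G z = Complex ((p1 - p4) / 2) ((p2 + p3) / 2)"
        and p: "\<bar>p1 + a\<bar> \<le> \<eta> * (\<bar>a\<bar> + \<bar>b\<bar> + \<bar>c\<bar> + \<bar>d\<bar>)" "\<bar>p2 + b\<bar> \<le> \<eta> * (\<bar>a\<bar> + \<bar>b\<bar> + \<bar>c\<bar> + \<bar>d\<bar>)"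
          "\<bar>p3 + c\<bar> \<le> \<eta> * (\<bar>a\<bar> + \<bar>b\<bar> + \<bar>c\<bar> + \<bar>d\<bar>)" "\<bar>p4 + d\<bar> \<le> \<eta> * (\<bar>a\<bar> + \<bar>b\<bar> + \<bar>c\<bar> + \<bar>d\<bar>)"
          "\<bar>b - c\<bar> \<le> \<eta> * (\<bar>a\<bar> + \<bar>b\<bar> + \<bar>c\<bar> + \<bar>d\<bar>)"
        and tr: "a + d = k + k'" "a * d - b * c = k * k'"
        using key[OF elim(2,1)] unfolding Let_def k_def[symmetric] k'_def[symmetric] by (elim exE conjE)
      define T where "T = \<bar>a\<bar> + \<bar>b\<bar> + \<bar>c\<bar> + \<bar>d\<bar>"
      \<comment> \<open>The point is k^2 + k'^2 = tr^2 - 2 det = a^2 + d^2 + 2 b c, which is at most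
        4 T^2.\<close>
      have kk: "(\<bar>k\<bar> + \<bar>k'\<bar>)\<^sup>2 \<le> 8 * T\<^sup>2"
      proof -
        have "\<bar>a\<bar> \<le> T" "\<bar>b\<bar> \<le> T" "\<bar>c\<bar> \<le> T" "\<bar>d\<bar> \<le> T" by (auto simp: T_def)
        then have 1: "a\<^sup>2 \<le> T\<^sup>2" "d\<^sup>2 \<le> T\<^sup>2" and bc: "\<bar>b\<bar> * \<bar>c\<bar> \<le> T\<^sup>2"
          using power_mono[of "\<bar>a\<bar>" T 2] power_mono[of "\<bar>d\<bar>" T 2]
          by (auto intro!: mult_mono simp: power2_eq_square)
        have "b * c \<le> \<bar>b\<bar> * \<bar>c\<bar>" by (metis abs_ge_self abs_mult)
        then have 2: "b * c \<le> T\<^sup>2" using bc by linarith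
        have 3: "(\<bar>k\<bar> + \<bar>k'\<bar>)\<^sup>2 \<le> 2 * (k\<^sup>2 + k'\<^sup>2)"
          using zero_le_power2[of "\<bar>k\<bar> - \<bar>k'\<bar>"] by (simp add: power2_eq_square algebra_simps)
        have "k\<^sup>2 + k'\<^sup>2 = (k + k')\<^sup>2 - 2 * (k * k')" by (simp add: power2_eq_square algebra_simps)
        also have "\<dots> = a\<^sup>2 + d\<^sup>2 + 2 * (b * c)" unfolding tr[symmetric] by (simp add: power2_eq_square algebra_simps)
        finally have "k\<^sup>2 + k'\<^sup>2 = a\<^sup>2 + d\<^sup>2 + 2 * (b * c)" .
        moreover have "x \<le> 8 * y" if "u = A + B + 2 * w" "A \<le> y" "B \<le> y" "w \<le> y" "x \<le> 2 * u"
          for x y u w A B :: real using that by linarith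
        ultimately show ?thesis using 1 2 3 by blast
      qed
      have r: "\<bar>m * (a + d)\<^sup>2 - (1 + m)\<^sup>2 * (a * d - b * c)\<bar> \<le> \<eta> * T\<^sup>2"
      proof -
        have "m * (a + d)\<^sup>2 - (1 + m)\<^sup>2 * (a * d - b * c) = - ((k' - m * k) * (k - m * k'))"
          unfolding tr by (simp add: power2_eq_square algebra_simps)
        then have "\<bar>m * (a + d)\<^sup>2 - (1 + m)\<^sup>2 * (a * d - b * c)\<bar> = \<bar>k' - m * k\<bar> * \<bar>k - m * k'\<bar>"
          by (simp add: abs_mult)
        also have "\<dots> \<le> (\<epsilon> * (\<bar>k\<bar> + \<bar>k'\<bar>)) * ((1 + \<bar>m\<bar>) * (\<bar>k\<bar> + \<bar>k'\<bar>))"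
        proof (rule mult_mono)
          show "\<bar>k' - m * k\<bar> \<le> \<epsilon> * (\<bar>k\<bar> + \<bar>k'\<bar>)" using elim by (simp add: k_def k'_def)
          have "\<bar>k - m * k'\<bar> \<le> \<bar>k\<bar> + \<bar>m\<bar> * \<bar>k'\<bar>" by (metis abs_mult abs_triangle_ineq4)
          also have "\<dots> \<le> (1 + \<bar>m\<bar>) * (\<bar>k\<bar> + \<bar>k'\<bar>)" by (simp add: algebra_simps)
          finally show "\<bar>k - m * k'\<bar> \<le> (1 + \<bar>m\<bar>) * (\<bar>k\<bar> + \<bar>k'\<bar>)" .
        qed (use \<epsilon> in auto)
        also have "\<dots> = \<epsilon> * (1 + \<bar>m\<bar>) * (\<bar>k\<bar> + \<bar>k'\<bar>)\<^sup>2" by (simp add: power2_eq_square ac_simps)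
        also have "\<epsilon> * (1 + \<bar>m\<bar>) = \<eta> / 8"
        proof -
          have "\<eta> / (8 * x) * x = \<eta> / 8" if "x \<noteq> 0" for x using that by simp
          moreover have "1 + \<bar>m\<bar> \<noteq> 0" by linarith
          ultimately show ?thesis unfolding \<epsilon>_def by blast
        qed
        also have "\<eta> / 8 * (\<bar>k\<bar> + \<bar>k'\<bar>)\<^sup>2 \<le> \<eta> / 8 * (8 * T\<^sup>2)" using kk \<eta> by (intro mult_left_mono) auto
        finally show ?thesis by simp
      qed
      note pj = perturbed_jacobian[OF \<eta> p r[unfolded T_def], folded D T_def]
      have "k = 0 \<and> k' = 0" if "Dz G z = 0" "Dw G z = 0"
      proof -
        have "T \<le> 0" using pj(1) that by simp
        then have "T = 0" by (simp add: T_def)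
        then have "\<bar>k\<bar> + \<bar>k'\<bar> = 0" using kk by simp
        then show ?thesis by (simp add: add_nonneg_eq_0_iff)
      qed
      then show ?case using pj(2,3) unfolding small_def C_def k_def k'_def by simp
    qed
  qed
  show ?thesis
  proof (rule slope_of_gradient_like_map[OF V V0 smG m])
    fix \<epsilon> :: real assume \<epsilon>: "\<epsilon> > 0"
    have min1: "0 < min (1 / 8) (\<epsilon> / 12)" and min2: "0 < min (1 / 8) (\<epsilon> / C)" using \<epsilon> C by auto
    have "12 * min (1 / 8) (\<epsilon> / 12) \<le> \<epsilon>" by (simp add: min_def)
    then have *: "12 * min (1 / 8) (\<epsilon> / 12) * x \<le> \<epsilon> * x" if "x \<ge> 0" for x
      using that by (rule mult_right_mono)
    show "\<forall>\<^sub>F z in nhds 0. \<bar>Im (Dz G z)\<bar> \<le> \<epsilon> * (norm (Dz G z) + norm (Dw G z))"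
    proof (rule eventually_mono[OF main[OF min1 min.cobounded1]])
      fix z assume "small (min (1 / 8) (\<epsilon> / 12)) z"
      then have a: "\<bar>Im (Dz G z)\<bar> \<le> 12 * min (1 / 8) (\<epsilon> / 12) * (norm (Dz G z) + norm (Dw G z))"
        unfolding small_def by (elim conjE)
      show "\<bar>Im (Dz G z)\<bar> \<le> \<epsilon> * (norm (Dz G z) + norm (Dw G z))"
        by (rule order_trans[OF a *]) simp
    qed
    have "C * min (1 / 8) (\<epsilon> / C) \<le> \<epsilon>" using mult_left_mono[OF min.cobounded2[of "1 / 8" "\<epsilon> / C"], of C] C by simp
    then have *: "C * min (1 / 8) (\<epsilon> / C) * x \<le> \<epsilon> * x" if "x \<ge> 0" for x
      using that by (rule mult_right_mono)
    show "\<forall>\<^sub>F z in nhds 0. \<bar>(1 + m)\<^sup>2 * (norm (Dw G z))\<^sup>2 - (1 - m)\<^sup>2 * (norm (Dz G z))\<^sup>2\<bar> \<le>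
        \<epsilon> * ((norm (Dz G z))\<^sup>2 + (norm (Dw G z))\<^sup>2)"
    proof (rule eventually_mono[OF main[OF min2 min.cobounded1]])
      fix z assume "small (min (1 / 8) (\<epsilon> / C)) z"
      then have a: "\<bar>(1 + m)\<^sup>2 * (norm (Dw G z))\<^sup>2 - (1 - m)\<^sup>2 * (norm (Dz G z))\<^sup>2\<bar>
          \<le> C * min (1 / 8) (\<epsilon> / C) * ((norm (Dz G z))\<^sup>2 + (norm (Dw G z))\<^sup>2)"
        unfolding small_def by (elim conjE)
      show "\<bar>(1 + m)\<^sup>2 * (norm (Dw G z))\<^sup>2 - (1 - m)\<^sup>2 * (norm (Dz G z))\<^sup>2\<bar> \<le>
          \<epsilon> * ((norm (Dz G z))\<^sup>2 + (norm (Dw G z))\<^sup>2)"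
        by (rule order_trans[OF a *]) simp
    qed
  next
    have "A x0 *v u = t *\<^sub>R u" for u
      unfolding umb by (simp add: vec_eq_iff forall_2 matrix_vector_mult_def mat_def sum_2)
    then have "t *\<^sub>R DF x0 u = - DN x0 u" for u
      using Aspec[OF B(2), of u] linear_cmul[OF has_derivative_linear[OF dF[OF B(2)]]] by simp
    then have "M1 0 + t *\<^sub>R Y1 0 = 0" "M2 0 + t *\<^sub>R Y2 0 = 0"
      using Yv[OF V0] Mv[OF V0] by (simp_all add: l)
    moreover have "proj 0 = 0" by (simp add: proj_def complex_eq_iff)
    ultimately show "Dz G 0 = 0" "Dw G 0 = 0" unfolding Dz_def Dw_def dG[OF V0] by simp_all
  next
    show "\<not> (\<forall>\<^sub>F z in nhds 0. Dz G z = 0 \<and> Dw G z = 0)"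
    proof
      assume "\<forall>\<^sub>F z in nhds 0. Dz G z = 0 \<and> Dw G z = 0"
      moreover have "\<forall>\<^sub>F z in nhds 0. Dz G z = 0 \<and> Dw G z = 0 \<longrightarrow> k1 (x0 + l z) = t \<and> k2 (x0 + l z) = t"
        by (rule eventually_mono[OF main[of "1 / 8"]]) (simp_all add: small_def)
      ultimately have "\<forall>\<^sub>F z in nhds 0. k1 (x0 + l z) = t \<and> k2 (x0 + l z) = t"
        by eventually_elim simp
      then show False using evB'[of "\<lambda>x. k1 x = t \<and> k2 x = t"] nonconst by simp
    qed
  qed
qed

text \<open>Near an interior point the local smooth extension coincides with f on an open set, so
  its derivatives are those of f.\<close>

lemma smooth_on_interior:
  assumes "smooth_on S f" "x \<in> interior S"
  shows "\<exists>B. open B \<and> x \<in> B \<and> B \<subseteq> interior S \<and> smooth_open B f"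
proof -
  have "x \<in> S" using assms(2) interior_subset by blast
  then obtain U g where U: "open U" "x \<in> U" "\<forall>k. Ck_on_open k U g" "\<forall>y\<in>S \<inter> U. g y = f y"
    using assms(1) unfolding smooth_on_def by blast
  have o: "open (interior S \<inter> U)" using U by auto
  have "smooth_open U g" using U(3) by (simp add: smooth_open_def)
  then have "smooth_open (interior S \<inter> U) g" by (rule smooth_open_subset) simp
  moreover have "g y = f y" if "y \<in> interior S \<inter> U" for y
    using U(4) subsetD[OF interior_subset, of y S] that by simp
  ultimately have "smooth_open (interior S \<inter> U) f"
    using smooth_open_cong[OF o] by metis
  then show ?thesis using o U(2) assms(2) by (intro exI[of _ "interior S \<inter> U"]) simp
qed

lemma chart_inverse:
  assumes "is_chart M c" "q \<in> dom_of c"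
  shows "inv_into (dom_of c) (coord c) (coord c q) = q"
proof -
  have "inj_on (coord c) (topspace (subtopology M (dom_of c)))"
    using assms(1) unfolding is_chart_def by (blast intro: homeomorphic_imp_injective_map)
  moreover have "dom_of c \<subseteq> topspace M"
    using assms(1) unfolding is_chart_def by (blast dest: openin_subset)
  ultimately show ?thesis using assms(2) by (simp add: inv_into_f_f inf_absorb2)
qed

text \<open>A chart is an open map onto its image, and at points interior to that image relatively
  open sets contain open ones; this moves neighbourhoods on the surface into the plane.\<close>

lemma chart_neighbourhood_image:
  assumes c: "is_chart M c" "p \<in> dom_of c" "coord c p \<in> interior (coord c ` dom_of c)"
    and W: "openin M W" "p \<in> W"
  shows "\<exists>B. open B \<and> coord c p \<in> B \<and> B \<subseteq> interior (coord c ` dom_of c) \<and>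
    (\<forall>x\<in>B. \<exists>q\<in>W \<inter> dom_of c. coord c q = x \<and> inv_into (dom_of c) (coord c) x = q)"
proof -
  let ?S = "coord c ` dom_of c"
  have "open_map (subtopology M (dom_of c)) (top_of_set ?S) (coord c)"
    using c(1) unfolding is_chart_def by (blast intro: homeomorphic_imp_open_map)
  moreover have "openin (subtopology M (dom_of c)) (W \<inter> dom_of c)"
    unfolding openin_subtopology using W(1) by blast
  ultimately have "openin (top_of_set ?S) (coord c ` (W \<inter> dom_of c))"
    by (simp add: open_map_def)
  then obtain T where T: "open T" "coord c ` (W \<inter> dom_of c) = ?S \<inter> T"
    unfolding openin_open by (elim exE conjE)
  have "coord c p \<in> coord c ` (W \<inter> dom_of c)" using W(2) c(2) by simp
  then have p: "coord c p \<in> T" unfolding T(2) by simp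
  have "\<exists>q\<in>W \<inter> dom_of c. coord c q = x \<and> inv_into (dom_of c) (coord c) x = q" if x: "x \<in> interior ?S \<inter> T" for x
  proof -
    have "x \<in> coord c ` (W \<inter> dom_of c)" unfolding T(2) using subsetD[OF interior_subset, of x ?S] x by simp
    then obtain q where q: "x = coord c q" "q \<in> W \<inter> dom_of c" by (rule imageE)
    then show ?thesis using chart_inverse[OF c(1), of q] by (intro bexI[of _ q]) simp_all
  qed
  then show ?thesis using T(1) p c(3) by (intro exI[of _ "interior ?S \<inter> T"]) (simp add: open_Int)
qed

lemma chart_preimage_open:
  assumes c: "is_chart M c" and B: "open B"
  shows "openin M {q \<in> dom_of c. coord c q \<in> B}"
proof -
  let ?S = "coord c ` dom_of c"
  have o: "openin M (dom_of c)" using c unfolding is_chart_def by blast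
  then have top: "topspace (subtopology M (dom_of c)) = dom_of c" using openin_subset by fastforce
  have "continuous_map (subtopology M (dom_of c)) (top_of_set ?S) (coord c)"
    using c unfolding is_chart_def by (blast intro: homeomorphic_imp_continuous_map)
  moreover have "openin (top_of_set ?S) (?S \<inter> B)" using B by (auto simp: openin_open)
  ultimately have "openin (subtopology M (dom_of c)) {q \<in> topspace (subtopology M (dom_of c)). coord c q \<in> ?S \<inter> B}"
    by (rule openin_continuous_map_preimage)
  then have "openin M {q \<in> dom_of c. coord c q \<in> ?S \<inter> B}"
    unfolding top using o by (rule openin_trans_full)
  moreover have "{q \<in> dom_of c. coord c q \<in> ?S \<inter> B} = {q \<in> dom_of c. coord c q \<in> B}" by auto
  ultimately show ?thesis by simp
qed

lemma coord_deriv_interior: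
  assumes "coord c q \<in> interior (coord c ` dom_of c)"
  shows "coord_deriv c f q = frechet_derivative (coord_rep c f) (at (coord c q))"
  unfolding coord_deriv_def at_within_interior[OF assms] ..

lemma nonvertical_line:
  assumes L: "line_through_origin L" and nv: "\<not> (\<forall>x\<in>L. x $ 1 = 0)"
  obtains m where "slope L = ereal m" "\<And>x. x \<in> L \<Longrightarrow> x $ 2 = m * x $ 1" "0 \<in> L"
proof -
  have sub: "subspace L" and dim: "dim L = 1" using L by (auto simp: line_through_origin_def)
  obtain y where y: "y \<in> L" "y $ 1 \<noteq> 0" using nv by blast
  have "span {y} = L"
  proof (rule subspace_dim_equal)
    show "span {y} \<subseteq> L" using y sub by (simp add: span_minimal)
    have "y \<noteq> 0" using y by auto
    then show "dim L \<le> dim (span {y})" using dim by simp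
  qed (use sub in auto)
  define m where "m = y $ 2 / y $ 1"
  have m: "x $ 2 = m * x $ 1" if "x \<in> L" for x
  proof -
    have "x \<in> span {y}" using \<open>span {y} = L\<close> that by simp
    then obtain k where "x = k *\<^sub>R y" by (auto simp: span_singleton)
    then show ?thesis using y by (simp add: m_def)
  qed
  have "(THE m. \<forall>x\<in>L. x $ 2 = m * x $ 1) = m"
  proof (rule the_equality)
    show "\<forall>x\<in>L. x $ 2 = m * x $ 1" using m by blast
    fix m' assume "\<forall>x\<in>L. x $ 2 = m' * x $ 1"
    then have "m' * y $ 1 = m * y $ 1" using m[OF y(1)] y(1) by simp
    then show "m' = m" using y(2) by simp
  qed
  then have "slope L = ereal m" using nv by (simp add: slope_def)
  then show ?thesis using that m subspace_0[OF sub] by blast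
qed

text \<open>The functional x2 - m x1 vanishes on L and is Lipschitz with constant 1 + |m|.\<close>

lemma infdist_line_bound:
  fixes v :: "real^2"
  assumes "L \<noteq> {}" "\<And>x. x \<in> L \<Longrightarrow> x $ 2 = m * x $ 1"
  shows "\<bar>v $ 2 - m * v $ 1\<bar> \<le> (1 + \<bar>m\<bar>) * infdist v L"
proof -
  have pos: "1 + \<bar>m\<bar> > 0" by linarith
  have "\<bar>v $ 2 - m * v $ 1\<bar> / (1 + \<bar>m\<bar>) \<le> dist v y" if "y \<in> L" for y
  proof -
    have "v $ 2 - m * v $ 1 = (v - y) $ 2 - m * (v - y) $ 1" using assms(2)[OF that] by (simp add: algebra_simps)
    also have "\<bar>\<dots>\<bar> \<le> \<bar>(v - y) $ 2\<bar> + \<bar>m\<bar> * \<bar>(v - y) $ 1\<bar>" by (metis abs_mult abs_triangle_ineq4)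
    also have "\<dots> \<le> norm (v - y) + \<bar>m\<bar> * norm (v - y)"
      by (intro add_mono mult_left_mono component_le_norm_cart) auto
    finally have "\<bar>v $ 2 - m * v $ 1\<bar> \<le> (1 + \<bar>m\<bar>) * dist v y" by (simp add: dist_norm algebra_simps)
    then show ?thesis using pos by (simp add: pos_divide_le_eq mult.commute)
  qed
  then have "\<bar>v $ 2 - m * v $ 1\<bar> / (1 + \<bar>m\<bar>) \<le> infdist v L"
    unfolding infdist_notempty[OF assms(1)] using assms(1) by (intro cINF_greatest)
  then show ?thesis using pos by (simp add: pos_divide_le_eq mult.commute)
qed

theorem theorem1p2:
  fixes M :: "'a topology" and \<A> :: "'a chart set"
    and X N :: "'a \<Rightarrow> real^3" and p :: 'a and t :: real
    and \<kappa>1 \<kappa>2 :: "'a \<Rightarrow> real" and L :: "(real^2) set"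
  assumes "smooth_surface M \<A>"
    and "smooth_immersion M \<A> X"
    and "p \<in> topspace M" and "interior_point \<A> p"
    and "unit_normal_near M \<A> X p N"
    and "umbilic_at \<A> X N p t"
    and "continuous_labeling_near M \<A> X N p \<kappa>1 \<kappa>2"
    and "nonconstant_germ M p \<kappa>1 \<kappa>2 t"
    and "secant_tangent M p \<kappa>1 \<kappa>2 t L"
  shows "slope L \<in> admissible_slopes"
proof (cases "\<forall>x\<in>L. x $ 1 = 0")
  case True
  then show ?thesis by (simp add: slope_def admissible_slopes_def)
next
  case False
  have line: "line_through_origin L" using assms(9) by (simp add: secant_tangent_def)
  obtain m where slope: "slope L = ereal m" and Lm: "\<And>x. x \<in> L \<Longrightarrow> x $ 2 = m * x $ 1" and L0: "0 \<in> L"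
    using nonvertical_line[OF line False] by blast
  obtain c where c: "c \<in> \<A>" "p \<in> dom_of c" and pint: "coord c p \<in> interior (coord c ` dom_of c)"
    using assms(4) unfolding interior_point_def by blast
  have chart: "is_chart M c" using assms(1) c by (auto simp: smooth_surface_def)
  define S where "S = coord c ` dom_of c"
  define \<psi> where "\<psi> = inv_into (dom_of c) (coord c)"
  define x0 where "x0 = coord c p"
  note nbhd = chart_neighbourhood_image[OF chart c(2) pint, folded S_def \<psi>_def x0_def]
  have x0: "x0 \<in> interior S" using pint by (simp add: x0_def S_def)
  have \<psi>x0: "\<psi> x0 = p" unfolding \<psi>_def x0_def by (rule chart_inverse[OF chart c(2)])
  define F where "F = coord_rep c X"
  define Nn where "Nn = coord_rep c N"
  have rep: "coord_rep c f x = f (\<psi> x)" for f :: "'a \<Rightarrow> real^3" and x by (simp add: coord_rep_def \<psi>_def)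
  have "openin M (dom_of c)" using chart unfolding is_chart_def by blast
  then have dom: "dom_of c \<inter> topspace M = dom_of c" using openin_subset by (metis inf.absorb1)
  have "smooth_on (coord c ` (dom_of c \<inter> topspace M)) (coord_rep c X)"
    using assms(2) c(1) unfolding smooth_immersion_def smooth_map_on_def by blast
  then have "smooth_on S F" unfolding dom S_def F_def .
  then obtain B1 where B1: "open B1" "x0 \<in> B1" "B1 \<subseteq> interior S" "smooth_open B1 F"
    using smooth_on_interior x0 by blast
  obtain W where W: "openin M W" "p \<in> W" "smooth_map_on \<A> W N"
    and N: "\<forall>q\<in>W. norm (N q) = 1 \<and> (\<forall>c\<in>\<A>. q \<in> dom_of c \<longrightarrow> (\<forall>u. N q \<bullet> coord_deriv c X q u = 0))"
    using assms(5) unfolding unit_normal_near_def by (elim exE conjE)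
  obtain V where V: "openin M V" "p \<in> V"
    and eig: "\<forall>q\<in>V. \<forall>c\<in>\<A>. q \<in> dom_of c \<longrightarrow> eigenvalues_with_mult (shape_operator X N c q) (\<kappa>1 q) (\<kappa>2 q)"
    using assms(7) unfolding continuous_labeling_near_def by (elim exE conjE)
  \<comment> \<open>Shrinks the chart to where both the unit normal and the labeling are
    available.\<close>
  obtain B2 where B2: "open B2" "x0 \<in> B2" "B2 \<subseteq> interior S"
    "\<forall>x\<in>B2. \<exists>q\<in>(W \<inter> V) \<inter> dom_of c. coord c q = x \<and> \<psi> x = q"
    using nbhd[OF openin_Int[OF W(1) V(1)] IntI[OF W(2) V(2)]] by (elim exE conjE)
  have "B2 \<subseteq> coord c ` (dom_of c \<inter> W)"
  proof
    fix x assume "x \<in> B2"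
    from bspec[OF B2(4) this] have "\<psi> x \<in> dom_of c \<inter> W" "coord c (\<psi> x) = x" by auto
    then show "x \<in> coord c ` (dom_of c \<inter> W)" by (metis imageI)
  qed
  then have "x0 \<in> interior (coord c ` (dom_of c \<inter> W))" using B2(1,2) by (meson interiorI)
  moreover have "smooth_on (coord c ` (dom_of c \<inter> W)) Nn"
    using W(3) c(1) unfolding smooth_map_on_def Nn_def by blast
  ultimately obtain B3 where B3: "open B3" "x0 \<in> B3" "smooth_open B3 Nn"
    using smooth_on_interior by blast
  define B where "B = B1 \<inter> B2 \<inter> B3"
  have B: "open B" "x0 \<in> B" using B1 B2 B3 by (auto simp: B_def)
  have smF: "smooth_open B F" and smN: "smooth_open B Nn"
    using B1 B3 by (auto intro: smooth_open_subset simp: B_def)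
  have q: "\<psi> x \<in> W" "\<psi> x \<in> V" "\<psi> x \<in> dom_of c" "coord c (\<psi> x) = x" if "x \<in> B" for x
  proof -
    have "x \<in> B2" using that by (simp add: B_def)
    from bspec[OF B2(4) this] show "\<psi> x \<in> W" "\<psi> x \<in> V" "\<psi> x \<in> dom_of c" "coord c (\<psi> x) = x" by auto
  qed
  have deriv: "coord_deriv c f (\<psi> x) = frechet_derivative (coord_rep c f) (at x)" if "x \<in> B" for f :: "'a \<Rightarrow> real^3" and x
  proof -
    have "x \<in> interior S" using that B1(3) unfolding B_def by blast
    then have "coord c (\<psi> x) \<in> interior (coord c ` dom_of c)" unfolding q(4)[OF that] S_def .
    from coord_deriv_interior[OF this, of f] show ?thesis unfolding q(4)[OF that] .
  qed
  have shape: "shape_operator X N c (\<psi> x) =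
      (THE A. \<forall>u. frechet_derivative F (at x) (A *v u) = - frechet_derivative Nn (at x) u)" if "x \<in> B" for x
    unfolding shape_operator_def deriv[OF that] F_def Nn_def ..
  define v where "v = curvature_deviation \<kappa>1 \<kappa>2 t"
  have v: "v r $ 1 = \<kappa>1 r - t" "v r $ 2 = \<kappa>2 r - t" for r by (simp_all add: v_def curvature_deviation_def)
  have v0: "v r = 0 \<longleftrightarrow> \<kappa>1 r = t \<and> \<kappa>2 r = t" for r by (simp add: vec_eq_iff forall_2 v)
  have umb: "shape_operator X N c p = mat t" using assms(6) c unfolding umbilic_at_def by blast
  \<comment> \<open>The curvatures at p have sum 2 t and product t^2, hence both equal t. A point
    with nonzero deviation is thus different from p, as the filter in the secant limit
    requires.\<close>
  have vp: "v p = 0"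
  proof -
    have "eigenvalues_with_mult (mat t) (\<kappa>1 p) (\<kappa>2 p)" using eig V(2) c umb by metis
    from eigenvalues_trace_det[OF this] have "\<kappa>1 p + \<kappa>2 p = 2 * t" "\<kappa>1 p * \<kappa>2 p = t * t"
      by (simp_all add: mat_def)
    then have "(\<kappa>1 p - t)\<^sup>2 + (\<kappa>2 p - t)\<^sup>2 = 0"
    proof -
      have "(\<kappa>1 p - t)\<^sup>2 + (\<kappa>2 p - t)\<^sup>2 = (\<kappa>1 p + \<kappa>2 p)\<^sup>2 - 2 * (\<kappa>1 p * \<kappa>2 p) - 2 * t * (\<kappa>1 p + \<kappa>2 p) + 2 * t * t"
        by (simp add: power2_eq_square algebra_simps)
      also have "\<dots> = 0" unfolding \<open>\<kappa>1 p + \<kappa>2 p = 2 * t\<close> \<open>\<kappa>1 p * \<kappa>2 p = t * t\<close> by (simp add: power2_eq_square)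
      finally show ?thesis .
    qed
    then show ?thesis unfolding v0 by (simp add: sum_power2_eq_zero_iff)
  qed
  have secant: "\<forall>\<^sub>F x in nhds x0. \<bar>(\<kappa>2 (\<psi> x) - t) - m * (\<kappa>1 (\<psi> x) - t)\<bar> \<le> \<epsilon> * (\<bar>\<kappa>1 (\<psi> x) - t\<bar> + \<bar>\<kappa>2 (\<psi> x) - t\<bar>)"
    if "\<epsilon> > 0" for \<epsilon>
  proof -
    \<comment> \<open>Compensates the Lipschitz constant in
      \<open>infdist_line_bound\<close>.\<close>
    define \<delta> where "\<delta> = \<epsilon> / (1 + \<bar>m\<bar>)"
    have m1: "1 + \<bar>m\<bar> > 0" by linarith
    have \<delta>: "\<delta> > 0" using that m1 by (simp add: \<delta>_def)
    have "((\<lambda>q. infdist (v q) L / norm (v q)) \<longlongrightarrow> 0) (atin_within M p {q. v q \<noteq> 0})"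
      using assms(9) unfolding secant_tangent_def Let_def v_def by blast
    then have "\<forall>\<^sub>F q in atin_within M p {q. v q \<noteq> 0}. infdist (v q) L / norm (v q) < \<delta>"
      using \<delta> by (rule order_tendstoD(2))
    then have "\<exists>T. openin M T \<and> p \<in> T \<and> (\<forall>q\<in>T. v q \<noteq> 0 \<and> q \<noteq> p \<longrightarrow> infdist (v q) L / norm (v q) < \<delta>)"
      using assms(3) unfolding eventually_atin_within mem_Collect_eq by simp
    then obtain T where T: "openin M T" "p \<in> T"
      "\<forall>q\<in>T. v q \<noteq> 0 \<and> q \<noteq> p \<longrightarrow> infdist (v q) L / norm (v q) < \<delta>"
      by (elim exE conjE)
    obtain B' where B': "open B'" "x0 \<in> B'" "\<forall>x\<in>B'. \<exists>q\<in>T \<inter> dom_of c. coord c q = x \<and> \<psi> x = q"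
      using nbhd[OF T(1,2)] by (elim exE conjE)
    have "\<bar>(\<kappa>2 (\<psi> x) - t) - m * (\<kappa>1 (\<psi> x) - t)\<bar> \<le> \<epsilon> * (\<bar>\<kappa>1 (\<psi> x) - t\<bar> + \<bar>\<kappa>2 (\<psi> x) - t\<bar>)" if "x \<in> B'" for x
    proof (cases "v (\<psi> x) = 0")
      case True
      then show ?thesis unfolding v0 by simp
    next
      case False
      define w where "w = v (\<psi> x)"
      have nw: "norm w > 0" using False by (simp add: w_def)
      have "\<psi> x \<noteq> p" using False vp by auto
      moreover have "\<psi> x \<in> T" using bspec[OF B'(3) that] by auto
      ultimately have "infdist w L / norm w < \<delta>" using T(3) False unfolding w_def by simp
      then have i: "infdist w L \<le> \<delta> * norm w" using nw by (simp add: divide_less_eq)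
      have "\<bar>w $ 2 - m * w $ 1\<bar> \<le> (1 + \<bar>m\<bar>) * infdist w L"
        by (rule infdist_line_bound[OF _ Lm]) (use L0 in auto)
      also have "\<dots> \<le> (1 + \<bar>m\<bar>) * (\<delta> * norm w)" using i m1 by (intro mult_left_mono) auto
      also have "\<dots> = \<epsilon> * norm w" using m1 by (simp add: \<delta>_def)
      also have "\<dots> \<le> \<epsilon> * (\<bar>w $ 1\<bar> + \<bar>w $ 2\<bar>)"
        using \<open>\<epsilon> > 0\<close> norm_le_l1_cart[of w] by (intro mult_left_mono) (auto simp: sum_2)
      finally show ?thesis by (simp add: w_def v)
    qed
    then show ?thesis using B'(1,2) unfolding eventually_nhds by blast
  qed
  have nonconst: "\<not> (\<forall>\<^sub>F x in nhds x0. \<kappa>1 (\<psi> x) = t \<and> \<kappa>2 (\<psi> x) = t)"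
  proof
    assume "\<forall>\<^sub>F x in nhds x0. \<kappa>1 (\<psi> x) = t \<and> \<kappa>2 (\<psi> x) = t"
    then obtain B' where B': "open B'" "x0 \<in> B'" "\<And>x. x \<in> B' \<Longrightarrow> \<kappa>1 (\<psi> x) = t \<and> \<kappa>2 (\<psi> x) = t"
      unfolding eventually_nhds by blast
    have "openin M {q \<in> dom_of c. coord c q \<in> B'}" by (rule chart_preimage_open[OF chart B'(1)])
    moreover have "p \<in> {q \<in> dom_of c. coord c q \<in> B'}" using c B' by (simp add: x0_def)
    ultimately obtain r where r: "r \<in> dom_of c" "coord c r \<in> B'" "v r \<noteq> 0"
      using assms(8) unfolding nonconstant_germ_def v_def by blast
    have "\<psi> (coord c r) = r" unfolding \<psi>_def by (rule chart_inverse[OF chart r(1)])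
    then show False using B'(3)[OF r(2)] r(3) v0 by simp
  qed
  show ?thesis
  proof (cases "m = 0 \<or> m = -1")
    case True
    then show ?thesis unfolding slope admissible_slopes_def by (auto simp: zero_ereal_def one_ereal_def)
  next
    case False
    have "\<exists>j\<ge>1. m = 2 * real j + 1 \<or> m = 1 / (2 * real j + 1)"
    proof (rule plane_slope[OF B smF smN _ _ _ _ _ _ _ secant nonconst])
      fix x assume x: "x \<in> B"
      have "inj (coord_deriv c X (\<psi> x))" using assms(2) c q[OF x] unfolding smooth_immersion_def by blast
      then show "inj (frechet_derivative F (at x))" unfolding deriv[OF x] F_def .
      show "norm (Nn x) = 1" using N q(1)[OF x] by (simp add: Nn_def rep)
      show "Nn x \<bullet> frechet_derivative F (at x) u = 0" for u
      proof -
        have "N (\<psi> x) \<bullet> coord_deriv c X (\<psi> x) u = 0" using N q(1,3)[OF x] c(1) by blast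
        then show ?thesis unfolding deriv[OF x] Nn_def F_def rep .
      qed
      show "eigenvalues_with_mult (THE A. \<forall>u. frechet_derivative F (at x) (A *v u) = - frechet_derivative Nn (at x) u)
          (\<kappa>1 (\<psi> x)) (\<kappa>2 (\<psi> x))"
      proof -
        have "eigenvalues_with_mult (shape_operator X N c (\<psi> x)) (\<kappa>1 (\<psi> x)) (\<kappa>2 (\<psi> x))"
          using eig q(2,3)[OF x] c(1) by blast
        then show ?thesis unfolding shape[OF x] .
      qed
    next
      show "(THE A. \<forall>u. frechet_derivative F (at x0) (A *v u) = - frechet_derivative Nn (at x0) u) = mat t"
        using umb shape[OF B(2)] \<psi>x0 by simp
    qed (use False in auto)
    then show ?thesis unfolding slope admissible_slopes_def by auto
  qed
qed

end
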